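(* Let $G$ be a Lie group with Lie algebra $\mathfrak g$ and let $n\geq1$. The tangent group $T(T^{n-1}G)$ has the structure of a double cross product of the $n$th order tangent group $T^nG$ by $\mathfrak g^{\times\,n-1}$. In short, there is an isomorphism of Lie groups $$T(T^{n-1}G)\cong\mathfrak g^{\times\,n-1}\bowtie T^nG.$$
   Context: $n$th order tangent group. $T^nG$ is the set of classes $[p]$ of curves $p(t)\in G$, two curves being equivalent if they have the same derivatives up to order $n$ at $t=0$; it is a Lie group with $[p][q]:=[pq]$; $T^0G:=G$. With the left logarithmic derivative $\delta^\ell p:=p^{-1}p'$, the left trivialization $[p]\mapsto(p(0),(\delta^\ell p)(0),(\delta^\ell p)'(0),\ldots,(\delta^\ell p)^{(n-1)}(0))$ identifies $T^nG$ with $G\times\mathfrak g^{\times n}$, with product $(x,\xi_1,\ldots,\xi_n)(y,\zeta_1,\ldots,\zeta_n)=(xy,\rho_1,\ldots,\rho_n)$, where $$\rho_k=\zeta_k+\sum_{i_1+\cdots+i_\ell=k}(-1)^{\ell-1}N_{(i_1,\ldots,i_\ell)}\,\mathrm{ad}_{\zeta_{i_{\ell-1}}}\cdots\mathrm{ad}_{\zeta_{i_1}}\mathrm{Ad}_{y^{-1}}\xi_{i_\ell},$$ the sum being over $\ell\geq1$ and positive integers $i_1,\ldots,i_\ell$, and $N_{(i_1,\ldots,i_\ell)}=\prod_{j=2}^{\ell}\binom{i_1+\cdots+i_j-1}{i_j-1}$. The group $\mathfrak g^{\times\,n-1}$ is the subgroup $T^{n-1}_eG=\{(e,X_1,\ldots,X_{n-1})\}$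 of $T^{n-1}G$ ($e$ the identity of $G$). For a Lie group $K$ with Lie algebra $\mathfrak k$, the tangent group $TK$ is identified by left trivialization with $K\ltimes\mathfrak k$, with product $(k_1,\xi_1)(k_2,\xi_2)=(k_1k_2,\xi_2+\mathrm{Ad}_{k_2^{-1}}\xi_1)$; here $K=T^{n-1}G$. In the paper, $T^nG$ and $\mathfrak g^{\times\,n-1}$ are viewed as subgroups of $T(T^{n-1}G)$ by $(x,\xi_1,\ldots,\xi_n)\mapsto(x,\xi_1,\ldots,\xi_{n-1};\xi_1,\ldots,\xi_n)$ and $(X_1,\ldots,X_{n-1})\mapsto(e,X_1,\ldots,X_{n-1};0,\ldots,0)$, where the Lie algebra of $T^{n-1}G$ is identified with $\mathfrak g^{\times n}$ by differentiating the left trivialization at the identity. Double cross product. Given Lie groups $K$ and $H$ with a smooth left action $\triangleright:H\times K\to K$ of $H$ on the manifold $K$ and a smooth right action $\triangleleft:H\times K\to H$ of $K$ on the manifold $H$ such that $h\triangleright e_K=e_K$, $e_H\triangleleft k=e_H$, $h\triangleright(k_1k_2)=(h\triangleright k_1)((h\triangleleft k_1)\triangleright k_2)$ and $(h_1h_2)\triangleleft k=(h_1\triangleleft(h_2\triangleright k))(h_2\triangleleft k)$, the double cross product $K\bowtie H$ is the Lie group $K\times H$ with product $(k_1,h_1)(k_2,h_2)=(k_1(h_1\triangleright k_2),(h_1\triangleleft k_2)h_2)$. "$T(T^{n-1}G)\cong\mathfrak g^{\times\,n-1}\bowtie T^nG$" means that this holds for some such pair of mutual actions. *)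

theory Defs
  imports "HOL-Analysis.Analysis" "HOL-Algebra.Group"
begin

section \<open>Smooth manifolds\<close>

text \<open>
  Dimensions vary with \<open>n\<close> and may be \<open>0\<close>, so \<open>\<real>\<^sup>d\<close> is the library's \<^const>\<open>Euclidean_space\<close> of dimension
  \<open>d\<close>: the functions \<open>nat \<Rightarrow> real\<close> vanishing at all \<open>i \<ge> d\<close>.  The product topology used by
  \<^const>\<open>continuous_on\<close> below induces the Euclidean topology on it.
  \<open>C_k_on k d U f\<close> says that all partial derivatives of \<open>f\<close> of order at most \<open>k\<close> exist and are
  continuous on the open set \<open>U\<close> of \<open>\<real>\<^sup>d\<close>.
\<close>

primrec C_k_on :: "nat \<Rightarrow> nat \<Rightarrow> (nat \<Rightarrow> real) set \<Rightarrow> ((nat \<Rightarrow> real) \<Rightarrow> real) \<Rightarrow> bool" where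
  "C_k_on 0 d U f \<longleftrightarrow> continuous_on U f"
| "C_k_on (Suc k) d U f \<longleftrightarrow> continuous_on U f \<and>
     (\<forall>i<d. \<exists>g. (\<forall>x\<in>U. ((\<lambda>t. f (x(i := t))) has_real_derivative g x) (at (x i))) \<and> C_k_on k d U g)"

definition C_infinity_on :: "nat \<Rightarrow> (nat \<Rightarrow> real) set \<Rightarrow> ((nat \<Rightarrow> real) \<Rightarrow> real) \<Rightarrow> bool" where
  "C_infinity_on d U f \<longleftrightarrow> (\<forall>k. C_k_on k d U f)"

record 'a manifold =
  points :: "'a set"
  mdim :: nat
  atlas :: "('a set \<times> ('a \<Rightarrow> nat \<Rightarrow> real)) set"

text \<open>
  The topology of a manifold is the one induced by its atlas, which need not be maximal.
\<close>

definition mtop :: "'a manifold \<Rightarrow> 'a topology" where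
  "mtop M = topology (\<lambda>U. U \<subseteq> points M \<and>
     (\<forall>(D, \<phi>)\<in>atlas M. openin (Euclidean_space (mdim M)) (\<phi> ` (U \<inter> D))))"

text \<open>
  Second countability is not required: it plays no role, and it is preserved by diffeomorphisms.
\<close>

definition smooth_manifold :: "'a manifold \<Rightarrow> bool" where
  "smooth_manifold M \<longleftrightarrow>
     (\<Union>(D, \<phi>)\<in>atlas M. D) = points M \<and>
     (\<forall>(D, \<phi>)\<in>atlas M. inj_on \<phi> D \<and> openin (Euclidean_space (mdim M)) (\<phi> ` D)) \<and>
     (\<forall>(D, \<phi>)\<in>atlas M. \<forall>(E, \<psi>)\<in>atlas M.
        openin (Euclidean_space (mdim M)) (\<phi> ` (D \<inter> E)) \<and>
        (\<forall>j<mdim M. C_infinity_on (mdim M) (\<phi> ` (D \<inter> E)) (\<lambda>u. \<psi> (inv_into D \<phi> u) j))) \<and>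
     Hausdorff_space (mtop M)"

definition smooth_map :: "'a manifold \<Rightarrow> 'b manifold \<Rightarrow> ('a \<Rightarrow> 'b) \<Rightarrow> bool" where
  "smooth_map M N f \<longleftrightarrow> continuous_map (mtop M) (mtop N) f \<and>
     (\<forall>(D, \<phi>)\<in>atlas M. \<forall>(E, \<psi>)\<in>atlas N. \<forall>j<mdim N.
        C_infinity_on (mdim M) (\<phi> ` (D \<inter> f -` E)) (\<lambda>u. \<psi> (f (inv_into D \<phi> u)) j))"

definition append_coords :: "nat \<Rightarrow> (nat \<Rightarrow> real) \<Rightarrow> (nat \<Rightarrow> real) \<Rightarrow> nat \<Rightarrow> real" where
  "append_coords d u v = (\<lambda>i. if i < d then u i else v (i - d))"

definition prod_manifold :: "'a manifold \<Rightarrow> 'b manifold \<Rightarrow> ('a \<times> 'b) manifold" where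
  "prod_manifold M N =
     \<lparr>points = points M \<times> points N,
      mdim = mdim M + mdim N,
      atlas = {(D \<times> E, \<lambda>(x, y). append_coords (mdim M) (\<phi> x) (\<psi> y)) | D \<phi> E \<psi>.
                 (D, \<phi>) \<in> atlas M \<and> (E, \<psi>) \<in> atlas N}\<rparr>"


section \<open>Lie groups\<close>

record 'a lie = "'a monoid" +
  mfd :: "'a manifold"

definition lie_group :: "'a lie \<Rightarrow> bool" where
  "lie_group G \<longleftrightarrow> group G \<and> smooth_manifold (mfd G) \<and> points (mfd G) = carrier G \<and>
     smooth_map (prod_manifold (mfd G) (mfd G)) (mfd G) (\<lambda>(x, y). x \<otimes>\<^bsub>G\<^esub> y) \<and>
     smooth_map (mfd G) (mfd G) (\<lambda>x. inv\<^bsub>G\<^esub> x)"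

definition lie_group_iso :: "'a lie \<Rightarrow> 'b lie \<Rightarrow> ('a \<Rightarrow> 'b) \<Rightarrow> bool" where
  "lie_group_iso G H f \<longleftrightarrow> lie_group G \<and> lie_group H \<and> f \<in> iso G H \<and>
     smooth_map (mfd G) (mfd H) f \<and> smooth_map (mfd H) (mfd G) (inv_into (carrier G) f)"


section \<open>Higher order tangent groups\<close>

text \<open>
  Only germs of curves at \<open>t = 0\<close> matter: a curve is a function on \<open>\<real>\<close> that is smooth on some open
  interval around \<open>0\<close>, small enough to be mapped into a chart.
\<close>

definition curve :: "'a manifold \<Rightarrow> (real \<Rightarrow> 'a) \<Rightarrow> bool" where
  "curve M p \<longleftrightarrow> (\<exists>(D, \<phi>)\<in>atlas M. \<exists>\<epsilon>>0. \<forall>t. \<bar>t\<bar> < \<epsilon> \<longrightarrow> p t \<in> D \<and>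
     (\<forall>j<mdim M. \<forall>k. (deriv ^^ k) (\<lambda>s. \<phi> (p s) j) field_differentiable at t))"

definition jet :: "nat \<Rightarrow> 'a manifold \<Rightarrow> (real \<Rightarrow> 'a) \<Rightarrow> (real \<Rightarrow> 'a) set" where
  "jet n M p = {q. curve M q \<and> q 0 = p 0 \<and>
     (\<forall>(D, \<phi>)\<in>atlas M. p 0 \<in> D \<longrightarrow>
        (\<forall>k\<le>n. \<forall>j<mdim M. (deriv ^^ k) (\<lambda>t. \<phi> (q t) j) 0 = (deriv ^^ k) (\<lambda>t. \<phi> (p t) j) 0))}"

text \<open>
  The chart of \<open>T\<^sup>nM\<close> induced by a chart \<open>\<phi>\<close> of \<open>M\<close> sends \<open>[p]\<close> to
  \<open>((\<phi> \<circ> p)(0), (\<phi> \<circ> p)'(0), \<dots>, (\<phi> \<circ> p)\<^bsup>(n)\<^esup>(0))\<close>; the \<open>k\<close>-th derivative occupies the coordinates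
  \<open>k * d, \<dots>, k * d + d - 1\<close>, where \<open>d\<close> is the dimension of \<open>M\<close>.
\<close>

definition jet_coords :: "nat \<Rightarrow> 'a manifold \<Rightarrow> ('a \<Rightarrow> nat \<Rightarrow> real) \<Rightarrow> (real \<Rightarrow> 'a) set \<Rightarrow> nat \<Rightarrow> real" where
  "jet_coords n M \<phi> A = (\<lambda>i. if i < Suc n * mdim M
     then (deriv ^^ (i div mdim M)) (\<lambda>t. \<phi> ((SOME p. p \<in> A) t) (i mod mdim M)) 0 else 0)"

definition jet_manifold :: "nat \<Rightarrow> 'a manifold \<Rightarrow> (real \<Rightarrow> 'a) set manifold" where
  "jet_manifold n M =
     \<lparr>points = {jet n M p | p. curve M p},
      mdim = Suc n * mdim M,
      atlas = {({jet n M p | p. curve M p \<and> p 0 \<in> D}, jet_coords n M \<phi>) | D \<phi>. (D, \<phi>) \<in> atlas M}\<rparr>"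

definition jet_mult :: "nat \<Rightarrow> 'a lie \<Rightarrow> (real \<Rightarrow> 'a) set \<Rightarrow> (real \<Rightarrow> 'a) set \<Rightarrow> (real \<Rightarrow> 'a) set" where
  "jet_mult n G A B = (\<Union>p\<in>A. \<Union>q\<in>B. jet n (mfd G) (\<lambda>t. p t \<otimes>\<^bsub>G\<^esub> q t))"

text \<open>
  The tangent group \<open>TG\<close> is the case \<open>n = 1\<close>.  For \<open>n = 0\<close> this is a copy of \<open>G\<close>, a curve being
  determined by \<open>p 0\<close> up to equivalence.
\<close>

definition tangent_group :: "nat \<Rightarrow> 'a lie \<Rightarrow> (real \<Rightarrow> 'a) set lie" where
  "tangent_group n G =
     \<lparr>carrier = {jet n (mfd G) p | p. curve (mfd G) p},
      mult = jet_mult n G,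
      one = jet n (mfd G) (\<lambda>_. \<one>\<^bsub>G\<^esub>),
      mfd = jet_manifold n (mfd G)\<rparr>"

text \<open>
  The subgroup \<open>T\<^sup>m\<^sub>eG\<close> of \<open>T\<^sup>mG\<close>, i.e. the group \<open>\<gg>\<^sup>\<times>\<^sup>m\<close>.  Its charts are those of \<open>T\<^sup>mG\<close> around \<open>e\<close>
  with the block of coordinates of the base point, which is constant here, removed.
\<close>

definition tangent_group_at_one :: "nat \<Rightarrow> 'a lie \<Rightarrow> (real \<Rightarrow> 'a) set lie" where
  "tangent_group_at_one m G =
     (let F = {jet m (mfd G) p | p. curve (mfd G) p \<and> p 0 = \<one>\<^bsub>G\<^esub>} in
      \<lparr>carrier = F,
       mult = jet_mult m G,
       one = jet m (mfd G) (\<lambda>_. \<one>\<^bsub>G\<^esub>),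
       mfd = \<lparr>points = F,
              mdim = m * mdim (mfd G),
              atlas = {(F, \<lambda>A i. jet_coords m (mfd G) \<phi> A (i + mdim (mfd G))) | D \<phi>.
                         (D, \<phi>) \<in> atlas (mfd G) \<and> \<one>\<^bsub>G\<^esub> \<in> D}\<rparr>\<rparr>)"

text \<open>
  The subgroups of \<open>T(T\<^sup>n\<^sup>-\<^sup>1G)\<close> that the factorization is about, described by curves.
  \<open>zero_section\<close> sends \<open>A \<in> T\<^sup>mG\<close> to the class of the constant curve \<open>A\<close>; in left trivializations it
  is \<open>(e, X\<^sub>1, \<dots>, X\<^sub>m) \<mapsto> (e, X\<^sub>1, \<dots>, X\<^sub>m; 0, \<dots>, 0)\<close> on \<open>T\<^sup>m\<^sub>eG\<close>.
  \<open>prolongation\<close> sends \<open>[p] \<in> T\<^sup>nG\<close> to the class of \<open>s \<mapsto> [t \<mapsto> p(s + t)] \<in> T\<^sup>n\<^sup>-\<^sup>1G\<close>.  In left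
  trivializations it is \<open>(x, \<xi>\<^sub>1, \<dots>, \<xi>\<^sub>n) \<mapsto> (x, \<xi>\<^sub>1, \<dots>, \<xi>\<^sub>n\<^sub>-\<^sub>1; \<xi>\<^sub>1, \<dots>, \<xi>\<^sub>n)\<close>: writing \<open>\<delta>p = p\<^sup>-\<^sup>1p'\<close> and
  \<open>r\<^sub>s(t) = p(t)\<^sup>-\<^sup>1p(s + t)\<close>, one has \<open>r\<^sub>0 = e\<close> and
  \<open>(\<delta>r\<^sub>s)(t) = \<delta>p(s + t) - Ad(r\<^sub>s(t)\<^sup>-\<^sup>1) \<delta>p(t)\<close>, whose \<open>s\<close>-derivative at \<open>s = 0\<close> is
  \<open>(\<delta>p)'(t) + [\<delta>p(t), \<delta>p(t)] = (\<delta>p)'(t)\<close>.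
\<close>

definition zero_section :: "nat \<Rightarrow> 'a lie \<Rightarrow> (real \<Rightarrow> 'a) set \<Rightarrow> (real \<Rightarrow> (real \<Rightarrow> 'a) set) set" where
  "zero_section m G A = jet 1 (mfd (tangent_group m G)) (\<lambda>_. A)"

definition prolongation :: "nat \<Rightarrow> 'a lie \<Rightarrow> (real \<Rightarrow> 'a) set \<Rightarrow> (real \<Rightarrow> (real \<Rightarrow> 'a) set) set" where
  "prolongation n G A =
     (\<Union>p\<in>A. jet 1 (mfd (tangent_group (n - 1) G)) (\<lambda>s. jet (n - 1) (mfd G) (\<lambda>t. p (s + t))))"



section \<open>Double cross products\<close>

text \<open>
  \<open>lact h k\<close> is the left action of \<open>H\<close> on \<open>K\<close>, and \<open>ract h k\<close> is the right action of \<open>K\<close> on \<open>H\<close>.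
\<close>

definition mutual_actions ::
  "'k lie \<Rightarrow> 'h lie \<Rightarrow> ('h \<Rightarrow> 'k \<Rightarrow> 'k) \<Rightarrow> ('h \<Rightarrow> 'k \<Rightarrow> 'h) \<Rightarrow> bool" where
  "mutual_actions K H lact ract \<longleftrightarrow>
     lie_group K \<and> lie_group H \<and>
     smooth_map (prod_manifold (mfd H) (mfd K)) (mfd K) (\<lambda>(h, k). lact h k) \<and>
     smooth_map (prod_manifold (mfd H) (mfd K)) (mfd H) (\<lambda>(h, k). ract h k) \<and>
     (\<forall>k\<in>carrier K. lact \<one>\<^bsub>H\<^esub> k = k) \<and>
     (\<forall>h\<^sub>1\<in>carrier H. \<forall>h\<^sub>2\<in>carrier H. \<forall>k\<in>carrier K. lact (h\<^sub>1 \<otimes>\<^bsub>H\<^esub> h\<^sub>2) k = lact h\<^sub>1 (lact h\<^sub>2 k)) \<and>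
     (\<forall>h\<in>carrier H. ract h \<one>\<^bsub>K\<^esub> = h) \<and>
     (\<forall>h\<in>carrier H. \<forall>k\<^sub>1\<in>carrier K. \<forall>k\<^sub>2\<in>carrier K. ract h (k\<^sub>1 \<otimes>\<^bsub>K\<^esub> k\<^sub>2) = ract (ract h k\<^sub>1) k\<^sub>2) \<and>
     (\<forall>h\<in>carrier H. lact h \<one>\<^bsub>K\<^esub> = \<one>\<^bsub>K\<^esub>) \<and>
     (\<forall>k\<in>carrier K. ract \<one>\<^bsub>H\<^esub> k = \<one>\<^bsub>H\<^esub>) \<and>
     (\<forall>h\<in>carrier H. \<forall>k\<^sub>1\<in>carrier K. \<forall>k\<^sub>2\<in>carrier K.
        lact h (k\<^sub>1 \<otimes>\<^bsub>K\<^esub> k\<^sub>2) = lact h k\<^sub>1 \<otimes>\<^bsub>K\<^esub> lact (ract h k\<^sub>1) k\<^sub>2) \<and>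
     (\<forall>h\<^sub>1\<in>carrier H. \<forall>h\<^sub>2\<in>carrier H. \<forall>k\<in>carrier K.
        ract (h\<^sub>1 \<otimes>\<^bsub>H\<^esub> h\<^sub>2) k = ract h\<^sub>1 (lact h\<^sub>2 k) \<otimes>\<^bsub>H\<^esub> ract h\<^sub>2 k)"

definition double_cross_product ::
  "'k lie \<Rightarrow> 'h lie \<Rightarrow> ('h \<Rightarrow> 'k \<Rightarrow> 'k) \<Rightarrow> ('h \<Rightarrow> 'k \<Rightarrow> 'h) \<Rightarrow> ('k \<times> 'h) lie" where
  "double_cross_product K H lact ract =
     \<lparr>carrier = carrier K \<times> carrier H,
      mult = (\<lambda>(k\<^sub>1, h\<^sub>1) (k\<^sub>2, h\<^sub>2). (k\<^sub>1 \<otimes>\<^bsub>K\<^esub> lact h\<^sub>1 k\<^sub>2, ract h\<^sub>1 k\<^sub>2 \<otimes>\<^bsub>H\<^esub> h\<^sub>2)),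
      one = (\<one>\<^bsub>K\<^esub>, \<one>\<^bsub>H\<^esub>),
      mfd = prod_manifold (mfd K) (mfd H)\<rparr>"

end

theory Submission
  imports Defs
begin

text \<open>
  A Lie group \<open>L\<close> in which every element factors uniquely as \<open>i k \<otimes> p h\<close>, with homomorphisms \<open>i : K \<rightarrow> L\<close>, \<open>p : H \<rightarrow> L\<close> and both
  factors depending smoothly on the element, is the double cross product of \<open>K\<close> and \<open>H\<close>.  Here the factorization of the
  class of \<open>s \<mapsto> [t \<mapsto> w(s, t)]\<close> asks for curves \<open>q\<close> with \<open>q(0) = e\<close> and \<open>c\<close> such that \<open>w(0, t) = q(t) c(t)\<close> and
  \<open>\<partial>\<^sub>sw(0, t) = q(t) c'(t)\<close> hold up to order \<open>n - 1\<close> at \<open>t = 0\<close>.  Eliminating \<open>q\<close> leaves the differential equation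
  \<open>c' = c w(0, \<cdot>)\<^sup>-\<^sup>1 \<partial>\<^sub>sw(0, \<cdot>)\<close> with initial value \<open>c(0) = w(0, 0)\<close>.  In a chart it determines the \<open>n\<close>-jet of \<open>c\<close> recursively,
  each derivative being a smooth function of the preceding ones and of the coordinates of the given class.
\<close>

section \<open>Differential calculus on Euclidean spaces\<close>

text \<open>Comparing base jets in a factorization gives \<open>A [c] = [w]\<close>, so the first
  factor is forced to be the jet of \<open>w c^(-1)\<close> and only \<open>c\<close> is sought. The
  product of the two factors is then represented by the ternary expression \<open>x y^(-1) z\<close>
  at \<open>w(t)\<close>, \<open>c(t)\<close>, \<open>c(s + t)\<close>. All entries and the value
  lie near one base point, so the condition can be written in a single chart around that point,
  without passing to the Lie algebra. As \<open>x y^(-1) (y x^(-1) z) = z\<close>, the derivative in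
  \<open>z\<close> is inverted by exchanging \<open>x\<close> and \<open>y\<close>, which puts the
  equation into explicit form. Only jets are available. The condition holds up to order
  \<open>n - 1\<close> and involves \<open>c'\<close>, so it determines exactly the
  \<open>n\<close>-jet of \<open>c\<close>; and a class in the iterated tangent group carries no
  chosen map \<open>w(s, t)\<close>, so a curve for the base jet and a Taylor polynomial for the
  \<open>s\<close>-derivative stand in for it. The coordinates of the product are derivatives in
  \<open>s\<close> of derivatives in \<open>t\<close>; exchanging them rests on the symmetry of
  mixed partial derivatives, developed here from the coordinatewise notion of smoothness.\<close>

abbreviation eopen :: "nat \<Rightarrow> (nat \<Rightarrow> real) set \<Rightarrow> bool" where
  "eopen d \<equiv> openin (Euclidean_space d)"

abbreviation esp :: "nat \<Rightarrow> (nat \<Rightarrow> real) set" where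
  "esp d \<equiv> topspace (Euclidean_space d)"

lemma esp_iff: "x \<in> esp d \<longleftrightarrow> (\<forall>i\<ge>d. x i = 0)"
  by (simp add: topspace_Euclidean_space)

lemma eopen_iff: "eopen d U \<longleftrightarrow> (\<exists>T. open T \<and> U = esp d \<inter> T)"
proof -
  have "Euclidean_space d = top_of_set (esp d)"
    by (subst Euclidean_space_def) (simp add: topspace_Euclidean_space euclidean_product_topology)
  then show ?thesis by (metis openin_open)
qed

lemma eopen_trans:
  assumes "openin (top_of_set U) S" "eopen d U" shows "eopen d S"
proof -
  obtain T T' where "open T" "U = esp d \<inter> T" "open T'" "S = U \<inter> T'"
    using assms by (auto simp: eopen_iff openin_open)
  then show ?thesis unfolding eopen_iff by (intro exI[of _ "T \<inter> T'"]) auto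
qed

lemma eopen_esp: "eopen d U \<Longrightarrow> x \<in> U \<Longrightarrow> i \<ge> d \<Longrightarrow> x i = 0"
  using openin_subset esp_iff by blast

lemma esp_eqI: "x \<in> esp d \<Longrightarrow> y \<in> esp d \<Longrightarrow> (\<And>i. i < d \<Longrightarrow> x i = y i) \<Longrightarrow> x = y"
  unfolding esp_iff by (rule ext) (metis linorder_not_le)

text \<open>Induction on the number of coordinates instead of a minimum over them, since the
  dimension may be \<open>0\<close>.\<close>

lemma common_radius:
  fixes d :: nat
  assumes "\<And>i. i < d \<Longrightarrow> \<exists>\<delta>>0. \<forall>y. \<bar>y - x i\<bar> < \<delta> \<longrightarrow> P i y"
  shows "\<exists>\<delta>>0::real. \<forall>i<d. \<forall>y. \<bar>y - x i\<bar> < \<delta> \<longrightarrow> P i y"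
  using assms
proof (induction d)
  case 0
  then show ?case by (intro exI[of _ 1]) auto
next
  case (Suc d)
  then obtain \<delta> where \<delta>: "\<delta> > 0" "\<forall>i<d. \<forall>y. \<bar>y - x i\<bar> < \<delta> \<longrightarrow> P i y" by (meson less_SucI)
  obtain \<delta>' where \<delta>': "\<delta>' > 0" "\<forall>y. \<bar>y - x d\<bar> < \<delta>' \<longrightarrow> P d y" using Suc.prems by blast
  show ?case
    by (rule exI[of _ "min \<delta> \<delta>'"]) (use \<delta> \<delta>' in \<open>auto simp: less_Suc_eq\<close>)
qed

text \<open>From index \<open>d\<close> on all points of \<open>esp d\<close> agree with
  \<open>x\<close>, so a basic open set of the infinite product constrains only the first
  \<open>d\<close> coordinates.\<close>

lemma eopen_imp_box:
  assumes "eopen d U" "x \<in> U"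
  shows "\<exists>\<delta>>0. \<forall>y\<in>esp d. (\<forall>i<d. \<bar>y i - x i\<bar> < \<delta>) \<longrightarrow> y \<in> U"
proof -
  obtain T where T: "open T" "U = esp d \<inter> T"
    using assms by (auto simp: eopen_iff)
  have "openin (product_topology (\<lambda>i. euclidean) UNIV) T"
    by (simp add: T euclidean_product_topology)
  from product_topology_open_contains_basis[OF this, of x] assms T
  obtain X where X: "x \<in> (\<Pi>\<^sub>E i\<in>UNIV. X i)" "\<And>i. open (X i)" "(\<Pi>\<^sub>E i\<in>UNIV. X i) \<subseteq> T"
    by auto
  have xX: "x i \<in> X i" for i using X(1) by auto
  have "\<exists>\<delta>>0. \<forall>y. \<bar>y - x i\<bar> < \<delta> \<longrightarrow> y \<in> X i" for i
    using X(2)[of i] xX[of i] unfolding open_real by blast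
  then obtain \<delta> where \<delta>: "\<delta> > 0" "\<forall>i<d. \<forall>y. \<bar>y - x i\<bar> < \<delta> \<longrightarrow> y \<in> X i"
    using common_radius[of d x "\<lambda>i y. y \<in> X i"] by blast
  have "y \<in> U" if y: "y \<in> esp d" "\<forall>i<d. \<bar>y i - x i\<bar> < \<delta>" for y
  proof -
    have "x \<in> esp d" using assms openin_subset by blast
    have "y i \<in> X i" for i
    proof (cases "i < d")
      case False
      then have "y i = x i" using y(1) \<open>x \<in> esp d\<close> by (auto simp: esp_iff)
      then show ?thesis using xX by simp
    qed (use \<delta> y in auto)
    then have "y \<in> (\<Pi>\<^sub>E i\<in>UNIV. X i)" by auto
    then show ?thesis using T X y by auto
  qed
  then show ?thesis using \<delta>(1) by blast
qed

lemma eopen_box: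
  "eopen d {y \<in> esp d. \<forall>i<d. \<bar>y i - x i\<bar> < \<delta>}"
proof -
  have "open {y::nat\<Rightarrow>real. \<bar>y i - x i\<bar> < \<delta>}" for i
    by (intro open_Collect_less continuous_intros) auto
  then have "open (\<Inter>i<d. {y::nat\<Rightarrow>real. \<bar>y i - x i\<bar> < \<delta>})" by auto
  moreover have "{y \<in> esp d. \<forall>i<d. \<bar>y i - x i\<bar> < \<delta>} = esp d \<inter> (\<Inter>i<d. {y. \<bar>y i - x i\<bar> < \<delta>})"
    by auto
  ultimately show ?thesis
    unfolding eopen_iff by blast
qed

lemma eopenI:
  assumes "U \<subseteq> esp d" "\<And>x. x \<in> U \<Longrightarrow> \<exists>V. eopen d V \<and> x \<in> V \<and> V \<subseteq> U"
  shows "eopen d U"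
  using assms openin_subopen by blast

text \<open>Continuity into sequences is coordinatewise. The coordinates from \<open>e\<close> on
  vanish, which makes them continuous and places the values of \<open>g\<close> in
  \<open>esp e\<close>.\<close>

lemma eopen_preimage:
  assumes U: "eopen d U" and c: "\<And>j. j < e \<Longrightarrow> continuous_on U (\<lambda>x. g x j)"
    and z: "\<And>x j. x \<in> U \<Longrightarrow> e \<le> j \<Longrightarrow> g x j = 0" and V: "eopen e V"
  shows "eopen d {x \<in> U. g x \<in> V}"
proof -
  obtain T where T: "open T" "V = esp e \<inter> T"
    using V by (auto simp: eopen_iff)
  have "continuous_on U g"
  proof (rule continuous_on_coordinatewise_then_product)
    fix j show "continuous_on U (\<lambda>x. g x j)"
    proof (cases "j < e")
      case False
      then show ?thesis using z by (subst continuous_on_cong[OF refl, of _ _ "\<lambda>_. 0"]) auto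
    qed (use c in auto)
  qed
  from continuous_openin_preimage_gen[OF this T(1)]
  have "openin (top_of_set U) {x \<in> U. g x \<in> V}"
  proof (rule back_subst[of "openin (top_of_set U)"])
    show "U \<inter> g -` T = {x \<in> U. g x \<in> V}" using z by (auto simp: T esp_iff)
  qed
  then show ?thesis
    using U by (rule eopen_trans)
qed

lemma eopen_continuous_preimage:
  assumes "eopen d U" "continuous_on U (g :: _ \<Rightarrow> real)" "open S"
  shows "eopen d {x \<in> U. g x \<in> S}"
proof -
  have "openin (top_of_set U) (U \<inter> g -` S)" using assms by (intro continuous_openin_preimage_gen)
  moreover have "U \<inter> g -` S = {x \<in> U. g x \<in> S}" by auto
  ultimately show ?thesis using assms by (metis eopen_trans)
qed

text \<open>The filter is left open because both \<open>nhds\<close> (germs of curves) and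
  \<open>at\<close> (difference quotients) occur.\<close>

lemma eventually_in_eopen:
  assumes "eopen d V" "x \<in> V" "\<And>i. i < d \<Longrightarrow> ((\<lambda>t. z t i) \<longlongrightarrow> x i) F" "eventually (\<lambda>t. z t \<in> esp d) F"
  shows "eventually (\<lambda>t. z t \<in> V) F"
proof -
  obtain \<delta> where \<delta>: "\<delta> > 0" "\<forall>y\<in>esp d. (\<forall>i<d. \<bar>y i - x i\<bar> < \<delta>) \<longrightarrow> y \<in> V"
    using eopen_imp_box assms by blast
  have "eventually (\<lambda>t. \<forall>i\<in>{..<d}. \<bar>z t i - x i\<bar> < \<delta>) F"
    using assms(3) \<delta>(1) by (intro eventually_ball_finite) (auto simp: tendsto_iff dist_real_def)
  with assms(4) show ?thesis
    by eventually_elim (use \<delta> in auto)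
qed

lemma continuous_on_eopen_tendsto:
  assumes "eopen d U" "continuous_on U (g :: _ \<Rightarrow> real)" "x \<in> U"
    "\<And>i. i < d \<Longrightarrow> ((\<lambda>t. z t i) \<longlongrightarrow> x i) F" "eventually (\<lambda>t. z t \<in> esp d) F"
  shows "((\<lambda>t. g (z t)) \<longlongrightarrow> g x) F"
proof (rule topological_tendstoI)
  fix S assume "open S" "g x \<in> S"
  then show "eventually (\<lambda>t. g (z t) \<in> S) F"
    using eventually_in_eopen[OF eopen_continuous_preimage[OF assms(1,2)], of S x z F] assms
    by (auto elim: eventually_mono)
qed

text \<open>A canonical choice of the functions whose existence \<open>C_k_on\<close> asserts; where
  the derivative fails to exist it has whatever value \<open>deriv\<close> returns.\<close>

definition pd :: "nat \<Rightarrow> ((nat \<Rightarrow> real) \<Rightarrow> real) \<Rightarrow> (nat \<Rightarrow> real) \<Rightarrow> real" where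
  "pd i f x = deriv (\<lambda>t. f (x(i := t))) (x i)"

text \<open>A coordinate below \<open>d\<close> can be varied a little inside an open
  \<open>U\<close>; hence partial derivatives at points of \<open>U\<close> depend only on the
  values on \<open>U\<close>.\<close>

lemma eventually_upd_in:
  assumes "eopen d U" "x \<in> U" "i < d"
  shows "eventually (\<lambda>t. x(i := t) \<in> U) (nhds (x i))"
proof (rule eventually_in_eopen[OF assms(1,2)])
  show "((\<lambda>t. (x(i := t)) j) \<longlongrightarrow> x j) (nhds (x i))" for j
    by (cases "j = i") (auto simp: filterlim_ident)
qed (use assms in \<open>auto simp: esp_iff eopen_esp\<close>)

lemma pd_cong:
  assumes "eopen d U" "x \<in> U" "i < d" "\<And>x. x \<in> U \<Longrightarrow> f x = g x"
  shows "pd i f x = pd i g x"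
  unfolding pd_def
  by (intro deriv_cong_ev eventually_mono[OF eventually_upd_in[OF assms(1-3)]] assms(4) refl)

section \<open>Functions of class \<open>C_k_on\<close> and their closure properties\<close>

lemma C_k_on_imp_continuous: "C_k_on k d U f \<Longrightarrow> continuous_on U f"
  by (cases k) auto

lemma C_k_on_cong_imp:
  assumes "eopen d U" "\<And>x. x \<in> U \<Longrightarrow> f x = g x" "C_k_on k d U f"
  shows "C_k_on k d U g"
proof (cases k)
  case 0
  have "continuous_on U g" by (rule continuous_on_eq[OF _ assms(2)]) (use assms(3) 0 in simp)
  then show ?thesis using 0 by simp
next
  case (Suc m)
  have "((\<lambda>t. g (x(i := t))) has_real_derivative D) (at (x i))"
    if "x \<in> U" "i < d" "((\<lambda>t. f (x(i := t))) has_real_derivative D) (at (x i))" for x i D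
    by (rule iffD1[OF DERIV_cong_ev[OF refl _ refl] that(3)],
        rule eventually_mono[OF eventually_upd_in[OF assms(1) that(1,2)] assms(2)])
  moreover have "continuous_on U g"
    by (rule continuous_on_eq[OF _ assms(2)]) (use assms(3) Suc in simp)
  ultimately show ?thesis
    using assms(3) unfolding Suc C_k_on.simps by blast
qed

lemma C_k_on_subset: "V \<subseteq> U \<Longrightarrow> C_k_on k d U f \<Longrightarrow> C_k_on k d V f"
proof (induction k arbitrary: f)
  case (Suc k)
  have "continuous_on V f" using Suc.prems continuous_on_subset by auto
  moreover have "\<exists>g. (\<forall>x\<in>V. ((\<lambda>t. f (x(i := t))) has_real_derivative g x) (at (x i))) \<and> C_k_on k d V g"
    if "i < d" for i
    using Suc.prems Suc.IH that by (simp only: C_k_on.simps) blast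
  ultimately show ?case by simp
qed (auto intro: continuous_on_subset)

lemma C_k_on_SucD: "C_k_on (Suc k) d U f \<Longrightarrow> C_k_on k d U f"
proof (induction k arbitrary: f)
  case (Suc k)
  have "continuous_on U f" using Suc.prems by simp
  moreover have "\<exists>g. (\<forall>x\<in>U. ((\<lambda>t. f (x(i := t))) has_real_derivative g x) (at (x i))) \<and> C_k_on k d U g"
    if "i < d" for i
    using Suc.prems Suc.IH that unfolding C_k_on.simps(2)[of "Suc k"] by blast
  ultimately show ?case by simp
qed auto

lemma C_k_on_le: "j \<le> k \<Longrightarrow> C_k_on k d U f \<Longrightarrow> C_k_on j d U f"
  by (induction k) (auto simp: le_Suc_eq simp del: C_k_on.simps dest: C_k_on_SucD)

lemma C_k_on_Suc_has_pd:
  assumes "C_k_on (Suc k) d U f" "x \<in> U" "i < d"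
  shows "((\<lambda>t. f (x(i := t))) has_real_derivative pd i f x) (at (x i))"
  using assms unfolding C_k_on.simps pd_def by (metis DERIV_imp_deriv)

lemma C_k_on_pd:
  assumes "eopen d U" "C_k_on (Suc k) d U f" "i < d"
  shows "C_k_on k d U (pd i f)"
proof -
  obtain g where "\<forall>x\<in>U. ((\<lambda>t. f (x(i := t))) has_real_derivative g x) (at (x i))" "C_k_on k d U g"
    using assms unfolding C_k_on.simps by blast
  then show ?thesis
    using assms(1) by (elim C_k_on_cong_imp[rotated 2]) (auto simp: pd_def DERIV_imp_deriv)
qed

lemma C_k_on_SucI:
  assumes "continuous_on U f"
    "\<And>x i. x \<in> U \<Longrightarrow> i < d \<Longrightarrow> ((\<lambda>t. f (x(i := t))) has_real_derivative g i x) (at (x i))"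
    "\<And>i. i < d \<Longrightarrow> C_k_on k d U (g i)"
  shows "C_k_on (Suc k) d U f"
  using assms unfolding C_k_on.simps by blast

lemma C_k_on_const: "C_k_on k d U (\<lambda>_. c)"
  by (induction k arbitrary: c) (auto intro!: exI[of _ "\<lambda>_. 0"])

lemma C_k_on_proj: "C_k_on k d U (\<lambda>x. x i)"
proof (cases k)
  case (Suc m)
  show ?thesis unfolding Suc
    by (rule C_k_on_SucI[where g = "\<lambda>j _. if i = j then 1 else 0"])
      (auto simp: C_k_on_const continuous_on_product_coordinates intro!: derivative_eq_intros continuous_on_subset[OF continuous_on_product_coordinates])
qed (auto intro: continuous_on_subset[OF continuous_on_product_coordinates])

lemma C_k_on_add: "C_k_on k d U f \<Longrightarrow> C_k_on k d U g \<Longrightarrow> C_k_on k d U (\<lambda>x. f x + g x)"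
proof (induction k arbitrary: f g)
  case (Suc k)
  obtain f' where f': "\<And>i x. i < d \<Longrightarrow> x \<in> U \<Longrightarrow> ((\<lambda>t. f (x(i := t))) has_real_derivative f' i x) (at (x i))"
    "\<And>i. i < d \<Longrightarrow> C_k_on k d U (f' i)" using Suc.prems(1) unfolding C_k_on.simps by metis
  obtain g' where g': "\<And>i x. i < d \<Longrightarrow> x \<in> U \<Longrightarrow> ((\<lambda>t. g (x(i := t))) has_real_derivative g' i x) (at (x i))"
    "\<And>i. i < d \<Longrightarrow> C_k_on k d U (g' i)" using Suc.prems(2) unfolding C_k_on.simps by metis
  show ?case
    using Suc.prems by (intro C_k_on_SucI[where g = "\<lambda>i x. f' i x + g' i x"] Suc.IH f' g' DERIV_add)
      (auto intro!: continuous_on_add)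
qed (auto intro: continuous_on_add)

lemma C_k_on_mult: "C_k_on k d U f \<Longrightarrow> C_k_on k d U g \<Longrightarrow> C_k_on k d U (\<lambda>x. f x * g x)"
proof (induction k arbitrary: f g)
  case (Suc k)
  obtain f' where f': "\<And>i x. i < d \<Longrightarrow> x \<in> U \<Longrightarrow> ((\<lambda>t. f (x(i := t))) has_real_derivative f' i x) (at (x i))"
    "\<And>i. i < d \<Longrightarrow> C_k_on k d U (f' i)" using Suc.prems(1) unfolding C_k_on.simps by metis
  obtain g' where g': "\<And>i x. i < d \<Longrightarrow> x \<in> U \<Longrightarrow> ((\<lambda>t. g (x(i := t))) has_real_derivative g' i x) (at (x i))"
    "\<And>i. i < d \<Longrightarrow> C_k_on k d U (g' i)" using Suc.prems(2) unfolding C_k_on.simps by metis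
  have *: "((\<lambda>t. f (x(i := t)) * g (x(i := t))) has_real_derivative f' i x * g x + g' i x * f x) (at (x i))"
    if "x \<in> U" "i < d" for x i
    using DERIV_mult[OF f'(1)[OF that(2,1)] g'(1)[OF that(2,1)]] by simp
  show ?case
    using Suc.prems C_k_on_SucD
    by (intro C_k_on_SucI[where g = "\<lambda>i x. f' i x * g x + g' i x * f x"] C_k_on_add Suc.IH f' g' *)
      (auto intro!: continuous_on_mult)
qed (auto intro: continuous_on_mult)

lemma C_k_on_sum: "(\<And>a. a \<in> A \<Longrightarrow> C_k_on k d U (f a)) \<Longrightarrow> C_k_on k d U (\<lambda>x. \<Sum>a\<in>A. f a x)"
  by (induction A rule: infinite_finite_induct) (auto intro: C_k_on_const C_k_on_add)

section \<open>Chain rule and locality\<close>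

text \<open>
  The increment of \<open>f\<close> along the curve is split into steps changing one coordinate at a time, to which
  the mean value theorem applies.
\<close>

lemma DERIV_compose_curve:
  assumes U: "eopen d U" and f: "C_k_on (Suc 0) d U f" and cU: "c t\<^sub>0 \<in> U"
    and c: "\<forall>\<^sub>F t in nhds t\<^sub>0. c t \<in> esp d"
    and c': "\<And>i. i < d \<Longrightarrow> ((\<lambda>t. c t i) has_real_derivative c' i) (at t\<^sub>0)"
  shows "((\<lambda>t. f (c t)) has_real_derivative (\<Sum>i<d. pd i f (c t\<^sub>0) * c' i)) (at t\<^sub>0)"
proof -
  define m where "m i t = (\<lambda>j. if j < i then c t j else c t\<^sub>0 j)" for i t
  have cont: "((\<lambda>t. c t i) \<longlongrightarrow> c t\<^sub>0 i) (at t\<^sub>0)" if "i < d" for i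
    using DERIV_isCont[OF c'[OF that]] by (simp add: isCont_def)
  have c0: "c t\<^sub>0 \<in> esp d" using U cU openin_subset by blast
  have cat: "\<forall>\<^sub>F t in at t\<^sub>0. c t \<in> esp d"
    using c by (auto simp: eventually_at_filter elim: eventually_mono)
  have "((\<lambda>t. f (m i t)) has_real_derivative (\<Sum>j<i. pd j f (c t\<^sub>0) * c' j)) (at t\<^sub>0)" if "i \<le> d" for i
    using that
  proof (induction i)
    case 0
    then show ?case by (simp add: m_def)
  next
    case (Suc i)
    then have i: "i < d" by simp
    obtain \<delta> where \<delta>: "\<delta> > 0" "\<forall>y\<in>esp d. (\<forall>j<d. \<bar>y j - c t\<^sub>0 j\<bar> < \<delta>) \<longrightarrow> y \<in> U"
      using eopen_imp_box U cU by blast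
    have ev: "\<forall>\<^sub>F t in at t\<^sub>0. \<forall>j\<in>{..<d}. \<bar>c t j - c t\<^sub>0 j\<bar> < \<delta>"
      using cont \<delta>(1) by (intro eventually_ball_finite) (auto simp: tendsto_iff dist_real_def)
    have mvt: "\<exists>z\<in>U. (\<forall>j<d. \<bar>z j - c t\<^sub>0 j\<bar> \<le> \<bar>c t j - c t\<^sub>0 j\<bar>) \<and>
        f (m (Suc i) t) - f (m i t) = (c t i - c t\<^sub>0 i) * pd i f z"
      if t: "c t \<in> esp d" "\<forall>j\<in>{..<d}. \<bar>c t j - c t\<^sub>0 j\<bar> < \<delta>" for t
    proof -
      define h where "h s = f ((m i t)(i := s))" for s
      have inU: "(m i t)(i := s) \<in> U" if "\<bar>s - c t\<^sub>0 i\<bar> \<le> \<bar>c t i - c t\<^sub>0 i\<bar>" for s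
        using that t c0 i \<delta> by (intro \<delta>(2)[rule_format]) (auto simp: m_def esp_iff intro: le_less_trans)
      have dh: "(h has_real_derivative pd i f ((m i t)(i := s))) (at s)"
        if "\<bar>s - c t\<^sub>0 i\<bar> \<le> \<bar>c t i - c t\<^sub>0 i\<bar>" for s
        using C_k_on_Suc_has_pd[OF f inU[OF that] i] by (simp add: h_def[abs_def])
      have e: "f (m (Suc i) t) = h (c t i)" "f (m i t) = h (c t\<^sub>0 i)"
        unfolding h_def by (rule arg_cong[of _ _ f]; auto simp: m_def)+
      have "\<exists>s. \<bar>s - c t\<^sub>0 i\<bar> \<le> \<bar>c t i - c t\<^sub>0 i\<bar> \<and> h (c t i) - h (c t\<^sub>0 i) = (c t i - c t\<^sub>0 i) * pd i f ((m i t)(i := s))"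
      proof (cases "c t i" "c t\<^sub>0 i" rule: linorder_cases)
        case less
        have "\<exists>z>c t i. z < c t\<^sub>0 i \<and> h (c t\<^sub>0 i) - h (c t i) = (c t\<^sub>0 i - c t i) * pd i f ((m i t)(i := z))"
          using less by (intro MVT2 dh) auto
        then obtain z where "z > c t i" "z < c t\<^sub>0 i" "h (c t\<^sub>0 i) - h (c t i) = (c t\<^sub>0 i - c t i) * pd i f ((m i t)(i := z))"
          by blast
        then show ?thesis by (intro exI[of _ z]) (auto simp: algebra_simps)
      next
        case greater
        have "\<exists>z>c t\<^sub>0 i. z < c t i \<and> h (c t i) - h (c t\<^sub>0 i) = (c t i - c t\<^sub>0 i) * pd i f ((m i t)(i := z))"
          using greater by (intro MVT2 dh) auto
        then obtain z where "z < c t i" "z > c t\<^sub>0 i" "h (c t i) - h (c t\<^sub>0 i) = (c t i - c t\<^sub>0 i) * pd i f ((m i t)(i := z))"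
          by blast
        then show ?thesis by (intro exI[of _ z]) auto
      qed auto
      then obtain s where s: "\<bar>s - c t\<^sub>0 i\<bar> \<le> \<bar>c t i - c t\<^sub>0 i\<bar>"
        "h (c t i) - h (c t\<^sub>0 i) = (c t i - c t\<^sub>0 i) * pd i f ((m i t)(i := s))" by blast
      show ?thesis
        by (rule bexI[of _ "(m i t)(i := s)"]) (use s inU e in \<open>auto simp: m_def\<close>)
    qed
    then obtain z where z: "\<And>t. c t \<in> esp d \<Longrightarrow> \<forall>j\<in>{..<d}. \<bar>c t j - c t\<^sub>0 j\<bar> < \<delta> \<Longrightarrow>
        z t \<in> U \<and> (\<forall>j<d. \<bar>z t j - c t\<^sub>0 j\<bar> \<le> \<bar>c t j - c t\<^sub>0 j\<bar>) \<and>
        f (m (Suc i) t) - f (m i t) = (c t i - c t\<^sub>0 i) * pd i f (z t)"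
      by metis
    \<comment> \<open>The intermediate points differ from \<open>c t\<^sub>0\<close> in each
      coordinate by no more than \<open>c t\<close> does, so they are squeezed to
      \<open>c t\<^sub>0\<close>; continuity of \<open>pd i f\<close> then yields the limit of the
      difference quotient.\<close>
    have zlim: "((\<lambda>t. z t j) \<longlongrightarrow> c t\<^sub>0 j) (at t\<^sub>0)" if "j < d" for j
    proof -
      have "((\<lambda>t. \<bar>c t j - c t\<^sub>0 j\<bar>) \<longlongrightarrow> 0) (at t\<^sub>0)"
        using cont[OF that] by (simp add: LIM_zero tendsto_rabs_zero)
      moreover have "\<forall>\<^sub>F t in at t\<^sub>0. norm (z t j - c t\<^sub>0 j) \<le> \<bar>c t j - c t\<^sub>0 j\<bar>"
        using cat ev by eventually_elim (use z that in auto)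
      ultimately have "((\<lambda>t. z t j - c t\<^sub>0 j) \<longlongrightarrow> 0) (at t\<^sub>0)"
        by (rule Lim_null_comparison[rotated])
      then show ?thesis by (simp add: LIM_zero_iff)
    qed
    have zesp: "\<forall>\<^sub>F t in at t\<^sub>0. z t \<in> esp d"
      using cat ev by eventually_elim (use z openin_subset[OF U] in blast)
    have "continuous_on U (pd i f)" using C_k_on_pd[OF U f i] by simp
    from continuous_on_eopen_tendsto[OF U this cU zlim zesp]
    have "((\<lambda>t. pd i f (z t)) \<longlongrightarrow> pd i f (c t\<^sub>0)) (at t\<^sub>0)" by simp
    moreover have "((\<lambda>t. (c t i - c t\<^sub>0 i) / (t - t\<^sub>0)) \<longlongrightarrow> c' i) (at t\<^sub>0)"
      using c'[OF i] by (simp add: has_field_derivative_iff)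
    ultimately have "((\<lambda>t. pd i f (z t) * ((c t i - c t\<^sub>0 i) / (t - t\<^sub>0))) \<longlongrightarrow> pd i f (c t\<^sub>0) * c' i) (at t\<^sub>0)"
      by (rule tendsto_mult)
    moreover have "\<forall>\<^sub>F t in at t\<^sub>0. pd i f (z t) * ((c t i - c t\<^sub>0 i) / (t - t\<^sub>0)) =
        ((f (m (Suc i) t) - f (m i t)) - (f (m (Suc i) t\<^sub>0) - f (m i t\<^sub>0))) / (t - t\<^sub>0)"
      using cat ev
    proof eventually_elim
      case (elim t)
      moreover have "m (Suc i) t\<^sub>0 = m i t\<^sub>0" by (auto simp: m_def)
      ultimately show ?case using z[of t] by (simp add: mult.commute)
    qed
    ultimately have "((\<lambda>t. f (m (Suc i) t) - f (m i t)) has_real_derivative pd i f (c t\<^sub>0) * c' i) (at t\<^sub>0)"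
      unfolding has_field_derivative_iff by (rule Lim_transform_eventually)
    from DERIV_add[OF Suc.IH this] Suc.prems show ?case by simp
  qed
  from this[of d] have "((\<lambda>t. f (m d t)) has_real_derivative (\<Sum>i<d. pd i f (c t\<^sub>0) * c' i)) (at t\<^sub>0)" by simp
  moreover have "\<forall>\<^sub>F t in nhds t\<^sub>0. f (m d t) = f (c t)"
    using c
  proof eventually_elim
    case (elim t)
    then have "m d t = c t" using c0 by (auto simp: m_def esp_iff)
    then show ?case by simp
  qed
  ultimately show ?thesis by (simp add: DERIV_cong_ev)
qed

text \<open>By induction with \<open>f\<close> arbitrary: the partial derivatives of the composite
  are sums of products of \<open>pd j f\<close> after \<open>g\<close>, covered by the induction
  hypothesis, with partial derivatives of \<open>g\<close>.\<close>

lemma C_k_on_compose: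
  assumes U: "eopen d U" and V: "eopen e V" and gV: "\<And>x. x \<in> U \<Longrightarrow> g x \<in> V"
    and g: "\<And>j. j < e \<Longrightarrow> C_k_on k d U (\<lambda>x. g x j)" and f: "C_k_on k e V f"
  shows "C_k_on k d U (\<lambda>x. f (g x))"
  using g f
proof (induction k arbitrary: f)
  case 0
  show ?case unfolding C_k_on.simps
  proof (rule continuous_on_compose2[of V f U g])
    show "continuous_on U g"
    proof (rule continuous_on_coordinatewise_then_product)
      fix j show "continuous_on U (\<lambda>x. g x j)"
      proof (cases "j < e")
        case False
        have "continuous_on U (\<lambda>_. 0)" by simp
        then show ?thesis
          by (rule continuous_on_eq) (use False gV eopen_esp[OF V] in auto)
      qed (use 0 in auto)
    qed
  qed (use 0 gV in auto)
next
  case (Suc k)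
  have gk: "C_k_on k d U (\<lambda>x. g x j)" if "j < e" for j using Suc.prems(1)[OF that] by (rule C_k_on_SucD)
  have fg: "C_k_on k d U (\<lambda>x. f (g x))"
    by (rule Suc.IH) (use gk Suc.prems(2) C_k_on_SucD in blast)+
  have D: "((\<lambda>t. f (g (x(i := t)))) has_real_derivative (\<Sum>j<e. pd j f (g x) * pd i (\<lambda>x. g x j) x)) (at (x i))"
    if x: "x \<in> U" and i: "i < d" for x i
  proof -
    have "((\<lambda>t. f (g (x(i := t)))) has_real_derivative (\<Sum>j<e. pd j f (g (x(i := x i))) * pd i (\<lambda>x. g x j) x)) (at (x i))"
    proof (rule DERIV_compose_curve[OF V])
      show "C_k_on (Suc 0) e V f" by (rule C_k_on_le[OF _ Suc.prems(2)]) simp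
      show "g (x(i := x i)) \<in> V" using x gV by simp
      show "\<forall>\<^sub>F t in nhds (x i). g (x(i := t)) \<in> esp e"
        using eventually_upd_in[OF U x i] by eventually_elim (use gV openin_subset[OF V] in blast)
      show "((\<lambda>t. g (x(i := t)) j) has_real_derivative pd i (\<lambda>x. g x j) x) (at (x i))" if "j < e" for j
        by (rule C_k_on_Suc_has_pd[OF Suc.prems(1)[OF that] x i])
    qed
    then show ?thesis by simp
  qed
  show ?case
  proof (rule C_k_on_SucI[OF C_k_on_imp_continuous[OF fg] D])
    fix i assume i: "i < d"
    have "C_k_on k d U (\<lambda>x. pd j f (g x) * pd i (\<lambda>x. g x j) x)" if j: "j < e" for j
      by (rule C_k_on_mult[OF Suc.IH[OF gk C_k_on_pd[OF V Suc.prems(2) j]] C_k_on_pd[OF U Suc.prems(1)[OF j] i]])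
    then show "C_k_on k d U (\<lambda>x. \<Sum>j<e. pd j f (g x) * pd i (\<lambda>x. g x j) x)"
      by (intro C_k_on_sum) simp
  qed
qed

text \<open>Nothing has to be glued: \<open>pd i f\<close> does not refer to the neighbourhood, so
  it serves as the derivative on every \<open>V\<close> at once.\<close>

lemma C_k_on_local:
  assumes "\<And>x. x \<in> U \<Longrightarrow> \<exists>V. eopen d V \<and> x \<in> V \<and> C_k_on k d V f" "U \<subseteq> esp d"
  shows "C_k_on k d U f"
  using assms(1)
proof (induction k arbitrary: f)
  case 0
  have "continuous (at x within U) f" if x: "x \<in> U" for x
  proof -
    obtain V where V: "eopen d V" "x \<in> V" "continuous_on V f" using 0 x by auto
    then obtain T where T: "open T" "V = esp d \<inter> T"
      by (auto simp: eopen_iff)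
    have "continuous (at x within V) f" using V by (simp add: continuous_on_eq_continuous_within)
    then have "continuous (at x within U \<inter> T) f"
      by (rule continuous_within_subset) (use assms(2) T in blast)
    moreover have "at x within U \<inter> T = at x within U"
      by (rule at_within_nhd[of _ T]) (use T V in auto)
    ultimately show ?thesis by (simp add: continuous_within)
  qed
  then show ?case by (simp add: continuous_on_eq_continuous_within)
next
  case (Suc k)
  have "C_k_on k d U f"
  proof (rule Suc.IH)
    fix x assume "x \<in> U"
    then obtain V where "eopen d V" "x \<in> V" "C_k_on (Suc k) d V f" using Suc.prems by meson
    then show "\<exists>V. eopen d V \<and> x \<in> V \<and> C_k_on k d V f" by (meson C_k_on_SucD)
  qed
  then show ?case
  proof (rule C_k_on_SucI[where g = "\<lambda>i. pd i f", OF C_k_on_imp_continuous])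
    fix x i assume i: "x \<in> U" "i < d"
    then obtain V where "eopen d V" "x \<in> V" "C_k_on (Suc k) d V f" using Suc.prems by meson
    then show "((\<lambda>t. f (x(i := t))) has_real_derivative pd i f x) (at (x i))"
      using C_k_on_Suc_has_pd i(2) by meson
  next
    fix i assume i: "i < d"
    show "C_k_on k d U (pd i f)"
    proof (rule Suc.IH)
      fix x assume "x \<in> U"
      then obtain V where "eopen d V" "x \<in> V" "C_k_on (Suc k) d V f" using Suc.prems by meson
      then show "\<exists>V. eopen d V \<and> x \<in> V \<and> C_k_on k d V (pd i f)" using C_k_on_pd i by meson
    qed
  qed
qed

section \<open>Smooth functions and the symmetry of mixed partial derivatives\<close>

lemma C_infinity_on_cong:
  assumes "eopen d U" "\<And>x. x \<in> U \<Longrightarrow> f x = g x"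
  shows "C_infinity_on d U f \<longleftrightarrow> C_infinity_on d U g"
  unfolding C_infinity_on_def using C_k_on_cong_imp[OF assms] C_k_on_cong_imp[OF assms(1), of g f] assms(2) by auto

lemma C_infinity_on_subset: "C_infinity_on d U f \<Longrightarrow> V \<subseteq> U \<Longrightarrow> C_infinity_on d V f"
  unfolding C_infinity_on_def using C_k_on_subset by blast

lemma C_infinity_on_const [simp, intro]: "C_infinity_on d U (\<lambda>_. c)"
  unfolding C_infinity_on_def by (simp add: C_k_on_const)

lemma C_infinity_on_proj [simp, intro]: "C_infinity_on d U (\<lambda>x. x i)"
  unfolding C_infinity_on_def by (simp add: C_k_on_proj)

lemma C_infinity_on_add: "C_infinity_on d U f \<Longrightarrow> C_infinity_on d U g \<Longrightarrow> C_infinity_on d U (\<lambda>x. f x + g x)"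
  unfolding C_infinity_on_def by (simp add: C_k_on_add)

lemma C_infinity_on_mult: "C_infinity_on d U f \<Longrightarrow> C_infinity_on d U g \<Longrightarrow> C_infinity_on d U (\<lambda>x. f x * g x)"
  unfolding C_infinity_on_def by (simp add: C_k_on_mult)

lemma C_infinity_on_sum: "(\<And>a. a \<in> A \<Longrightarrow> C_infinity_on d U (f a)) \<Longrightarrow> C_infinity_on d U (\<lambda>x. \<Sum>a\<in>A. f a x)"
  unfolding C_infinity_on_def by (simp add: C_k_on_sum)

lemma C_infinity_on_compose:
  assumes "eopen d U" "eopen e V" "\<And>x. x \<in> U \<Longrightarrow> g x \<in> V"
    "\<And>j. j < e \<Longrightarrow> C_infinity_on d U (\<lambda>x. g x j)" "C_infinity_on e V f"
  shows "C_infinity_on d U (\<lambda>x. f (g x))"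
  unfolding C_infinity_on_def
proof
  fix k show "C_k_on k d U (\<lambda>x. f (g x))"
    by (rule C_k_on_compose[OF assms(1-3)]) (use assms(4,5) in \<open>simp_all add: C_infinity_on_def\<close>)
qed

lemma C_infinity_on_local:
  assumes "\<And>x. x \<in> U \<Longrightarrow> \<exists>V. eopen d V \<and> x \<in> V \<and> C_infinity_on d V f" "U \<subseteq> esp d"
  shows "C_infinity_on d U f"
  unfolding C_infinity_on_def
proof
  fix k show "C_k_on k d U f"
    by (rule C_k_on_local[OF _ assms(2)]) (use assms(1) C_infinity_on_def in metis)
qed

lemma C_infinity_on_pd: "eopen d U \<Longrightarrow> C_infinity_on d U f \<Longrightarrow> i < d \<Longrightarrow> C_infinity_on d U (pd i f)"
  unfolding C_infinity_on_def using C_k_on_pd by blast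

lemma C_infinity_on_has_pd:
  assumes "C_infinity_on d U f" "x \<in> U" "i < d"
  shows "((\<lambda>t. f (x(i := t))) has_real_derivative pd i f x) (at (x i))"
  using assms C_k_on_Suc_has_pd unfolding C_infinity_on_def by blast

lemma C_infinity_on_continuous: "C_infinity_on d U f \<Longrightarrow> continuous_on U f"
  unfolding C_infinity_on_def by (metis C_k_on.simps(1))

lemma eopen_preimage_smooth:
  assumes "eopen d U" "\<And>j. j < e \<Longrightarrow> C_infinity_on d U (\<lambda>x. g x j)"
    "\<And>x j. x \<in> U \<Longrightarrow> e \<le> j \<Longrightarrow> g x j = 0" "eopen e V"
  shows "eopen d {x \<in> U. g x \<in> V}"
  using assms by (intro eopen_preimage C_infinity_on_continuous)

text \<open>The mean value theorem twice, first for \<open>D\<close> in direction \<open>i\<close>,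
  then for \<open>pd i f\<close> in direction \<open>j\<close>. The left side is symmetric in
  \<open>i\<close> and \<open>j\<close> while the right side is not, and \<open>pd_commute\<close>
  exploits this.\<close>

lemma mixed_difference:
  assumes U: "eopen d U" and f: "C_infinity_on d U f" and ij: "i < d" "j < d" "i \<noteq> j" and h: "h > 0"
    and box: "\<And>y. y \<in> esp d \<Longrightarrow> (\<And>k. k < d \<Longrightarrow> \<bar>y k - x k\<bar> \<le> h) \<Longrightarrow> y \<in> U" and x: "x \<in> U"
  shows "\<exists>z\<in>esp d. (\<forall>k<d. \<bar>z k - x k\<bar> \<le> h) \<and>
    f (x(i := x i + h, j := x j + h)) - f (x(i := x i + h)) - f (x(j := x j + h)) + f x = h * h * pd j (pd i f) z"
proof -
  have xe: "x \<in> esp d" using U x openin_subset by blast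
  have near: "x(i := a, j := b) \<in> U" if "\<bar>a - x i\<bar> \<le> h" "\<bar>b - x j\<bar> \<le> h" for a b
    using that xe h ij by (intro box) (auto simp: esp_iff)
  define D where "D a = f (x(i := a, j := x j + h)) - f (x(i := a, j := x j))" for a
  have D: "(D has_real_derivative pd i f (x(i := a, j := x j + h)) - pd i f (x(i := a, j := x j))) (at a)"
    if "\<bar>a - x i\<bar> \<le> h" for a
  proof -
    have "((\<lambda>t. f (x(i := t, j := b))) has_real_derivative pd i f (x(i := a, j := b))) (at a)"
      if "\<bar>b - x j\<bar> \<le> h" for b
      using C_infinity_on_has_pd[OF f near[OF \<open>\<bar>a - x i\<bar> \<le> h\<close> that] ij(1)] ij(3)
      by (simp add: fun_upd_twist[of i j])
    then show ?thesis unfolding D_def by (intro DERIV_diff) (use h in auto)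
  qed
  have "\<exists>a>x i. a < x i + h \<and> D (x i + h) - D (x i) = (x i + h - x i) *
      (pd i f (x(i := a, j := x j + h)) - pd i f (x(i := a, j := x j)))"
    using h D by (intro MVT2) auto
  then obtain a where a: "a > x i" "a < x i + h"
    "D (x i + h) - D (x i) = h * (pd i f (x(i := a, j := x j + h)) - pd i f (x(i := a, j := x j)))"
    by auto
  have "\<exists>b>x j. b < x j + h \<and> pd i f (x(i := a, j := x j + h)) - pd i f (x(i := a, j := x j)) =
      (x j + h - x j) * pd j (pd i f) (x(i := a, j := b))"
  proof (rule MVT2)
    fix b assume "x j \<le> b" "b \<le> x j + h"
    then show "((\<lambda>b. pd i f (x(i := a, j := b))) has_real_derivative pd j (pd i f) (x(i := a, j := b))) (at b)"
      using C_infinity_on_has_pd[OF C_infinity_on_pd[OF U f ij(1)] near ij(2), of a b] a by simp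
  qed (use h in auto)
  then obtain b where b: "b > x j" "b < x j + h"
    "pd i f (x(i := a, j := x j + h)) - pd i f (x(i := a, j := x j)) = h * pd j (pd i f) (x(i := a, j := b))"
    by auto
  have "D (x i + h) - D (x i) = f (x(i := x i + h, j := x j + h)) - f (x(i := x i + h)) - f (x(j := x j + h)) + f x"
    using ij(3) unfolding D_def by (simp add: fun_upd_idem)
  then show ?thesis
    using a b xe h ij by (intro bexI[of _ "x(i := a, j := b)"]) (auto simp: esp_iff)
qed

lemma pd_commute:
  assumes U: "eopen d U" and f: "C_infinity_on d U f" and ij: "i < d" "j < d" and x: "x \<in> U"
  shows "pd i (pd j f) x = pd j (pd i f) x"
proof (rule ccontr)
  assume ne: "pd i (pd j f) x \<noteq> pd j (pd i f) x"
  then have "i \<noteq> j" by auto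
  \<comment> \<open>Half the discrepancy: the two mixed derivatives coincide at suitable points
    \<open>z\<close> and \<open>z'\<close>, at which each is within \<epsilon> of its value at
    \<open>x\<close>, contradicting the triangle inequality.\<close>
  define \<epsilon> where "\<epsilon> = \<bar>pd i (pd j f) x - pd j (pd i f) x\<bar> / 2"
  have "\<epsilon> > 0" using ne by (simp add: \<epsilon>_def)
  have nb: "\<exists>\<delta>>0. \<forall>y\<in>esp d. (\<forall>k<d. \<bar>y k - x k\<bar> < \<delta>) \<longrightarrow> y \<in> {y \<in> U. g y \<in> ball (g x) \<epsilon>}"
    if "C_infinity_on d U g" for g
    by (rule eopen_imp_box[OF eopen_continuous_preimage[OF U C_infinity_on_continuous[OF that]]])
      (use x \<open>\<epsilon> > 0\<close> in auto)
  obtain \<delta>1 where \<delta>1: "\<delta>1 > 0" "\<forall>y\<in>esp d. (\<forall>k<d. \<bar>y k - x k\<bar> < \<delta>1) \<longrightarrow> y \<in> U \<and> dist (pd i (pd j f) x) (pd i (pd j f) y) < \<epsilon>"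
    using nb[of "pd i (pd j f)"] U f ij by (auto intro!: C_infinity_on_pd)
  obtain \<delta>2 where \<delta>2: "\<delta>2 > 0" "\<forall>y\<in>esp d. (\<forall>k<d. \<bar>y k - x k\<bar> < \<delta>2) \<longrightarrow> y \<in> U \<and> dist (pd j (pd i f) x) (pd j (pd i f) y) < \<epsilon>"
    using nb[of "pd j (pd i f)"] U f ij by (auto intro!: C_infinity_on_pd)
  define h where "h = min \<delta>1 \<delta>2 / 2"
  have h: "h > 0" "h < \<delta>1" "h < \<delta>2" using \<delta>1(1) \<delta>2(1) by (auto simp: h_def min_def)
  have box: "y \<in> U" if "y \<in> esp d" "\<And>k. k < d \<Longrightarrow> \<bar>y k - x k\<bar> \<le> h" for y
    using \<delta>1(2) that h by (meson le_less_trans)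
  obtain z where z: "z \<in> esp d" "\<forall>k<d. \<bar>z k - x k\<bar> \<le> h"
    "f (x(i := x i + h, j := x j + h)) - f (x(i := x i + h)) - f (x(j := x j + h)) + f x = h * h * pd j (pd i f) z"
    using mixed_difference[OF U f ij \<open>i \<noteq> j\<close> h(1) box x] by blast
  obtain z' where z': "z' \<in> esp d" "\<forall>k<d. \<bar>z' k - x k\<bar> \<le> h"
    "f (x(j := x j + h, i := x i + h)) - f (x(j := x j + h)) - f (x(i := x i + h)) + f x = h * h * pd i (pd j f) z'"
    using mixed_difference[OF U f ij(2,1) \<open>i \<noteq> j\<close>[symmetric] h(1) box x] by blast
  have "h * h * pd j (pd i f) z = h * h * pd i (pd j f) z'"
    using z(3) z'(3) unfolding fun_upd_twist[OF \<open>i \<noteq> j\<close>, of x "x i + h" "x j + h"] by linarith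
  then have "pd j (pd i f) z = pd i (pd j f) z'" using h(1) by simp
  moreover have "dist (pd j (pd i f) x) (pd j (pd i f) z) < \<epsilon>" using \<delta>2(2) z h by (meson le_less_trans)
  moreover have "dist (pd i (pd j f) x) (pd i (pd j f) z') < \<epsilon>" using \<delta>1(2) z' h by (meson le_less_trans)
  ultimately show False
    using dist_triangle_half_l[of "pd i (pd j f) x" "pd i (pd j f) z'" "\<bar>pd i (pd j f) x - pd j (pd i f) x\<bar>" "pd j (pd i f) x"]
    by (simp add: \<epsilon>_def dist_real_def)
qed

section \<open>Germs of smooth functions of one variable\<close>

text \<open>One neighbourhood of \<open>0\<close> has to serve all orders \<open>k\<close>, in
  accordance with \<open>curve\<close>.\<close>

definition sgerm :: "(real \<Rightarrow> real) \<Rightarrow> bool" where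
  "sgerm f \<longleftrightarrow> (\<forall>\<^sub>F t in nhds 0. \<forall>k. (deriv ^^ k) f field_differentiable at t)"

lemma eopen_interval: "eopen 1 {x \<in> esp 1. \<bar>x 0\<bar> < \<epsilon>}"
  using eopen_box[of 1 "\<lambda>_. 0" \<epsilon>] by simp

lemma pd_fun_of_0: "pd 0 (\<lambda>x. f (x 0)) x = deriv f (x 0)"
  by (simp add: pd_def)

lemma C_k_on_interval_imp:
  assumes "C_k_on (Suc k) 1 {x \<in> esp 1. \<bar>x 0\<bar> < \<epsilon>} (\<lambda>x. f (x 0))" "\<bar>t\<bar> < \<epsilon>"
  shows "(deriv ^^ k) f field_differentiable at t"
  using assms(1)
proof (induction k arbitrary: f)
  case 0
  have "(\<lambda>i::nat. if i = 0 then t else 0) \<in> {x \<in> esp 1. \<bar>x 0\<bar> < \<epsilon>}" using assms(2) by (simp add: esp_iff)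
  from C_k_on_Suc_has_pd[OF 0 this, of 0] show ?case by (auto simp: field_differentiable_def)
next
  case (Suc k)
  have "C_k_on (Suc k) 1 {x \<in> esp 1. \<bar>x 0\<bar> < \<epsilon>} (pd 0 (\<lambda>x. f (x 0)))"
    by (rule C_k_on_pd[OF eopen_interval Suc.prems]) simp
  then have "(deriv ^^ k) (deriv f) field_differentiable at t"
    unfolding pd_fun_of_0 by (rule Suc.IH)
  then show ?case by (simp add: funpow_swap1)
qed

lemma C_k_on_interval:
  assumes "\<And>k t. \<bar>t\<bar> < \<epsilon> \<Longrightarrow> (deriv ^^ k) f field_differentiable at t"
  shows "C_k_on k 1 {x \<in> esp 1. \<bar>x 0\<bar> < \<epsilon>} (\<lambda>x. f (x 0))"
  using assms
proof (induction k arbitrary: f)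
  case 0
  have "continuous_on {t. \<bar>t\<bar> < \<epsilon>} f"
    using 0[of _ 0] by (auto intro!: continuous_at_imp_continuous_on field_differentiable_imp_continuous_at)
  then show ?case
    unfolding C_k_on.simps
    by (rule continuous_on_compose2) (auto intro: continuous_on_subset[OF continuous_on_product_coordinates])
next
  case (Suc k)
  have "continuous_on {t. \<bar>t\<bar> < \<epsilon>} f"
    using Suc.prems[of _ 0] by (auto intro!: continuous_at_imp_continuous_on field_differentiable_imp_continuous_at)
  then have "continuous_on {x \<in> esp 1. \<bar>x 0\<bar> < \<epsilon>} (\<lambda>x. f (x 0))"
    by (rule continuous_on_compose2) (auto intro: continuous_on_subset[OF continuous_on_product_coordinates])
  moreover have "C_k_on k 1 {x \<in> esp 1. \<bar>x 0\<bar> < \<epsilon>} (\<lambda>x. deriv f (x 0))"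
    by (rule Suc.IH) (use Suc.prems[of _ "Suc _"] in \<open>simp add: funpow_swap1\<close>)
  moreover have "(f has_real_derivative deriv f t) (at t)" if "\<bar>t\<bar> < \<epsilon>" for t
    using Suc.prems[OF that, of 0] by (simp add: field_differentiable_derivI)
  ultimately show ?case by (intro C_k_on_SucI[where g = "\<lambda>_ x. deriv f (x 0)"]) auto
qed

lemma C_infinity_on_interval:
  "C_infinity_on 1 {x \<in> esp 1. \<bar>x 0\<bar> < \<epsilon>} (\<lambda>x. f (x 0)) \<longleftrightarrow>
    (\<forall>k t. \<bar>t\<bar> < \<epsilon> \<longrightarrow> (deriv ^^ k) f field_differentiable at t)"
  unfolding C_infinity_on_def using C_k_on_interval C_k_on_interval_imp by blast

lemma eventually_nhds_0_real:
  "eventually P (nhds (0::real)) \<longleftrightarrow> (\<exists>\<epsilon>>0. \<forall>t. \<bar>t\<bar> < \<epsilon> \<longrightarrow> P t)"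
  by (simp add: eventually_nhds_metric dist_real_def)

text \<open>Reads a germ of one variable as a smooth function on an interval of
  \<open>esp 1\<close>, so that \<open>C_infinity_on_compose\<close> also governs smooth functions
  along curves.\<close>

lemma sgerm_iff:
  "sgerm f \<longleftrightarrow> (\<exists>\<epsilon>>0. C_infinity_on 1 {x \<in> esp 1. \<bar>x 0\<bar> < \<epsilon>} (\<lambda>x. f (x 0)))"
  unfolding sgerm_def eventually_nhds_0_real C_infinity_on_interval by blast

lemma sgerm_compose:
  assumes U: "eopen d U" and F: "C_infinity_on d U F" and c: "\<And>i. i < d \<Longrightarrow> sgerm (\<lambda>t. c t i)"
    and cU: "\<forall>\<^sub>F t in nhds 0. c t \<in> U"
  shows "sgerm (\<lambda>t. F (c t))"
proof -
  have "\<forall>\<^sub>F t in nhds 0. \<forall>i\<in>{..<d}. \<forall>k. (deriv ^^ k) (\<lambda>t. c t i) field_differentiable at t"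
    using c by (intro eventually_ball_finite) (auto simp: sgerm_def)
  with cU have "\<forall>\<^sub>F t in nhds 0. c t \<in> U \<and> (\<forall>i<d. \<forall>k. (deriv ^^ k) (\<lambda>t. c t i) field_differentiable at t)"
    by eventually_elim auto
  then obtain \<epsilon> where \<epsilon>: "\<epsilon> > 0" "\<And>t. \<bar>t\<bar> < \<epsilon> \<Longrightarrow> c t \<in> U"
    "\<And>t i k. \<bar>t\<bar> < \<epsilon> \<Longrightarrow> i < d \<Longrightarrow> (deriv ^^ k) (\<lambda>t. c t i) field_differentiable at t"
    unfolding eventually_nhds_0_real by auto
  have "C_infinity_on 1 {x \<in> esp 1. \<bar>x 0\<bar> < \<epsilon>} (\<lambda>x. F (c (x 0)))"
  proof (rule C_infinity_on_compose[OF eopen_interval U _ _ F])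
    show "C_infinity_on 1 {x \<in> esp 1. \<bar>x 0\<bar> < \<epsilon>} (\<lambda>x. c (x 0) j)" if "j < d" for j
      using \<epsilon>(3) that by (subst C_infinity_on_interval) auto
  qed (use \<epsilon> in auto)
  then show ?thesis using \<epsilon>(1) sgerm_iff by blast
qed

lemma higher_deriv_ev_cong:
  "\<forall>\<^sub>F t in nhds 0. f t = g t \<Longrightarrow> (deriv ^^ k) f 0 = (deriv ^^ k) (g :: real \<Rightarrow> real) 0"
  by (rule higher_deriv_cong_ev) auto

lemma sgerm_ev_cong: "\<forall>\<^sub>F t in nhds 0. f t = g t \<Longrightarrow> sgerm f \<Longrightarrow> sgerm g"
proof -
  assume "\<forall>\<^sub>F t in nhds 0. f t = g t" "sgerm f"
  then have "\<forall>\<^sub>F t in nhds 0. \<forall>\<^sub>F u in nhds t. f u = g u" "\<forall>\<^sub>F t in nhds 0. \<forall>k. (deriv ^^ k) f field_differentiable at t"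
    by (auto simp: eventually_eventually sgerm_def)
  then have "\<forall>\<^sub>F t in nhds 0. \<forall>k. (deriv ^^ k) g field_differentiable at t"
  proof eventually_elim
    case (elim t)
    show ?case
    proof
      fix k
      from elim(1) have "\<forall>\<^sub>F u in nhds t. \<forall>\<^sub>F v in nhds u. f v = g v" by (simp add: eventually_eventually)
      then have "\<forall>\<^sub>F u in nhds t. (deriv ^^ k) f u = (deriv ^^ k) g u"
        by eventually_elim (rule higher_deriv_cong_ev, auto)
      with elim(2) show "(deriv ^^ k) g field_differentiable at t"
        unfolding field_differentiable_def by (metis DERIV_cong_ev)
    qed
  qed
  then show "sgerm g" by (simp add: sgerm_def)
qed

lemma sgerm_deriv: "sgerm f \<Longrightarrow> sgerm (deriv f)"
  unfolding sgerm_def by (elim eventually_mono) (metis comp_apply funpow_Suc_right)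

lemma sgerm_has_derivative: "sgerm f \<Longrightarrow> \<forall>\<^sub>F t in nhds 0. (f has_real_derivative deriv f t) (at t)"
  unfolding sgerm_def by (elim eventually_mono) (metis field_differentiable_derivI funpow_0)

lemma sgerm_has_derivative_0: "sgerm f \<Longrightarrow> (f has_real_derivative deriv f 0) (at 0)"
  using eventually_nhds_x_imp_x[OF sgerm_has_derivative] .

lemma sgerm_const [simp]: "sgerm (\<lambda>_. c)"
  by (auto simp: sgerm_iff intro!: exI[of _ 1])

lemma sgerm_ident [simp]: "sgerm (\<lambda>t. t)"
  by (auto simp: sgerm_iff intro!: exI[of _ 1])

text \<open>The smooth function \<open>x 0 + x 1\<close> on \<open>esp 2\<close> is evaluated along
  the curve with coordinates \<open>f\<close> and \<open>g\<close>; products are treated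
  alike.\<close>

lemma sgerm_add: "sgerm f \<Longrightarrow> sgerm g \<Longrightarrow> sgerm (\<lambda>t. f t + g t)"
proof -
  assume fg: "sgerm f" "sgerm g"
  let ?c = "\<lambda>t (i::nat). if i = 0 then f t else if i = 1 then g t else (0::real)"
  have "sgerm (\<lambda>t. ?c t i)" if "i < 2" for i :: nat using that fg by (cases i) auto
  then have "sgerm (\<lambda>t. ?c t (0::nat) + ?c t 1)"
    using sgerm_compose[of 2 "esp 2" "\<lambda>x. x 0 + x 1" ?c]
    by (simp add: C_infinity_on_add esp_iff)
  then show ?thesis by simp
qed

lemma sgerm_mult: "sgerm f \<Longrightarrow> sgerm g \<Longrightarrow> sgerm (\<lambda>t. f t * g t)"
proof -
  assume fg: "sgerm f" "sgerm g"
  let ?c = "\<lambda>t (i::nat). if i = 0 then f t else if i = 1 then g t else (0::real)"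
  have "sgerm (\<lambda>t. ?c t i)" if "i < 2" for i :: nat using that fg by (cases i) auto
  then have "sgerm (\<lambda>t. ?c t (0::nat) * ?c t 1)"
    using sgerm_compose[of 2 "esp 2" "\<lambda>x. x 0 * x 1" ?c]
    by (simp add: C_infinity_on_mult esp_iff)
  then show ?thesis by simp
qed

lemma sgerm_sum: "(\<And>a. a \<in> A \<Longrightarrow> sgerm (f a)) \<Longrightarrow> sgerm (\<lambda>t. \<Sum>a\<in>A. f a t)"
  by (induction A rule: infinite_finite_induct) (auto intro: sgerm_add)

lemma sgerm_power: "sgerm (\<lambda>t. t ^ n)"
  by (induction n) (auto intro: sgerm_mult)

lemma higher_deriv_Suc: "(deriv ^^ Suc k) f = (deriv ^^ k) (deriv f)"
  by (simp add: funpow_swap1)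

lemma deriv_add_germ:
  "sgerm f \<Longrightarrow> sgerm g \<Longrightarrow> \<forall>\<^sub>F t in nhds 0. deriv (\<lambda>t. f t + g t) t = deriv f t + deriv g t"
  using eventually_conj[OF sgerm_has_derivative sgerm_has_derivative, of f g]
  by (auto elim!: eventually_mono intro!: DERIV_imp_deriv DERIV_add)

lemma deriv_mult_germ:
  "sgerm f \<Longrightarrow> sgerm g \<Longrightarrow> \<forall>\<^sub>F t in nhds 0. deriv (\<lambda>t. f t * g t) t = deriv f t * g t + f t * deriv g t"
  using eventually_conj[OF sgerm_has_derivative sgerm_has_derivative, of f g]
  by (auto elim!: eventually_mono intro!: DERIV_imp_deriv derivative_eq_intros)

lemma higher_deriv_add_germ:
  "sgerm f \<Longrightarrow> sgerm g \<Longrightarrow> (deriv ^^ k) (\<lambda>t. f t + g t) 0 = (deriv ^^ k) f 0 + (deriv ^^ k) g 0"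
proof (induction k arbitrary: f g)
  case (Suc k)
  then show ?case
    using higher_deriv_ev_cong[OF deriv_add_germ[OF Suc.prems], of k] sgerm_deriv
    unfolding higher_deriv_Suc by simp
qed auto

lemma higher_deriv_const_0: "(deriv ^^ k) (\<lambda>_. c::real) t = (if k = 0 then c else 0)"
  by (induction k arbitrary: c) (auto simp: higher_deriv_Suc simp del: funpow.simps(2))

lemma higher_deriv_sum_germ:
  "(\<And>a. a \<in> A \<Longrightarrow> sgerm (f a)) \<Longrightarrow> (deriv ^^ k) (\<lambda>t. \<Sum>a\<in>A. f a t) 0 = (\<Sum>a\<in>A. (deriv ^^ k) (f a) 0)"
  by (induction A rule: infinite_finite_induct)
    (auto simp: higher_deriv_const_0 higher_deriv_add_germ sgerm_sum)

lemma higher_deriv_mult_germ: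
  assumes "sgerm f" "sgerm g"
  shows "(deriv ^^ k) (\<lambda>t. f t * g t) 0 = (\<Sum>l\<le>k. of_nat (k choose l) * (deriv ^^ l) f 0 * (deriv ^^ (k - l)) g 0)"
  using assms
proof (induction k arbitrary: f g)
  case (Suc k)
  define a where "a l = (deriv ^^ l) f 0" for l
  define b where "b l = (deriv ^^ l) g 0" for l
  have "(deriv ^^ Suc k) (\<lambda>t. f t * g t) 0 = (deriv ^^ k) (\<lambda>t. deriv f t * g t + f t * deriv g t) 0"
    using higher_deriv_ev_cong[OF deriv_mult_germ[OF Suc.prems], of k] unfolding higher_deriv_Suc .
  also have "\<dots> = (deriv ^^ k) (\<lambda>t. deriv f t * g t) 0 + (deriv ^^ k) (\<lambda>t. f t * deriv g t) 0"
    by (intro higher_deriv_add_germ sgerm_mult sgerm_deriv Suc.prems)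
  also have "\<dots> = (\<Sum>l\<le>k. of_nat (k choose l) * a (Suc l) * b (k - l)) + (\<Sum>l\<le>k. of_nat (k choose l) * a l * b (Suc (k - l)))"
    using Suc.prems by (simp add: Suc.IH sgerm_deriv a_def b_def higher_deriv_Suc del: funpow.simps(2))
  \<comment> \<open>The extra summand \<open>l = Suc k\<close> has coefficient
    \<open>k choose Suc k = 0\<close>. Extending the range and then splitting off
    \<open>l = 0\<close> aligns both sums for Pascal's rule.\<close>
  also have "(\<Sum>l\<le>k. of_nat (k choose l) * a l * b (Suc (k - l))) = (\<Sum>l\<le>Suc k. of_nat (k choose l) * a l * b (Suc k - l))"
    by (simp add: Suc_diff_le)
  also have "\<dots> = a 0 * b (Suc k) + (\<Sum>l\<le>k. of_nat (k choose Suc l) * a (Suc l) * b (k - l))"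
    by (subst sum.atMost_Suc_shift) simp
  also have "(\<Sum>l\<le>k. of_nat (k choose l) * a (Suc l) * b (k - l)) + (a 0 * b (Suc k) + (\<Sum>l\<le>k. of_nat (k choose Suc l) * a (Suc l) * b (k - l)))
      = (\<Sum>l\<le>Suc k. of_nat (Suc k choose l) * a l * b (Suc k - l))"
    unfolding sum.atMost_Suc_shift[of "\<lambda>l. real (Suc k choose l) * a l * b (Suc k - l)"]
    by (simp add: sum.distrib[symmetric] algebra_simps)
  finally show ?case by (simp only: a_def b_def)
qed auto

section \<open>Higher derivatives of composites and Taylor polynomials\<close>

text \<open>
  \<open>jet_comp d k F a\<close> is the \<open>k\<close>-th derivative at \<open>0\<close> of \<open>F \<circ> c\<close> in terms of the derivatives
  \<open>a l = c\<^sup>(\<^sup>l\<^sup>)(0)\<close>, \<open>l \<le> k\<close>, of the curve \<open>c\<close>: Leibniz' rule applied to \<open>(F \<circ> c)' = \<Sum>i. (\<partial>\<^sub>iF \<circ> c) c\<^sub>i'\<close>.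
\<close>

fun jet_comp :: "nat \<Rightarrow> nat \<Rightarrow> ((nat \<Rightarrow> real) \<Rightarrow> real) \<Rightarrow> (nat \<Rightarrow> nat \<Rightarrow> real) \<Rightarrow> real" where
  "jet_comp d 0 F a = F (a 0)"
| "jet_comp d (Suc k) F a =
    (\<Sum>i<d. \<Sum>l\<le>k. of_nat (k choose l) * jet_comp d l (pd i F) a * a (Suc (k - l)) i)"

text \<open>Strong induction with \<open>F\<close> arbitrary: after one differentiation, Leibniz'
  rule asks for the derivatives of \<open>pd i F\<close> along \<open>c\<close> of every order below
  \<open>k\<close>.\<close>

lemma higher_deriv_compose:
  assumes U: "eopen d U" and F: "C_infinity_on d U F" and c: "\<And>i. i < d \<Longrightarrow> sgerm (\<lambda>t. c t i)"
    and cU: "\<forall>\<^sub>F t in nhds 0. c t \<in> U"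
  shows "(deriv ^^ k) (\<lambda>t. F (c t)) 0 = jet_comp d k F (\<lambda>l i. (deriv ^^ l) (\<lambda>t. c t i) 0)"
  using F
proof (induction k arbitrary: F rule: less_induct)
  case (less k)
  show ?case
  proof (cases k)
    case (Suc m)
    have "\<forall>\<^sub>F t in nhds 0. \<forall>\<^sub>F u in nhds t. c u \<in> U" using cU by (simp add: eventually_eventually)
    moreover have "\<forall>\<^sub>F t in nhds 0. \<forall>i\<in>{..<d}. ((\<lambda>t. c t i) has_real_derivative deriv (\<lambda>t. c t i) t) (at t)"
      using sgerm_has_derivative[OF c] by (intro eventually_ball_finite) auto
    ultimately have "\<forall>\<^sub>F t in nhds 0. deriv (\<lambda>t. F (c t)) t = (\<Sum>i<d. pd i F (c t) * deriv (\<lambda>t. c t i) t)"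
    proof eventually_elim
      case (elim t)
      have "C_k_on (Suc 0) d U F" using less.prems by (simp add: C_infinity_on_def)
      moreover have "c t \<in> U" using eventually_nhds_x_imp_x[OF elim(1)] .
      moreover have "\<forall>\<^sub>F u in nhds t. c u \<in> esp d" using elim(1) by eventually_elim (use U openin_subset in blast)
      ultimately show ?case using elim(2) by (intro DERIV_imp_deriv DERIV_compose_curve[OF U]) auto
    qed
    then have "(deriv ^^ k) (\<lambda>t. F (c t)) 0 = (deriv ^^ m) (\<lambda>t. \<Sum>i<d. pd i F (c t) * deriv (\<lambda>t. c t i) t) 0"
      unfolding Suc higher_deriv_Suc by (rule higher_deriv_ev_cong)
    also have "\<dots> = (\<Sum>i<d. (deriv ^^ m) (\<lambda>t. pd i F (c t) * deriv (\<lambda>t. c t i) t) 0)"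
      using U less.prems c cU
      by (intro higher_deriv_sum_germ sgerm_mult sgerm_deriv sgerm_compose[OF U C_infinity_on_pd[OF U]]) auto
    also have "\<dots> = (\<Sum>i<d. \<Sum>l\<le>m. of_nat (m choose l) * jet_comp d l (pd i F) (\<lambda>l i. (deriv ^^ l) (\<lambda>t. c t i) 0)
        * (deriv ^^ (Suc (m - l))) (\<lambda>t. c t i) 0)"
    proof (intro sum.cong refl)
      fix i assume "i \<in> {..<d}"
      then have i: "i < d" by simp
      have "(deriv ^^ m) (\<lambda>t. pd i F (c t) * deriv (\<lambda>t. c t i) t) 0 =
        (\<Sum>l\<le>m. of_nat (m choose l) * (deriv ^^ l) (\<lambda>t. pd i F (c t)) 0 * (deriv ^^ (m - l)) (deriv (\<lambda>t. c t i)) 0)"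
        by (intro higher_deriv_mult_germ sgerm_deriv sgerm_compose[OF U C_infinity_on_pd[OF U less.prems i]] c i cU)
      also have "\<dots> = (\<Sum>l\<le>m. of_nat (m choose l) * jet_comp d l (pd i F) (\<lambda>l i. (deriv ^^ l) (\<lambda>t. c t i) 0)
        * (deriv ^^ (Suc (m - l))) (\<lambda>t. c t i) 0)"
        using Suc by (intro sum.cong refl) (simp add: less.IH[OF _ C_infinity_on_pd[OF U less.prems i]] higher_deriv_Suc del: funpow.simps(2))
      finally show "(deriv ^^ m) (\<lambda>t. pd i F (c t) * deriv (\<lambda>t. c t i) t) 0 = \<dots>" .
    qed
    finally show ?thesis by (simp add: Suc del: funpow.simps(2))
  qed simp
qed

text \<open>At order \<open>0\<close> full equality is required, also from index \<open>d\<close>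
  on, because \<open>F\<close> is applied to \<open>a 0\<close> itself.\<close>

lemma jet_comp_cong:
  "a 0 = b 0 \<Longrightarrow> (\<And>l i. l \<le> k \<Longrightarrow> i < d \<Longrightarrow> a l i = b l i) \<Longrightarrow> jet_comp d k F a = jet_comp d k F b"
proof (induction k arbitrary: F rule: less_induct)
  case (less k)
  show ?case
  proof (cases k)
    case (Suc m)
    have "jet_comp d l G a = jet_comp d l G b" if "l \<le> m" for l G
      by (rule less.IH) (use that Suc less.prems in auto)
    then show ?thesis unfolding Suc jet_comp.simps
      by (intro sum.cong refl arg_cong2[of _ _ _ _ "(*)"]) (use Suc less.prems(2) in auto)
  qed (use less.prems in simp)
qed

text \<open>The recursion shows \<open>jet_comp\<close> to be a polynomial in the entries of
  positive order whose coefficients are iterated partial derivatives of \<open>F\<close> at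
  \<open>a 0\<close>. This is the source of smoothness for maps between jet manifolds.\<close>

lemma C_infinity_on_jet_comp:
  assumes V: "eopen e V" and U: "eopen d U" and F: "C_infinity_on d U F"
    and a: "\<And>l i. l \<le> k \<Longrightarrow> i < d \<Longrightarrow> C_infinity_on e V (\<lambda>x. a x l i)" and a0: "\<And>x. x \<in> V \<Longrightarrow> a x 0 \<in> U"
  shows "C_infinity_on e V (\<lambda>x. jet_comp d k F (a x))"
  using F a
proof (induction k arbitrary: F rule: less_induct)
  case (less k)
  show ?case
  proof (cases k)
    case 0
    then show ?thesis using C_infinity_on_compose[OF V U a0 _ less.prems(1)] less.prems(2) by simp
  next
    case (Suc m)
    have "C_infinity_on e V (\<lambda>x. jet_comp d l (pd i F) (a x))" if "l \<le> m" "i < d" for l i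
      by (rule less.IH[OF _ C_infinity_on_pd[OF U less.prems(1) that(2)] less.prems(2)])
        (use that Suc in auto)
    moreover have "C_infinity_on e V (\<lambda>x. a x (Suc (m - l)) i)" if "i < d" for l i
      using that Suc by (intro less.prems(2)) auto
    ultimately show ?thesis unfolding Suc jet_comp.simps
      by (intro C_infinity_on_sum C_infinity_on_mult C_infinity_on_const) auto
  qed
qed

definition taylor :: "nat \<Rightarrow> (nat \<Rightarrow> real) \<Rightarrow> real \<Rightarrow> real" where
  "taylor n a t = (\<Sum>l\<le>n. a l / fact l * t ^ l)"

lemma higher_deriv_monomial:
  "(deriv ^^ k) (\<lambda>t::real. c * t ^ m) 0 = (if k = m then c * fact m else 0)"
proof (induction m arbitrary: c k)
  case 0
  then show ?case by (simp add: higher_deriv_const_0)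
next
  case (Suc m)
  have "deriv (\<lambda>t::real. c * t ^ Suc m) = (\<lambda>t. (c * of_nat (Suc m)) * t ^ m)"
  proof (intro ext DERIV_imp_deriv)
    show "((\<lambda>t. c * t ^ Suc m) has_real_derivative c * of_nat (Suc m) * t ^ m) (at t)" for t
      using DERIV_cmult[OF DERIV_pow[of "Suc m" t], of c] by (simp add: algebra_simps)
  qed
  then show ?case
    using Suc.IH[of _ "c * of_nat (Suc m)"]
    by (cases k) (auto simp: higher_deriv_Suc algebra_simps simp del: funpow.simps(2) power_Suc)
qed

lemma sgerm_taylor: "sgerm (taylor n a)"
  unfolding taylor_def[abs_def] by (intro sgerm_sum sgerm_mult sgerm_const sgerm_power)

text \<open>Arbitrary derivatives can be prescribed at \<open>0\<close>; jet charts therefore have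
  open images, and missing curves can be supplied from coordinates.\<close>

lemma higher_deriv_taylor: "k \<le> n \<Longrightarrow> (deriv ^^ k) (taylor n a) 0 = a k"
proof -
  assume "k \<le> n"
  have "(deriv ^^ k) (\<lambda>t. \<Sum>l\<le>n. a l / fact l * t ^ l) 0 = (\<Sum>l\<le>n. (deriv ^^ k) (\<lambda>t. a l / fact l * t ^ l) 0)"
    by (rule higher_deriv_sum_germ) (intro sgerm_mult sgerm_const sgerm_power)
  also have "\<dots> = (\<Sum>l\<le>n. if k = l then a k else 0)"
    by (intro sum.cong refl) (simp only: higher_deriv_monomial, simp)
  finally show ?thesis using \<open>k \<le> n\<close> by (simp add: taylor_def[abs_def])
qed

lemma sgerm_shift_deriv:
  "(deriv ^^ k) (\<lambda>t. f (s + t)) 0 = (deriv ^^ k) (f :: real \<Rightarrow> real) s"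
  using higher_deriv_shift_0[of k f s] by (simp add: o_def)

lemma sgerm_tendsto: "sgerm f \<Longrightarrow> (f \<longlongrightarrow> f 0) (nhds 0)"
  using DERIV_isCont[OF sgerm_has_derivative_0] by (simp add: isCont_def tendsto_at_iff_tendsto_nhds)

lemma sgerm_eventually_in_eopen:
  assumes "eopen d U" "c 0 \<in> U" "\<And>i. i < d \<Longrightarrow> sgerm (\<lambda>t. c t i)" "\<And>t i. i \<ge> d \<Longrightarrow> c t i = 0"
  shows "\<forall>\<^sub>F t in nhds 0. c t \<in> U"
  using assms sgerm_tendsto by (intro eventually_in_eopen[of d U "c 0"]) (fastforce simp: esp_iff)+

section \<open>Smooth maps in coordinates\<close>

text \<open>Separates the conditions on charts from the Hausdorff property, which is established on
  its own for products, jets and the fibre over the identity.\<close>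

definition smooth_atlas :: "'a manifold \<Rightarrow> bool" where
  "smooth_atlas M \<longleftrightarrow>
     (\<Union>(D, \<phi>)\<in>atlas M. D) = points M \<and>
     (\<forall>(D, \<phi>)\<in>atlas M. inj_on \<phi> D \<and> eopen (mdim M) (\<phi> ` D)) \<and>
     (\<forall>(D, \<phi>)\<in>atlas M. \<forall>(E, \<psi>)\<in>atlas M.
        eopen (mdim M) (\<phi> ` (D \<inter> E)) \<and>
        (\<forall>j<mdim M. C_infinity_on (mdim M) (\<phi> ` (D \<inter> E)) (\<lambda>u. \<psi> (inv_into D \<phi> u) j)))"

lemma smooth_manifold_iff: "smooth_manifold M \<longleftrightarrow> smooth_atlas M \<and> Hausdorff_space (mtop M)"
  unfolding smooth_manifold_def smooth_atlas_def by blast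

lemma
  assumes "smooth_atlas M" "(D, \<phi>) \<in> atlas M"
  shows chart_subset: "D \<subseteq> points M" and chart_inj: "inj_on \<phi> D" and chart_eopen: "eopen (mdim M) (\<phi> ` D)"
proof -
  note * = iffD1[OF smooth_atlas_def assms(1)]
  show "D \<subseteq> points M" using conjunct1[OF *] assms(2) by auto
  show "inj_on \<phi> D" "eopen (mdim M) (\<phi> ` D)" using bspec[OF conjunct1[OF conjunct2[OF *]] assms(2)] by auto
qed

lemma chart_esp: "smooth_atlas M \<Longrightarrow> (D, \<phi>) \<in> atlas M \<Longrightarrow> x \<in> D \<Longrightarrow> \<phi> x \<in> esp (mdim M)"
  using chart_eopen[of M D \<phi>] openin_subset by blast

lemma chart_exists:
  assumes "smooth_atlas M" "x \<in> points M"
  obtains D \<phi> where "(D, \<phi>) \<in> atlas M" "x \<in> D"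
proof -
  have "x \<in> (\<Union>(D, \<phi>)\<in>atlas M. D)" using assms(2) conjunct1[OF iffD1[OF smooth_atlas_def assms(1)]] by simp
  then show ?thesis using that by auto
qed

text \<open>The predicate inside \<open>topology\<close> must first be shown to be a topology;
  injectivity of the charts is what lets images commute with intersections.\<close>

lemma openin_mtop:
  assumes "smooth_atlas M"
  shows "openin (mtop M) U \<longleftrightarrow> U \<subseteq> points M \<and> (\<forall>(D, \<phi>)\<in>atlas M. eopen (mdim M) (\<phi> ` (U \<inter> D)))"
proof -
  have "istopology (\<lambda>U. U \<subseteq> points M \<and> (\<forall>(D, \<phi>)\<in>atlas M. eopen (mdim M) (\<phi> ` (U \<inter> D))))"
    unfolding istopology_def
  proof (intro conjI allI impI)
    fix S T assume ST: "S \<subseteq> points M \<and> (\<forall>(D, \<phi>)\<in>atlas M. eopen (mdim M) (\<phi> ` (S \<inter> D)))"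
      "T \<subseteq> points M \<and> (\<forall>(D, \<phi>)\<in>atlas M. eopen (mdim M) (\<phi> ` (T \<inter> D)))"
    then show "S \<inter> T \<subseteq> points M" by blast
    show "\<forall>(D, \<phi>)\<in>atlas M. eopen (mdim M) (\<phi> ` (S \<inter> T \<inter> D))"
    proof safe
      fix D \<phi> assume c: "(D, \<phi>) \<in> atlas M"
      have "\<phi> ` (S \<inter> T \<inter> D) = \<phi> ` (S \<inter> D) \<inter> \<phi> ` (T \<inter> D)"
        using chart_inj[OF assms c] by (auto simp: inj_on_def)
      then show "eopen (mdim M) (\<phi> ` (S \<inter> T \<inter> D))" using ST c by (auto intro: openin_Int)
    qed
  next
    fix \<K> assume K: "\<forall>U\<in>\<K>. U \<subseteq> points M \<and> (\<forall>(D, \<phi>)\<in>atlas M. eopen (mdim M) (\<phi> ` (U \<inter> D)))"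
    then show "\<Union>\<K> \<subseteq> points M" by blast
    show "\<forall>(D, \<phi>)\<in>atlas M. eopen (mdim M) (\<phi> ` (\<Union>\<K> \<inter> D))"
    proof safe
      fix D \<phi> assume c: "(D, \<phi>) \<in> atlas M"
      have "\<phi> ` (\<Union>\<K> \<inter> D) = (\<Union>U\<in>\<K>. \<phi> ` (U \<inter> D))" by blast
      moreover have "eopen (mdim M) (\<phi> ` (U \<inter> D))" if "U \<in> \<K>" for U using K c that by blast
      ultimately show "eopen (mdim M) (\<phi> ` (\<Union>\<K> \<inter> D))" by (simp only:) (rule openin_Union, blast)
    qed
  qed
  then show ?thesis unfolding mtop_def by (simp add: topology_inverse')
qed

lemma topspace_mtop:
  assumes "smooth_atlas M" shows "topspace (mtop M) = points M"
proof -
  have "openin (mtop M) (points M)"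
    unfolding openin_mtop[OF assms]
  proof safe
    fix D \<phi> assume c: "(D, \<phi>) \<in> atlas M"
    then have "points M \<inter> D = D" using chart_subset[OF assms c] by blast
    then show "eopen (mdim M) (\<phi> ` (points M \<inter> D))" using chart_eopen[OF assms c] by simp
  qed
  moreover have "topspace (mtop M) \<subseteq> points M"
    using openin_mtop[OF assms] openin_topspace by blast
  ultimately show ?thesis using openin_subset by blast
qed

lemma
  assumes "smooth_atlas M" "(D, \<phi>) \<in> atlas M" "(E, \<psi>) \<in> atlas M"
  shows chart_overlap_eopen: "eopen (mdim M) (\<phi> ` (D \<inter> E))"
    and chart_overlap_smooth: "j < mdim M \<Longrightarrow> C_infinity_on (mdim M) (\<phi> ` (D \<inter> E)) (\<lambda>u. \<psi> (inv_into D \<phi> u) j)"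
proof -
  have "\<forall>(D, \<phi>)\<in>atlas M. \<forall>(E, \<psi>)\<in>atlas M.
        eopen (mdim M) (\<phi> ` (D \<inter> E)) \<and>
        (\<forall>j<mdim M. C_infinity_on (mdim M) (\<phi> ` (D \<inter> E)) (\<lambda>u. \<psi> (inv_into D \<phi> u) j))"
    by (rule conjunct2[OF conjunct2[OF iffD1[OF smooth_atlas_def assms(1)]]])
  from bspec[OF this assms(2)] assms(3) show "eopen (mdim M) (\<phi> ` (D \<inter> E))"
    "j < mdim M \<Longrightarrow> C_infinity_on (mdim M) (\<phi> ` (D \<inter> E)) (\<lambda>u. \<psi> (inv_into D \<phi> u) j)" by auto
qed

lemma openin_chart: "smooth_atlas M \<Longrightarrow> (D, \<phi>) \<in> atlas M \<Longrightarrow> openin (mtop M) D"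
  using chart_subset[of M D \<phi>] chart_overlap_eopen[of M _ _ D \<phi>] by (auto simp: openin_mtop Int_commute)

text \<open>A local form \<open>g\<close> is merely asserted to exist, so local forms compose
  without any \<open>inv_into\<close>. Mapping nearby points into \<open>E\<close> carries the
  continuity of \<open>f\<close>, and values of \<open>g\<close> in \<open>esp e\<close> make
  preimages under \<open>g\<close> of open sets open.\<close>

definition smooth_rep :: "nat \<Rightarrow> 'a set \<Rightarrow> ('a \<Rightarrow> nat \<Rightarrow> real) \<Rightarrow> nat \<Rightarrow> 'b set \<Rightarrow> ('b \<Rightarrow> nat \<Rightarrow> real) \<Rightarrow> ('a \<Rightarrow> 'b) \<Rightarrow> 'a \<Rightarrow> bool" where
  "smooth_rep d D \<phi> e E \<psi> f x \<longleftrightarrow> (\<exists>U g. eopen d U \<and> \<phi> x \<in> U \<and>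
     (\<forall>y\<in>D. \<phi> y \<in> U \<longrightarrow> f y \<in> E \<and> \<psi> (f y) = g (\<phi> y)) \<and>
     (\<forall>u\<in>U. g u \<in> esp e) \<and> (\<forall>j<e. C_infinity_on d U (\<lambda>u. g u j)))"

lemma smooth_repI:
  assumes "eopen d U" "\<phi> x \<in> U" "\<And>y. y \<in> D \<Longrightarrow> \<phi> y \<in> U \<Longrightarrow> f y \<in> E"
    "\<And>y. y \<in> D \<Longrightarrow> \<phi> y \<in> U \<Longrightarrow> \<psi> (f y) \<in> esp e"
    "\<And>y j. y \<in> D \<Longrightarrow> \<phi> y \<in> U \<Longrightarrow> j < e \<Longrightarrow> \<psi> (f y) j = g (\<phi> y) j"
    "\<And>j. j < e \<Longrightarrow> C_infinity_on d U (\<lambda>u. g u j)"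
  shows "smooth_rep d D \<phi> e E \<psi> f x"
  unfolding smooth_rep_def
\<comment> \<open>Only the coordinates of \<open>g\<close> below \<open>e\<close> are controlled, so
  the remaining ones are set to \<open>0\<close> in the witness.\<close>
proof (intro exI[of _ U] exI[of _ "\<lambda>u j. if j < e then g u j else 0"] conjI ballI impI allI)
  fix y assume "y \<in> D" "\<phi> y \<in> U"
  then show "\<psi> (f y) = (\<lambda>j. if j < e then g (\<phi> y) j else 0)"
    using assms(4,5) by (intro esp_eqI[of _ e]) (auto simp: esp_iff)
qed (use assms in \<open>auto simp: esp_iff\<close>)

lemma smooth_rep_cong:
  assumes "smooth_rep d D \<phi> e E \<psi> f x" "\<And>y. y \<in> D \<Longrightarrow> f y = g y"
  shows "smooth_rep d D \<phi> e E \<psi> g x"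
  using assms unfolding smooth_rep_def by (elim exE conjE) (intro exI conjI, auto)

lemma smooth_rep_compose:
  assumes "smooth_rep d D \<phi> e E \<psi> f x" "smooth_rep e E \<psi> k F \<theta> h (f x)" "x \<in> D"
  shows "smooth_rep d D \<phi> k F \<theta> (\<lambda>x. h (f x)) x"
proof -
  obtain U g where U: "eopen d U" "\<phi> x \<in> U" "\<And>y. y \<in> D \<Longrightarrow> \<phi> y \<in> U \<Longrightarrow> f y \<in> E \<and> \<psi> (f y) = g (\<phi> y)"
    "\<And>u. u \<in> U \<Longrightarrow> g u \<in> esp e" "\<And>j. j < e \<Longrightarrow> C_infinity_on d U (\<lambda>u. g u j)"
    using assms(1) unfolding smooth_rep_def by blast
  obtain V g' where V: "eopen e V" "\<psi> (f x) \<in> V" "\<And>y. y \<in> E \<Longrightarrow> \<psi> y \<in> V \<Longrightarrow> h y \<in> F \<and> \<theta> (h y) = g' (\<psi> y)"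
    "\<And>u. u \<in> V \<Longrightarrow> g' u \<in> esp k" "\<And>j. j < k \<Longrightarrow> C_infinity_on e V (\<lambda>u. g' u j)"
    using assms(2) unfolding smooth_rep_def by blast
  have W: "eopen d {u \<in> U. g u \<in> V}"
    by (rule eopen_preimage_smooth[OF U(1,5) _ V(1)]) (use U(4) esp_iff in blast)+
  show ?thesis unfolding smooth_rep_def
  proof (intro exI[of _ "{u \<in> U. g u \<in> V}"] exI[of _ "\<lambda>u. g' (g u)"] conjI allI impI ballI)
    fix j assume "j < k"
    then show "C_infinity_on d {u \<in> U. g u \<in> V} (\<lambda>u. g' (g u) j)"
      by (intro C_infinity_on_compose[OF W V(1) _ _ V(5)] C_infinity_on_subset[OF U(5)]) auto
  qed (use U V W assms(3) in auto)
qed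

lemma smooth_rep_transition:
  assumes M: "smooth_atlas M" and D: "(D, \<phi>) \<in> atlas M" and E: "(E, \<psi>) \<in> atlas M" and x: "x \<in> D" "x \<in> E"
  shows "smooth_rep (mdim M) D \<phi> (mdim M) E \<psi> (\<lambda>x. x) x"
proof (rule smooth_repI[where U = "\<phi> ` (D \<inter> E)" and g = "\<lambda>u. \<psi> (inv_into D \<phi> u)"])
  show "eopen (mdim M) (\<phi> ` (D \<inter> E))" by (rule chart_overlap_eopen[OF M D E])
  show "C_infinity_on (mdim M) (\<phi> ` (D \<inter> E)) (\<lambda>u. \<psi> (inv_into D \<phi> u) j)" if "j < mdim M" for j
    by (rule chart_overlap_smooth[OF M D E that])
  fix y assume y: "y \<in> D" "\<phi> y \<in> \<phi> ` (D \<inter> E)"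
  then show "y \<in> E" using chart_inj[OF M D] by (auto simp: inj_on_def)
  then show "\<psi> y \<in> esp (mdim M)" by (rule chart_esp[OF M E])
  show "\<psi> y j = \<psi> (inv_into D \<phi> (\<phi> y)) j" for j
    using chart_inj[OF M D] y(1) by simp
qed (use x in blast)

lemma smooth_rep_imp_C_infinity:
  assumes "smooth_rep d D \<phi> e E \<psi> f x" "inj_on \<phi> D" "eopen d (\<phi> ` D)" "x \<in> D"
  shows "\<exists>V. eopen d V \<and> \<phi> x \<in> V \<and> V \<subseteq> \<phi> ` (D \<inter> f -` E) \<and> (\<forall>j<e. C_infinity_on d V (\<lambda>u. \<psi> (f (inv_into D \<phi> u)) j))"
proof -
  obtain U g where U: "eopen d U" "\<phi> x \<in> U" "\<And>y. y \<in> D \<Longrightarrow> \<phi> y \<in> U \<Longrightarrow> f y \<in> E \<and> \<psi> (f y) = g (\<phi> y)"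
    "\<And>u. u \<in> U \<Longrightarrow> g u \<in> esp e" "\<And>j. j < e \<Longrightarrow> C_infinity_on d U (\<lambda>u. g u j)"
    using assms(1) unfolding smooth_rep_def by blast
  have V: "eopen d (U \<inter> \<phi> ` D)" using U(1) assms(3) by blast
  have "C_infinity_on d (U \<inter> \<phi> ` D) (\<lambda>u. \<psi> (f (inv_into D \<phi> u)) j)" if "j < e" for j
  proof -
    have "C_infinity_on d (U \<inter> \<phi> ` D) (\<lambda>u. g u j)" using U(5)[OF that] by (rule C_infinity_on_subset) blast
    moreover have "g u j = \<psi> (f (inv_into D \<phi> u)) j" if "u \<in> U \<inter> \<phi> ` D" for u
      using that U(3) assms(2) by auto
    ultimately show ?thesis using C_infinity_on_cong[OF V] by meson
  qed
  moreover have "U \<inter> \<phi> ` D \<subseteq> \<phi> ` (D \<inter> f -` E)" using U(3) by auto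
  moreover have "\<phi> x \<in> U \<inter> \<phi> ` D" using U(2) assms(4) by blast
  ultimately show ?thesis using V by blast
qed

text \<open>Transition maps need only be examined near one point: the neighbourhoods obtained from
  \<open>smooth_rep\<close> lie inside the image of the overlap and thereby also prove that image
  open.\<close>

lemma smooth_atlasI:
  assumes "(\<Union>(D, \<phi>)\<in>atlas M. D) = points M"
    and inj: "\<And>D \<phi>. (D, \<phi>) \<in> atlas M \<Longrightarrow> inj_on \<phi> D"
    and op: "\<And>D \<phi>. (D, \<phi>) \<in> atlas M \<Longrightarrow> eopen (mdim M) (\<phi> ` D)"
    and tr: "\<And>D \<phi> E \<psi> x. (D, \<phi>) \<in> atlas M \<Longrightarrow> (E, \<psi>) \<in> atlas M \<Longrightarrow> x \<in> D \<Longrightarrow> x \<in> E \<Longrightarrow>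
      smooth_rep (mdim M) D \<phi> (mdim M) E \<psi> (\<lambda>x. x) x"
  shows "smooth_atlas M"
  unfolding smooth_atlas_def
proof (intro conjI ballI; clarify?)
  show "(\<Union>(D, \<phi>)\<in>atlas M. D) = points M" by fact
next
  fix D \<phi> assume "(D, \<phi>) \<in> atlas M"
  then show "inj_on \<phi> D \<and> eopen (mdim M) (\<phi> ` D)" using inj op by blast
next
  fix D \<phi> E \<psi> assume D: "(D, \<phi>) \<in> atlas M" and E: "(E, \<psi>) \<in> atlas M"
  have *: "\<exists>V. eopen (mdim M) V \<and> u \<in> V \<and> V \<subseteq> \<phi> ` (D \<inter> E) \<and> (\<forall>j<mdim M. C_infinity_on (mdim M) V (\<lambda>u. \<psi> (inv_into D \<phi> u) j))"
    if u: "u \<in> \<phi> ` (D \<inter> E)" for u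
  proof -
    obtain x where x: "x \<in> D" "x \<in> E" "u = \<phi> x" using u by blast
    show ?thesis
      using smooth_rep_imp_C_infinity[OF tr[OF D E x(1,2)] inj[OF D] op[OF D] x(1)] x(3) by (simp add: vimage_def)
  qed
  have sub: "\<phi> ` (D \<inter> E) \<subseteq> esp (mdim M)" using openin_subset[OF op[OF D]] by blast
  show "eopen (mdim M) (\<phi> ` (D \<inter> E)) \<and>
      (\<forall>j<mdim M. C_infinity_on (mdim M) (\<phi> ` (D \<inter> E)) (\<lambda>u. \<psi> (inv_into D \<phi> u) j))"
  proof (intro conjI allI impI)
    show "eopen (mdim M) (\<phi> ` (D \<inter> E))" by (rule eopenI[OF sub]) (use * in blast)
    show "C_infinity_on (mdim M) (\<phi> ` (D \<inter> E)) (\<lambda>u. \<psi> (inv_into D \<phi> u) j)" if "j < mdim M" for j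
      by (rule C_infinity_on_local[OF _ sub]) (use * that in blast)
  qed
qed

text \<open>Continuity of a chart. Openness in \<open>mtop M\<close> has to be tested in every chart
  \<open>\<psi>\<close>, where the set becomes a preimage under a transition map.\<close>

lemma openin_chart_preimage:
  assumes M: "smooth_atlas M" and D: "(D, \<phi>) \<in> atlas M" and V: "eopen (mdim M) V"
  shows "openin (mtop M) {x \<in> D. \<phi> x \<in> V}"
  unfolding openin_mtop[OF M]
proof (intro conjI ballI; clarify?)
  fix E \<psi> assume E: "(E, \<psi>) \<in> atlas M"
  show "eopen (mdim M) (\<psi> ` ({x \<in> D. \<phi> x \<in> V} \<inter> E))"
  proof (rule eopenI)
    show "\<psi> ` ({x \<in> D. \<phi> x \<in> V} \<inter> E) \<subseteq> esp (mdim M)" using chart_esp[OF M E] by blast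
    fix u assume "u \<in> \<psi> ` ({x \<in> D. \<phi> x \<in> V} \<inter> E)"
    then obtain x where x: "x \<in> D" "\<phi> x \<in> V" "x \<in> E" "u = \<psi> x" by blast
    obtain U g where U: "eopen (mdim M) U" "\<psi> x \<in> U" "\<And>y. y \<in> E \<Longrightarrow> \<psi> y \<in> U \<Longrightarrow> y \<in> D \<and> \<phi> y = g (\<psi> y)"
      "\<And>u. u \<in> U \<Longrightarrow> g u \<in> esp (mdim M)" "\<And>j. j < mdim M \<Longrightarrow> C_infinity_on (mdim M) U (\<lambda>u. g u j)"
      using smooth_rep_transition[OF M E D x(3,1)] unfolding smooth_rep_def by blast
    have "eopen (mdim M) ({u \<in> U. g u \<in> V} \<inter> \<psi> ` E)"
      by (intro openin_Int chart_eopen[OF M E] eopen_preimage_smooth[OF U(1,5) _ V])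
        (use U(4) esp_iff in blast)+
    then show "\<exists>W. eopen (mdim M) W \<and> u \<in> W \<and> W \<subseteq> \<psi> ` ({x \<in> D. \<phi> x \<in> V} \<inter> E)"
      by (intro exI[of _ "{u \<in> U. g u \<in> V} \<inter> \<psi> ` E"] conjI) (use U(2,3) x in auto)
  qed
qed (use chart_subset[OF M D] in blast)

lemma smooth_map_points:
  assumes "smooth_atlas M" "smooth_atlas N" "smooth_map M N f" "x \<in> points M"
  shows "f x \<in> points N"
  using assms continuous_map_image_subset_topspace[of "mtop M" "mtop N" f]
  by (auto simp: smooth_map_def topspace_mtop)

lemma
  assumes M: "smooth_atlas M" and N: "smooth_atlas N" and f: "smooth_map M N f"
    and D: "(D, \<phi>) \<in> atlas M" and E: "(E, \<psi>) \<in> atlas N"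
  shows eopen_chart_vimage: "eopen (mdim M) (\<phi> ` (D \<inter> f -` E))"
    and C_infinity_on_chart_vimage: "j < mdim N \<Longrightarrow>
      C_infinity_on (mdim M) (\<phi> ` (D \<inter> f -` E)) (\<lambda>u. \<psi> (f (inv_into D \<phi> u)) j)"
proof -
  have "openin (mtop M) {x \<in> topspace (mtop M). f x \<in> E}"
    using f openin_chart[OF N E] unfolding smooth_map_def continuous_map by blast
  moreover have "{x \<in> topspace (mtop M). f x \<in> E} \<inter> D = D \<inter> f -` E"
    using chart_subset[OF M D] by (auto simp: topspace_mtop[OF M])
  ultimately show "eopen (mdim M) (\<phi> ` (D \<inter> f -` E))"
    using D unfolding openin_mtop[OF M] by force
  show "C_infinity_on (mdim M) (\<phi> ` (D \<inter> f -` E)) (\<lambda>u. \<psi> (f (inv_into D \<phi> u)) j)" if "j < mdim N"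
    using f D E that unfolding smooth_map_def by fast
qed

lemma smooth_mapD:
  assumes M: "smooth_atlas M" and N: "smooth_atlas N" and f: "smooth_map M N f"
    and D: "(D, \<phi>) \<in> atlas M" and E: "(E, \<psi>) \<in> atlas N" and x: "x \<in> D" "f x \<in> E"
  shows "smooth_rep (mdim M) D \<phi> (mdim N) E \<psi> f x"
proof (rule smooth_repI[where U = "\<phi> ` (D \<inter> f -` E)" and g = "\<lambda>u. \<psi> (f (inv_into D \<phi> u))"])
  show "eopen (mdim M) (\<phi> ` (D \<inter> f -` E))" by (rule eopen_chart_vimage[OF M N f D E])
  show "C_infinity_on (mdim M) (\<phi> ` (D \<inter> f -` E)) (\<lambda>u. \<psi> (f (inv_into D \<phi> u)) j)" if "j < mdim N" for j
    by (rule C_infinity_on_chart_vimage[OF M N f D E that])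
  fix y assume y: "y \<in> D" "\<phi> y \<in> \<phi> ` (D \<inter> f -` E)"
  then show "f y \<in> E" using chart_inj[OF M D] by (auto simp: inj_on_def)
  then show "\<psi> (f y) \<in> esp (mdim N)" by (rule chart_esp[OF N E])
  show "\<psi> (f y) j = \<psi> (f (inv_into D \<phi> (\<phi> y))) j" for j
    using chart_inj[OF M D] y(1) by simp
qed (use x in blast)

text \<open>One pair of charts per point suffices although \<open>smooth_map\<close> quantifies over
  all pairs: the others are reached through transition maps. Continuity is read off from the same
  local forms.\<close>

lemma smooth_mapI:
  assumes M: "smooth_atlas M" and N: "smooth_atlas N"
    and f: "\<And>x. x \<in> points M \<Longrightarrow> \<exists>D \<phi> E \<psi>. (D, \<phi>) \<in> atlas M \<and> (E, \<psi>) \<in> atlas N \<and> x \<in> D \<and>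
      smooth_rep (mdim M) D \<phi> (mdim N) E \<psi> f x"
  shows "smooth_map M N f"
  unfolding smooth_map_def
proof (intro conjI ballI; clarify?)
  have mem: "f x \<in> E" if "smooth_rep (mdim M) D \<phi> (mdim N) E \<psi> f x" "x \<in> D" for D \<phi> E \<psi> x
    using that unfolding smooth_rep_def by blast
  show "continuous_map (mtop M) (mtop N) f"
    unfolding continuous_map topspace_mtop[OF M] topspace_mtop[OF N]
  proof (intro conjI allI impI)
    show "f ` points M \<subseteq> points N"
    proof (rule image_subsetI)
      fix x assume "x \<in> points M"
      from f[OF this] show "f x \<in> points N" using mem chart_subset[OF N] by blast
    qed
    fix W assume W: "openin (mtop N) W"
    show "openin (mtop M) {x \<in> points M. f x \<in> W}"
    proof (subst openin_subopen, safe)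
      fix x assume x: "x \<in> points M" "f x \<in> W"
      obtain D \<phi> E \<psi> where DE: "(D, \<phi>) \<in> atlas M" "(E, \<psi>) \<in> atlas N" "x \<in> D"
        "smooth_rep (mdim M) D \<phi> (mdim N) E \<psi> f x" using f[OF x(1)] by blast
      obtain U g where U: "eopen (mdim M) U" "\<phi> x \<in> U" "\<And>y. y \<in> D \<Longrightarrow> \<phi> y \<in> U \<Longrightarrow> f y \<in> E \<and> \<psi> (f y) = g (\<phi> y)"
        "\<And>u. u \<in> U \<Longrightarrow> g u \<in> esp (mdim N)" "\<And>j. j < mdim N \<Longrightarrow> C_infinity_on (mdim M) U (\<lambda>u. g u j)"
        using DE(4) unfolding smooth_rep_def by blast
      have V: "eopen (mdim N) (\<psi> ` (W \<inter> E))" using W DE(2) unfolding openin_mtop[OF N] by blast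
      have "eopen (mdim M) {u \<in> U. g u \<in> \<psi> ` (W \<inter> E)}"
        by (rule eopen_preimage_smooth[OF U(1,5) _ V]) (use U(4) esp_iff in blast)+
      then have 1: "openin (mtop M) {y \<in> D. \<phi> y \<in> {u \<in> U. g u \<in> \<psi> ` (W \<inter> E)}}" (is "openin _ ?T")
        by (rule openin_chart_preimage[OF M DE(1)])
      have "f x \<in> E" "g (\<phi> x) = \<psi> (f x)" using U(2,3) DE(3) by auto
      then have 2: "x \<in> ?T" using x(2) DE(3) U(2) by auto
      have 3: "f y \<in> W" if "y \<in> ?T" for y
      proof -
        from that obtain w where y: "y \<in> D" "\<phi> y \<in> U" "g (\<phi> y) = \<psi> w" "w \<in> W" "w \<in> E" by auto
        then have "f y \<in> E" "\<psi> (f y) = \<psi> w" using U(3)[of y] by auto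
        then have "f y = w" using y chart_inj[OF N DE(2)] by (auto simp: inj_on_def)
        then show ?thesis using y by simp
      qed
      show "\<exists>T. openin (mtop M) T \<and> x \<in> T \<and> T \<subseteq> {x \<in> points M. f x \<in> W}"
        using 1 2 3 chart_subset[OF M DE(1)] by (intro exI[of _ ?T]) blast
    qed
  qed
  fix D' \<phi>' E' \<psi>' j assume D': "(D', \<phi>') \<in> atlas M" and E': "(E', \<psi>') \<in> atlas N"
    and j: "j < mdim N"
  show "C_infinity_on (mdim M) (\<phi>' ` (D' \<inter> f -` E')) (\<lambda>u. \<psi>' (f (inv_into D' \<phi>' u)) j)"
  proof (rule C_infinity_on_local)
    fix u assume "u \<in> \<phi>' ` (D' \<inter> f -` E')"
    then obtain x where x: "x \<in> D'" "f x \<in> E'" "u = \<phi>' x" by blast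
    then have "x \<in> points M" using chart_subset[OF M D'] by blast
    then obtain D \<phi> E \<psi> where DE: "(D, \<phi>) \<in> atlas M" "(E, \<psi>) \<in> atlas N" "x \<in> D"
      "smooth_rep (mdim M) D \<phi> (mdim N) E \<psi> f x" using f by blast
    have 1: "smooth_rep (mdim M) D' \<phi>' (mdim N) E \<psi> f x"
      by (rule smooth_rep_compose[where f = "\<lambda>x. x", OF smooth_rep_transition[OF M D' DE(1) x(1) DE(3)] DE(4) x(1)])
    have "smooth_rep (mdim M) D' \<phi>' (mdim N) E' \<psi>' f x"
      by (rule smooth_rep_compose[where h = "\<lambda>x. x", OF 1 smooth_rep_transition[OF N DE(2) E' mem[OF DE(4,3)] x(2)] x(1)])
    from smooth_rep_imp_C_infinity[OF this chart_inj[OF M D'] chart_eopen[OF M D'] x(1)]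
    show "\<exists>V. eopen (mdim M) V \<and> u \<in> V \<and> C_infinity_on (mdim M) V (\<lambda>u. \<psi>' (f (inv_into D' \<phi>' u)) j)"
      using j x(3) by blast
  qed (use chart_esp[OF M D'] in blast)
qed

lemma smooth_map_compose:
  assumes M: "smooth_atlas M" and N: "smooth_atlas N" and P: "smooth_atlas P"
    and f: "smooth_map M N f" and h: "smooth_map N P h"
  shows "smooth_map M P (\<lambda>x. h (f x))"
proof (rule smooth_mapI[OF M P])
  fix x assume x: "x \<in> points M"
  have fx: "f x \<in> points N" using smooth_map_points[OF M N f x] .
  have hx: "h (f x) \<in> points P" using smooth_map_points[OF N P h fx] .
  obtain D \<phi> where D: "(D, \<phi>) \<in> atlas M" "x \<in> D" using chart_exists[OF M x] .
  obtain E \<psi> where E: "(E, \<psi>) \<in> atlas N" "f x \<in> E" using chart_exists[OF N fx] .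
  obtain F \<theta> where F: "(F, \<theta>) \<in> atlas P" "h (f x) \<in> F" using chart_exists[OF P hx] .
  show "\<exists>D \<phi> F \<theta>. (D, \<phi>) \<in> atlas M \<and> (F, \<theta>) \<in> atlas P \<and> x \<in> D \<and> smooth_rep (mdim M) D \<phi> (mdim P) F \<theta> (\<lambda>x. h (f x)) x"
    using smooth_rep_compose[OF smooth_mapD[OF M N f D(1) E(1) D(2) E(2)] smooth_mapD[OF N P h E(1) F(1) E(2) F(2)] D(2)]
      D F by blast
qed

lemma smooth_map_cong:
  assumes M: "smooth_atlas M" and N: "smooth_atlas N" and f: "smooth_map M N f" and eq: "\<And>x. x \<in> points M \<Longrightarrow> f x = g x"
  shows "smooth_map M N g"
proof (rule smooth_mapI[OF M N])
  fix x assume x: "x \<in> points M"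
  have fx: "f x \<in> points N" using smooth_map_points[OF M N f x] .
  obtain D \<phi> where D: "(D, \<phi>) \<in> atlas M" "x \<in> D" using chart_exists[OF M x] .
  obtain E \<psi> where E: "(E, \<psi>) \<in> atlas N" "f x \<in> E" using chart_exists[OF N fx] .
  have "smooth_rep (mdim M) D \<phi> (mdim N) E \<psi> g x"
    by (rule smooth_rep_cong[OF smooth_mapD[OF M N f D(1) E(1) D(2) E(2)]]) (use eq chart_subset[OF M D(1)] in blast)
  then show "\<exists>D \<phi> E \<psi>. (D, \<phi>) \<in> atlas M \<and> (E, \<psi>) \<in> atlas N \<and> x \<in> D \<and> smooth_rep (mdim M) D \<phi> (mdim N) E \<psi> g x"
    using D E by blast
qed

lemma smooth_map_ident:
  assumes M: "smooth_atlas M" shows "smooth_map M M (\<lambda>x. x)"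
proof (rule smooth_mapI[OF M M])
  fix x assume x: "x \<in> points M"
  obtain D \<phi> where D: "(D, \<phi>) \<in> atlas M" "x \<in> D" using chart_exists[OF M x] .
  then show "\<exists>D \<phi> E \<psi>. (D, \<phi>) \<in> atlas M \<and> (E, \<psi>) \<in> atlas M \<and> x \<in> D \<and> smooth_rep (mdim M) D \<phi> (mdim M) E \<psi> (\<lambda>x. x) x"
    using smooth_rep_transition[OF M D(1) D(1) D(2) D(2)] by blast
qed

section \<open>Products of manifolds\<close>

definition take_coords :: "nat \<Rightarrow> (nat \<Rightarrow> real) \<Rightarrow> nat \<Rightarrow> real" where
  "take_coords d u = (\<lambda>i. if i < d then u i else 0)"

definition drop_coords :: "nat \<Rightarrow> (nat \<Rightarrow> real) \<Rightarrow> nat \<Rightarrow> real" where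
  "drop_coords d u = (\<lambda>i. u (i + d))"

lemma take_append: "u \<in> esp d \<Longrightarrow> take_coords d (append_coords d u v) = u"
  by (auto simp: take_coords_def append_coords_def esp_iff)

lemma drop_append: "drop_coords d (append_coords d u v) = v"
  by (auto simp: drop_coords_def append_coords_def)

lemma append_take_drop: "append_coords d (take_coords d u) (drop_coords d u) = u"
  by (auto simp: take_coords_def append_coords_def drop_coords_def)

lemma append_esp: "v \<in> esp e \<Longrightarrow> append_coords d u v \<in> esp (d + e)"
  by (auto simp: append_coords_def esp_iff)

lemma take_esp: "take_coords d u \<in> esp d"
  by (auto simp: take_coords_def esp_iff)

lemma drop_esp: "u \<in> esp (d + e) \<Longrightarrow> drop_coords d u \<in> esp e"
  by (auto simp: drop_coords_def esp_iff)

lemma C_infinity_on_take: "C_infinity_on k U (\<lambda>u. take_coords d u j)"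
  by (cases "j < d") (simp_all add: take_coords_def)

lemma C_infinity_on_drop: "C_infinity_on k U (\<lambda>u. drop_coords d u j)"
  by (simp add: drop_coords_def)

lemma C_infinity_on_append:
  assumes "\<And>j. j < d \<Longrightarrow> C_infinity_on k U (\<lambda>x. f x j)" "j - d < e \<Longrightarrow> C_infinity_on k U (\<lambda>x. g x (j - d))" "j < d + e"
  shows "C_infinity_on k U (\<lambda>x. append_coords d (f x) (g x) j)"
  using assms by (cases "j < d") (auto simp: append_coords_def)

abbreviation prod_chart :: "nat \<Rightarrow> ('a \<Rightarrow> nat \<Rightarrow> real) \<Rightarrow> ('b \<Rightarrow> nat \<Rightarrow> real) \<Rightarrow> 'a \<times> 'b \<Rightarrow> nat \<Rightarrow> real" where
  "prod_chart d \<phi> \<psi> \<equiv> \<lambda>(x, y). append_coords d (\<phi> x) (\<psi> y)"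

lemma smooth_rep_Pair:
  assumes "smooth_rep d D \<phi> e E \<psi> f x" "smooth_rep d D \<phi> k F \<theta> h x"
  shows "smooth_rep d D \<phi> (e + k) (E \<times> F) (prod_chart e \<psi> \<theta>) (\<lambda>x. (f x, h x)) x"
proof -
  obtain U g where U: "eopen d U" "\<phi> x \<in> U" "\<And>y. y \<in> D \<Longrightarrow> \<phi> y \<in> U \<Longrightarrow> f y \<in> E \<and> \<psi> (f y) = g (\<phi> y)"
    "\<And>u. u \<in> U \<Longrightarrow> g u \<in> esp e" "\<And>j. j < e \<Longrightarrow> C_infinity_on d U (\<lambda>u. g u j)"
    using assms(1) unfolding smooth_rep_def by blast
  obtain V g' where V: "eopen d V" "\<phi> x \<in> V" "\<And>y. y \<in> D \<Longrightarrow> \<phi> y \<in> V \<Longrightarrow> h y \<in> F \<and> \<theta> (h y) = g' (\<phi> y)"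
    "\<And>u. u \<in> V \<Longrightarrow> g' u \<in> esp k" "\<And>j. j < k \<Longrightarrow> C_infinity_on d V (\<lambda>u. g' u j)"
    using assms(2) unfolding smooth_rep_def by blast
  show ?thesis
  proof (rule smooth_repI[where U = "U \<inter> V" and g = "\<lambda>u. append_coords e (g u) (g' u)"])
    show "C_infinity_on d (U \<inter> V) (\<lambda>u. append_coords e (g u) (g' u) j)" if "j < e + k" for j
    proof (rule C_infinity_on_append[OF _ _ that])
      show "C_infinity_on d (U \<inter> V) (\<lambda>u. g u j)" if "j < e" for j
        using U(5)[OF that] by (rule C_infinity_on_subset) simp
      show "C_infinity_on d (U \<inter> V) (\<lambda>u. g' u (j - e))" if "j - e < k"
        using V(5)[OF that] by (rule C_infinity_on_subset) simp
    qed
  qed (use U V in \<open>auto intro!: append_esp\<close>)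
qed

lemma smooth_rep_fst:
  assumes "p \<in> D \<times> E" "\<And>x. x \<in> D \<Longrightarrow> \<phi> x \<in> esp d" "\<And>x. x \<in> E \<Longrightarrow> \<psi> x \<in> esp e"
  shows "smooth_rep (d + e) (D \<times> E) (prod_chart d \<phi> \<psi>) d D \<phi> fst p"
  by (rule smooth_repI[where U = "esp (d + e)" and g = "take_coords d"])
    (use assms in \<open>auto simp: take_append append_esp C_infinity_on_take\<close>)

lemma smooth_rep_snd:
  assumes "p \<in> D \<times> E" "\<And>x. x \<in> D \<Longrightarrow> \<phi> x \<in> esp d" "\<And>x. x \<in> E \<Longrightarrow> \<psi> x \<in> esp e"
  shows "smooth_rep (d + e) (D \<times> E) (prod_chart d \<phi> \<psi>) e E \<psi> snd p"
  by (rule smooth_repI[where U = "esp (d + e)" and g = "drop_coords d"])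
    (use assms in \<open>auto simp: drop_append append_esp C_infinity_on_drop\<close>)

lemma prod_manifold_simps [simp]:
  "points (prod_manifold M N) = points M \<times> points N"
  "mdim (prod_manifold M N) = mdim M + mdim N"
  by (simp_all add: prod_manifold_def)

lemma atlas_prod_manifold:
  "c \<in> atlas (prod_manifold M N) \<longleftrightarrow>
    (\<exists>D \<phi> E \<psi>. (D, \<phi>) \<in> atlas M \<and> (E, \<psi>) \<in> atlas N \<and> c = (D \<times> E, prod_chart (mdim M) \<phi> \<psi>))"
  unfolding prod_manifold_def by auto

lemma in_atlas_prod:
  "(D, \<phi>) \<in> atlas M \<Longrightarrow> (E, \<psi>) \<in> atlas N \<Longrightarrow> (D \<times> E, prod_chart (mdim M) \<phi> \<psi>) \<in> atlas (prod_manifold M N)"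
  unfolding atlas_prod_manifold by blast

lemma smooth_atlas_prod:
  assumes M: "smooth_atlas M" and N: "smooth_atlas N"
  shows "smooth_atlas (prod_manifold M N)"
proof (rule smooth_atlasI)
  show "(\<Union>(D, \<phi>)\<in>atlas (prod_manifold M N). D) = points (prod_manifold M N)"
  proof safe
    fix x y E \<psi> assume "(E, \<psi>) \<in> atlas (prod_manifold M N)" "(x, y) \<in> E"
    then show "(x, y) \<in> points (prod_manifold M N)"
      using chart_subset[OF M, THEN subsetD] chart_subset[OF N, THEN subsetD]
      unfolding atlas_prod_manifold by auto
  next
    fix x y assume "(x, y) \<in> points (prod_manifold M N)"
    then have "x \<in> points M" "y \<in> points N" by auto
    obtain D \<phi> where D: "(D, \<phi>) \<in> atlas M" "x \<in> D" using chart_exists[OF M \<open>x \<in> points M\<close>] .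
    obtain E \<psi> where E: "(E, \<psi>) \<in> atlas N" "y \<in> E" using chart_exists[OF N \<open>y \<in> points N\<close>] .
    have "(D \<times> E, prod_chart (mdim M) \<phi> \<psi>) \<in> atlas (prod_manifold M N)"
      using D E unfolding atlas_prod_manifold by blast
    then show "(x, y) \<in> (\<Union>(D, \<phi>)\<in>atlas (prod_manifold M N). D)" using D E by blast
  qed
next
  fix C \<theta> assume "(C, \<theta>) \<in> atlas (prod_manifold M N)"
  then obtain D \<phi> E \<psi> where D: "(D, \<phi>) \<in> atlas M" and E: "(E, \<psi>) \<in> atlas N"
    and C: "C = D \<times> E" "\<theta> = prod_chart (mdim M) \<phi> \<psi>" unfolding atlas_prod_manifold by blast
  show "inj_on \<theta> C"
  proof (rule inj_onI; clarify?)
    fix x y x' y' assume "(x, y) \<in> C" "(x', y') \<in> C" and eq: "\<theta> (x, y) = \<theta> (x', y')"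
    then have xy: "x \<in> D" "y \<in> E" "x' \<in> D" "y' \<in> E" by (auto simp: C)
    have "\<phi> x = \<phi> x'" using arg_cong[OF eq, of "take_coords (mdim M)"] xy chart_esp[OF M D] by (simp add: C take_append)
    moreover have "\<psi> y = \<psi> y'" using arg_cong[OF eq, of "drop_coords (mdim M)"] by (simp add: C drop_append)
    ultimately show "x = x' \<and> y = y'" using xy chart_inj[OF M D] chart_inj[OF N E] by (auto simp: inj_on_def)
  qed
  have "\<theta> ` C = {u \<in> {u \<in> esp (mdim M + mdim N). take_coords (mdim M) u \<in> \<phi> ` D}. drop_coords (mdim M) u \<in> \<psi> ` E}"
  proof safe
    fix x y assume "(x, y) \<in> C"
    then have xy: "x \<in> D" "y \<in> E" by (auto simp: C)
    then have e: "\<phi> x \<in> esp (mdim M)" "\<psi> y \<in> esp (mdim N)" using chart_esp[OF M D] chart_esp[OF N E] by auto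
    show "\<theta> (x, y) \<in> esp (mdim M + mdim N)" "take_coords (mdim M) (\<theta> (x, y)) \<in> \<phi> ` D" "drop_coords (mdim M) (\<theta> (x, y)) \<in> \<psi> ` E"
      using xy e by (auto simp: C append_esp take_append drop_append)
  next
    fix u x y assume u: "take_coords (mdim M) u = \<phi> x" "drop_coords (mdim M) u = \<psi> y" and xy: "x \<in> D" "y \<in> E"
    have "u = \<theta> (x, y)" using append_take_drop[of "mdim M" u] unfolding u by (simp add: C)
    then show "u \<in> \<theta> ` C" using xy by (auto simp: C)
  qed
  also have "eopen (mdim M + mdim N) \<dots>"
  proof (rule eopen_preimage_smooth[OF eopen_preimage_smooth[OF openin_topspace]])
    show "eopen (mdim M) (\<phi> ` D)" "eopen (mdim N) (\<psi> ` E)" using chart_eopen M N D E by blast+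
  qed (use take_esp in \<open>auto simp: C_infinity_on_take C_infinity_on_drop esp_iff drop_coords_def\<close>)
  finally show "eopen (mdim (prod_manifold M N)) (\<theta> ` C)" by simp
next
  fix C \<theta> C' \<theta>' p assume "(C, \<theta>) \<in> atlas (prod_manifold M N)" "(C', \<theta>') \<in> atlas (prod_manifold M N)" and p: "p \<in> C" "p \<in> C'"
  then obtain D \<phi> E \<psi> D' \<phi>' E' \<psi>' where D: "(D, \<phi>) \<in> atlas M" and E: "(E, \<psi>) \<in> atlas N"
    and C: "C = D \<times> E" "\<theta> = prod_chart (mdim M) \<phi> \<psi>" and D': "(D', \<phi>') \<in> atlas M" and E': "(E', \<psi>') \<in> atlas N"
    and C': "C' = D' \<times> E'" "\<theta>' = prod_chart (mdim M) \<phi>' \<psi>'"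
    unfolding atlas_prod_manifold by blast
  have m: "fst p \<in> D" "snd p \<in> E" "fst p \<in> D'" "snd p \<in> E'" using p by (auto simp: C C')
  have "smooth_rep (mdim M + mdim N) C \<theta> (mdim M + mdim N) C' \<theta>' (\<lambda>p. (fst p, snd p)) p"
    unfolding C C'
  proof (rule smooth_rep_Pair)
    show "smooth_rep (mdim M + mdim N) (D \<times> E) (prod_chart (mdim M) \<phi> \<psi>) (mdim M) D' \<phi>' fst p"
      by (rule smooth_rep_compose[where h = "\<lambda>x. x", OF smooth_rep_fst smooth_rep_transition[OF M D D' m(1,3)]])
        (use p C chart_esp[OF M D] chart_esp[OF N E] in auto)
    show "smooth_rep (mdim M + mdim N) (D \<times> E) (prod_chart (mdim M) \<phi> \<psi>) (mdim N) E' \<psi>' snd p"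
      by (rule smooth_rep_compose[where h = "\<lambda>x. x", OF smooth_rep_snd smooth_rep_transition[OF N E E' m(2,4)]])
        (use p C chart_esp[OF M D] chart_esp[OF N E] in auto)
  qed
  then show "smooth_rep (mdim (prod_manifold M N)) C \<theta> (mdim (prod_manifold M N)) C' \<theta>' (\<lambda>x. x) p" by simp
qed

lemma smooth_map_fst:
  assumes M: "smooth_atlas M" and N: "smooth_atlas N"
  shows "smooth_map (prod_manifold M N) M fst"
proof (rule smooth_mapI[OF smooth_atlas_prod[OF M N] M])
  fix p assume "p \<in> points (prod_manifold M N)"
  then have "fst p \<in> points M" "snd p \<in> points N" by auto
  obtain D \<phi> where D: "(D, \<phi>) \<in> atlas M" "fst p \<in> D" using chart_exists[OF M \<open>fst p \<in> points M\<close>] .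
  obtain E \<psi> where E: "(E, \<psi>) \<in> atlas N" "snd p \<in> E" using chart_exists[OF N \<open>snd p \<in> points N\<close>] .
  have "smooth_rep (mdim M + mdim N) (D \<times> E) (prod_chart (mdim M) \<phi> \<psi>) (mdim M) D \<phi> fst p"
    by (rule smooth_rep_fst) (use D E chart_esp[OF M D(1)] chart_esp[OF N E(1)] in \<open>auto simp: mem_Times_iff\<close>)
  then show "\<exists>C \<theta> D \<phi>. (C, \<theta>) \<in> atlas (prod_manifold M N) \<and> (D, \<phi>) \<in> atlas M \<and> p \<in> C \<and>
      smooth_rep (mdim (prod_manifold M N)) C \<theta> (mdim M) D \<phi> fst p"
    using in_atlas_prod[OF D(1) E(1)] D E mem_Times_iff[of p D E] unfolding prod_manifold_simps by blast
qed

lemma smooth_map_snd: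
  assumes M: "smooth_atlas M" and N: "smooth_atlas N"
  shows "smooth_map (prod_manifold M N) N snd"
proof (rule smooth_mapI[OF smooth_atlas_prod[OF M N] N])
  fix p assume "p \<in> points (prod_manifold M N)"
  then have "fst p \<in> points M" "snd p \<in> points N" by auto
  obtain D \<phi> where D: "(D, \<phi>) \<in> atlas M" "fst p \<in> D" using chart_exists[OF M \<open>fst p \<in> points M\<close>] .
  obtain E \<psi> where E: "(E, \<psi>) \<in> atlas N" "snd p \<in> E" using chart_exists[OF N \<open>snd p \<in> points N\<close>] .
  have "smooth_rep (mdim M + mdim N) (D \<times> E) (prod_chart (mdim M) \<phi> \<psi>) (mdim N) E \<psi> snd p"
    by (rule smooth_rep_snd) (use D E chart_esp[OF M D(1)] chart_esp[OF N E(1)] in \<open>auto simp: mem_Times_iff\<close>)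
  then show "\<exists>C \<theta> E \<psi>. (C, \<theta>) \<in> atlas (prod_manifold M N) \<and> (E, \<psi>) \<in> atlas N \<and> p \<in> C \<and>
      smooth_rep (mdim (prod_manifold M N)) C \<theta> (mdim N) E \<psi> snd p"
    using in_atlas_prod[OF D(1) E(1)] D E mem_Times_iff[of p D E] unfolding prod_manifold_simps by blast
qed

lemma smooth_map_Pair:
  assumes M: "smooth_atlas M" and N: "smooth_atlas N" and P: "smooth_atlas P"
    and f: "smooth_map P M f" and g: "smooth_map P N g"
  shows "smooth_map P (prod_manifold M N) (\<lambda>x. (f x, g x))"
proof (rule smooth_mapI[OF P smooth_atlas_prod[OF M N]])
  fix x assume x: "x \<in> points P"
  obtain C \<theta> where C: "(C, \<theta>) \<in> atlas P" "x \<in> C" using chart_exists[OF P x] .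
  obtain D \<phi> where D: "(D, \<phi>) \<in> atlas M" "f x \<in> D" using chart_exists[OF M smooth_map_points[OF P M f x]] .
  obtain E \<psi> where E: "(E, \<psi>) \<in> atlas N" "g x \<in> E" using chart_exists[OF N smooth_map_points[OF P N g x]] .
  have "smooth_rep (mdim P) C \<theta> (mdim M + mdim N) (D \<times> E) (prod_chart (mdim M) \<phi> \<psi>) (\<lambda>x. (f x, g x)) x"
    by (intro smooth_rep_Pair smooth_mapD[OF P M f C(1) D(1) C(2) D(2)] smooth_mapD[OF P N g C(1) E(1) C(2) E(2)])
  then show "\<exists>C \<theta> D \<phi>. (C, \<theta>) \<in> atlas P \<and> (D, \<phi>) \<in> atlas (prod_manifold M N) \<and> x \<in> C \<and>
      smooth_rep (mdim P) C \<theta> (mdim (prod_manifold M N)) D \<phi> (\<lambda>x. (f x, g x)) x"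
    using in_atlas_prod[OF D(1) E(1)] C unfolding prod_manifold_simps by blast
qed

text \<open>First device for Hausdorff proofs: disjoint neighbourhoods are pulled back. Points that
  the map identifies call for the second device, \<open>separated_in_chart\<close>.\<close>

lemma separated_by_map:
  assumes X: "Hausdorff_space X" "continuous_map Y X f" "f x \<noteq> f y" and xy: "x \<in> topspace Y" "y \<in> topspace Y"
  shows "\<exists>U V. openin Y U \<and> openin Y V \<and> x \<in> U \<and> y \<in> V \<and> disjnt U V"
proof -
  have "f x \<in> topspace X" "f y \<in> topspace X" using xy X(2) continuous_map_image_subset_topspace by blast+
  then obtain U V where UV: "openin X U" "openin X V" "f x \<in> U" "f y \<in> V" "disjnt U V"
    using X unfolding Hausdorff_space_def by metis
  have "openin Y {x \<in> topspace Y. f x \<in> U}" "openin Y {x \<in> topspace Y. f x \<in> V}"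
    using X(2) UV unfolding continuous_map by blast+
  moreover have "disjnt {x \<in> topspace Y. f x \<in> U} {x \<in> topspace Y. f x \<in> V}"
    using UV by (auto simp: disjnt_iff)
  ultimately show ?thesis using xy UV by blast
qed

text \<open>The points differ in some coordinate \<open>i\<close>; strips around the two values,
  with half their distance as radius, are disjoint.\<close>

lemma separated_in_chart:
  assumes M: "smooth_atlas M" and D: "(D, \<phi>) \<in> atlas M" "x \<in> D" "y \<in> D" and "x \<noteq> y"
  shows "\<exists>U V. openin (mtop M) U \<and> openin (mtop M) V \<and> x \<in> U \<and> y \<in> V \<and> disjnt U V"
proof -
  have ne: "\<phi> x \<noteq> \<phi> y" using assms(5) D chart_inj[OF M D(1)] by (auto simp: inj_on_def)
  have e: "\<phi> x \<in> esp (mdim M)" "\<phi> y \<in> esp (mdim M)" using chart_esp[OF M D(1)] D by auto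
  obtain i where i: "i < mdim M" "\<phi> x i \<noteq> \<phi> y i" using esp_eqI[OF e] ne by blast
  define S where "S z = {v \<in> esp (mdim M). v i \<in> ball (z i) (\<bar>\<phi> x i - \<phi> y i\<bar> / 2)}" for z :: "nat \<Rightarrow> real"
  have S: "eopen (mdim M) (S z)" for z
    unfolding S_def by (rule eopen_continuous_preimage[OF openin_topspace C_infinity_on_continuous]) auto
  have "dist (\<phi> x i) (\<phi> y i) < \<bar>\<phi> x i - \<phi> y i\<bar>" if "v \<in> S (\<phi> x)" "v \<in> S (\<phi> y)" for v
    using that dist_triangle_half_l[of "\<phi> x i" "v i" "\<bar>\<phi> x i - \<phi> y i\<bar>" "\<phi> y i"] unfolding S_def by auto
  then have "disjnt {z \<in> D. \<phi> z \<in> S (\<phi> x)} {z \<in> D. \<phi> z \<in> S (\<phi> y)}"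
    unfolding disjnt_iff dist_real_def by blast
  moreover have "x \<in> {z \<in> D. \<phi> z \<in> S (\<phi> x)}" "y \<in> {z \<in> D. \<phi> z \<in> S (\<phi> y)}"
    using D e i unfolding S_def by auto
  ultimately show ?thesis using openin_chart_preimage[OF M D(1) S] by meson
qed

lemma smooth_manifold_prod:
  assumes "smooth_manifold M" "smooth_manifold N"
  shows "smooth_manifold (prod_manifold M N)"
proof -
  have M: "smooth_atlas M" and N: "smooth_atlas N" and H: "Hausdorff_space (mtop M)" "Hausdorff_space (mtop N)"
    using assms by (auto simp: smooth_manifold_iff)
  note P = smooth_atlas_prod[OF M N]
  have "Hausdorff_space (mtop (prod_manifold M N))"
    unfolding Hausdorff_space_def
  proof (intro allI impI)
    fix p q assume pq: "p \<in> topspace (mtop (prod_manifold M N)) \<and> q \<in> topspace (mtop (prod_manifold M N)) \<and> p \<noteq> q"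
    then consider "fst p \<noteq> fst q" | "snd p \<noteq> snd q" by (metis prod.collapse)
    then show "\<exists>U V. openin (mtop (prod_manifold M N)) U \<and> openin (mtop (prod_manifold M N)) V \<and> p \<in> U \<and> q \<in> V \<and> disjnt U V"
    proof cases
      case 1
      with pq show ?thesis
        by (intro separated_by_map[OF H(1)]) (use smooth_map_fst[OF M N] in \<open>auto simp: smooth_map_def\<close>)
    next
      case 2
      with pq show ?thesis
        by (intro separated_by_map[OF H(2)]) (use smooth_map_snd[OF M N] in \<open>auto simp: smooth_map_def\<close>)
    qed
  qed
  then show ?thesis using P by (simp add: smooth_manifold_iff)
qed

section \<open>Jets of curves\<close>

definition curve_in :: "nat \<Rightarrow> 'a set \<Rightarrow> ('a \<Rightarrow> nat \<Rightarrow> real) \<Rightarrow> (real \<Rightarrow> 'a) \<Rightarrow> bool" where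
  "curve_in d D \<phi> p \<longleftrightarrow> (\<forall>\<^sub>F t in nhds 0. p t \<in> D) \<and> (\<forall>j<d. sgerm (\<lambda>t. \<phi> (p t) j))"

abbreviation cderiv :: "nat \<Rightarrow> ('a \<Rightarrow> nat \<Rightarrow> real) \<Rightarrow> (real \<Rightarrow> 'a) \<Rightarrow> nat \<Rightarrow> real" where
  "cderiv k \<phi> p j \<equiv> (deriv ^^ k) (\<lambda>t. \<phi> (p t) j) 0"

lemma curve_iff: "curve M p \<longleftrightarrow> (\<exists>(D, \<phi>)\<in>atlas M. curve_in (mdim M) D \<phi> p)"
proof -
  have "(\<exists>\<epsilon>>0. \<forall>t. \<bar>t\<bar> < \<epsilon> \<longrightarrow> p t \<in> D \<and> (\<forall>j<mdim M. \<forall>k. (deriv ^^ k) (\<lambda>s. \<phi> (p s) j) field_differentiable at t))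
    \<longleftrightarrow> curve_in (mdim M) D \<phi> p" for D and \<phi> :: "'a \<Rightarrow> nat \<Rightarrow> real"
  proof -
    have "(\<forall>j<mdim M. sgerm (\<lambda>t. \<phi> (p t) j)) \<longleftrightarrow>
      (\<forall>\<^sub>F t in nhds 0. \<forall>j\<in>{..<mdim M}. \<forall>k. (deriv ^^ k) (\<lambda>s. \<phi> (p s) j) field_differentiable at t)"
      unfolding sgerm_def by (subst eventually_ball_finite_distrib) auto
    then show ?thesis
      unfolding curve_in_def eventually_nhds_0_real[symmetric] eventually_conj_iff
      by (simp add: Ball_def)
  qed
  then show ?thesis unfolding curve_def by simp
qed

lemma curve_in_0: "curve_in d D \<phi> p \<Longrightarrow> p 0 \<in> D"
  unfolding curve_in_def using eventually_nhds_x_imp_x by blast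

lemma curve_in_eventually:
  assumes "curve_in d D \<phi> p" "\<And>y. y \<in> D \<Longrightarrow> \<phi> y \<in> esp d" "eopen d U" "\<phi> (p 0) \<in> U"
  shows "\<forall>\<^sub>F t in nhds 0. \<phi> (p t) \<in> U"
proof (rule eventually_in_eopen[OF assms(3,4)])
  show "((\<lambda>t. \<phi> (p t) i) \<longlongrightarrow> \<phi> (p 0) i) (nhds 0)" if "i < d" for i
    using assms(1) that sgerm_tendsto unfolding curve_in_def by blast
  show "\<forall>\<^sub>F t in nhds 0. \<phi> (p t) \<in> esp d"
    using assms(1) unfolding curve_in_def by (elim conjE eventually_mono) (rule assms(2))
qed

lemma smooth_rep_curve:
  assumes r: "smooth_rep d D \<phi> e E \<psi> f (p 0)" and p: "curve_in d D \<phi> p" and D: "\<And>y. y \<in> D \<Longrightarrow> \<phi> y \<in> esp d"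
  shows "curve_in e E \<psi> (\<lambda>t. f (p t))"
proof -
  obtain U g where U: "eopen d U" "\<phi> (p 0) \<in> U" "\<And>y. y \<in> D \<Longrightarrow> \<phi> y \<in> U \<Longrightarrow> f y \<in> E \<and> \<psi> (f y) = g (\<phi> y)"
    "\<And>u. u \<in> U \<Longrightarrow> g u \<in> esp e" "\<And>j. j < e \<Longrightarrow> C_infinity_on d U (\<lambda>u. g u j)"
    using r unfolding smooth_rep_def by blast
  have ev: "\<forall>\<^sub>F t in nhds 0. \<phi> (p t) \<in> U" by (rule curve_in_eventually[OF p D U(1,2)])
  have evD: "\<forall>\<^sub>F t in nhds 0. p t \<in> D" using p unfolding curve_in_def by blast
  show ?thesis unfolding curve_in_def
  proof (intro conjI allI impI)
    show "\<forall>\<^sub>F t in nhds 0. f (p t) \<in> E" using ev evD by eventually_elim (use U in blast)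
    fix j assume j: "j < e"
    have "\<forall>\<^sub>F t in nhds 0. g (\<phi> (p t)) j = \<psi> (f (p t)) j" using ev evD by eventually_elim (use U in simp)
    moreover have "sgerm (\<lambda>t. g (\<phi> (p t)) j)"
      by (rule sgerm_compose[OF U(1) U(5)[OF j] _ ev]) (use p in \<open>auto simp: curve_in_def\<close>)
    ultimately show "sgerm (\<lambda>t. \<psi> (f (p t)) j)" by (rule sgerm_ev_cong)
  qed
qed

lemma cderiv_compose:
  assumes U: "eopen d U" "\<And>y. y \<in> D \<Longrightarrow> \<phi> y \<in> U \<Longrightarrow> \<psi> (f y) j = g (\<phi> y)" "C_infinity_on d U g"
    and p: "curve_in d D \<phi> p" "\<phi> (p 0) \<in> U" and D: "\<And>y. y \<in> D \<Longrightarrow> \<phi> y \<in> esp d"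
  shows "cderiv k \<psi> (\<lambda>t. f (p t)) j = jet_comp d k g (\<lambda>l i. cderiv l \<phi> p i)"
proof -
  have ev: "\<forall>\<^sub>F t in nhds 0. \<phi> (p t) \<in> U" by (rule curve_in_eventually[OF p(1) D U(1) p(2)])
  have evD: "\<forall>\<^sub>F t in nhds 0. p t \<in> D" using p unfolding curve_in_def by blast
  have "\<forall>\<^sub>F t in nhds 0. \<psi> (f (p t)) j = g (\<phi> (p t))" using ev evD by eventually_elim (use U in simp)
  then have "cderiv k \<psi> (\<lambda>t. f (p t)) j = (deriv ^^ k) (\<lambda>t. g (\<phi> (p t))) 0" by (rule higher_deriv_ev_cong)
  also have "\<dots> = jet_comp d k g (\<lambda>l i. cderiv l \<phi> p i)"
    by (rule higher_deriv_compose[OF U(1,3) _ ev]) (use p in \<open>auto simp: curve_in_def\<close>)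
  finally show ?thesis .
qed

text \<open>Equality at \<open>0\<close> is listed separately because equal coordinates identify
  points only inside the domain of the chart.\<close>

definition same_jet :: "nat \<Rightarrow> nat \<Rightarrow> ('a \<Rightarrow> nat \<Rightarrow> real) \<Rightarrow> (real \<Rightarrow> 'a) \<Rightarrow> (real \<Rightarrow> 'a) \<Rightarrow> bool" where
  "same_jet n d \<phi> p q \<longleftrightarrow> p 0 = q 0 \<and> (\<forall>k\<le>n. \<forall>j<d. cderiv k \<phi> p j = cderiv k \<phi> q j)"

text \<open>By \<open>cderiv_compose\<close> the derivatives of an image curve are
  \<open>jet_comp\<close> of those of the curve. For general \<open>f\<close> this lets smooth maps
  act on jets; for the identity it makes jets independent of the chart.\<close>

lemma smooth_rep_same_jet:
  assumes r: "smooth_rep d D \<phi> e E \<psi> f (p 0)" and p: "curve_in d D \<phi> p" and q: "curve_in d D \<phi> q"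
    and D: "\<And>y. y \<in> D \<Longrightarrow> \<phi> y \<in> esp d" and eq: "same_jet n d \<phi> p q"
  shows "same_jet n e \<psi> (\<lambda>t. f (p t)) (\<lambda>t. f (q t))"
proof -
  obtain U g where U: "eopen d U" "\<phi> (p 0) \<in> U" "\<And>y. y \<in> D \<Longrightarrow> \<phi> y \<in> U \<Longrightarrow> f y \<in> E \<and> \<psi> (f y) = g (\<phi> y)"
    "\<And>u. u \<in> U \<Longrightarrow> g u \<in> esp e" "\<And>j. j < e \<Longrightarrow> C_infinity_on d U (\<lambda>u. g u j)"
    using r unfolding smooth_rep_def by blast
  have q0: "\<phi> (q 0) \<in> U" using U eq by (simp add: same_jet_def)
  have "cderiv k \<psi> (\<lambda>t. f (p t)) j = cderiv k \<psi> (\<lambda>t. f (q t)) j" if "k \<le> n" "j < e" for k j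
  proof -
    have "cderiv k \<psi> (\<lambda>t. f (p t)) j = jet_comp d k (\<lambda>u. g u j) (\<lambda>l i. cderiv l \<phi> p i)"
      by (rule cderiv_compose[OF U(1) _ U(5)[OF that(2)] p U(2) D]) (use U in auto)
    also have "\<dots> = jet_comp d k (\<lambda>u. g u j) (\<lambda>l i. cderiv l \<phi> q i)"
      by (rule jet_comp_cong) (use eq that in \<open>auto simp: same_jet_def\<close>)
    also have "\<dots> = cderiv k \<psi> (\<lambda>t. f (q t)) j"
      by (rule cderiv_compose[OF U(1) _ U(5)[OF that(2)] q q0 D, symmetric]) (use U in auto)
    finally show ?thesis .
  qed
  then show ?thesis using eq by (simp add: same_jet_def)
qed

lemma curve_in_chart:
  assumes M: "smooth_atlas M" and p: "curve M p" and E: "(E, \<psi>) \<in> atlas M" "p 0 \<in> E"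
  shows "curve_in (mdim M) E \<psi> p"
proof -
  obtain D \<phi> where D: "(D, \<phi>) \<in> atlas M" "curve_in (mdim M) D \<phi> p" using p unfolding curve_iff by blast
  show ?thesis
    using smooth_rep_curve[where f = "\<lambda>x. x", OF smooth_rep_transition[OF M D(1) E(1) curve_in_0[OF D(2)] E(2)] D(2)]
      chart_esp[OF M D(1)] by blast
qed

lemma curve_inI: "(D, \<phi>) \<in> atlas M \<Longrightarrow> curve_in (mdim M) D \<phi> p \<Longrightarrow> curve M p"
  unfolding curve_iff by blast

lemma curve_point: "smooth_atlas M \<Longrightarrow> curve M p \<Longrightarrow> p 0 \<in> points M"
  unfolding curve_iff using curve_in_0 chart_subset by fast

text \<open>\<open>jet\<close> compares derivatives in all charts around \<open>p 0\<close>; by the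
  chain rule for transition maps a single chart decides.\<close>

lemma jet_iff:
  assumes M: "smooth_atlas M" and p: "curve M p" and D: "(D, \<phi>) \<in> atlas M" "p 0 \<in> D"
  shows "q \<in> jet n M p \<longleftrightarrow> curve M q \<and> same_jet n (mdim M) \<phi> q p"
proof
  assume "q \<in> jet n M p"
  then have "curve M q" "q 0 = p 0" and *: "\<forall>(D, \<phi>)\<in>atlas M. p 0 \<in> D \<longrightarrow>
        (\<forall>k\<le>n. \<forall>j<mdim M. cderiv k \<phi> q j = cderiv k \<phi> p j)"
    unfolding jet_def by auto
  with bspec[OF * D(1)] D(2) show "curve M q \<and> same_jet n (mdim M) \<phi> q p" by (simp add: same_jet_def)
next
  assume q: "curve M q \<and> same_jet n (mdim M) \<phi> q p"
  then have q0: "q 0 = p 0" by (simp add: same_jet_def)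
  have "same_jet n (mdim M) \<psi> q p" if E: "(E, \<psi>) \<in> atlas M" "p 0 \<in> E" for E \<psi>
  proof (rule smooth_rep_same_jet[where f = "\<lambda>x. x" and p = q and q = p and D = D and \<phi> = \<phi> and d = "mdim M"])
    show "smooth_rep (mdim M) D \<phi> (mdim M) E \<psi> (\<lambda>x. x) (q 0)"
      by (rule smooth_rep_transition[OF M D(1) E(1)]) (use q0 D E in auto)
    show "curve_in (mdim M) D \<phi> q" by (rule curve_in_chart[OF M _ D(1)]) (use q q0 D in auto)
  qed (use q curve_in_chart[OF M p D] chart_esp[OF M D(1)] in auto)
  then show "q \<in> jet n M p" using q q0 unfolding jet_def same_jet_def by auto
qed

lemma same_jet_refl: "same_jet n d \<phi> p p" by (simp add: same_jet_def)
lemma same_jet_sym: "same_jet n d \<phi> p q \<Longrightarrow> same_jet n d \<phi> q p" by (simp add: same_jet_def)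
lemma same_jet_trans: "same_jet n d \<phi> p q \<Longrightarrow> same_jet n d \<phi> q r \<Longrightarrow> same_jet n d \<phi> p r" by (simp add: same_jet_def)

lemma jet_self: 
  assumes M: "smooth_atlas M" and p: "curve M p" shows "p \<in> jet n M p"
proof -
  obtain D \<phi> where "(D, \<phi>) \<in> atlas M" "p 0 \<in> D" using chart_exists[OF M curve_point[OF M p]] .
  then show ?thesis using jet_iff[OF M p] p same_jet_refl by blast
qed

lemma jet_eq_iff:
  assumes M: "smooth_atlas M" and p: "curve M p" and q: "curve M q" and D: "(D, \<phi>) \<in> atlas M" "p 0 \<in> D"
  shows "jet n M p = jet n M q \<longleftrightarrow> same_jet n (mdim M) \<phi> p q"
proof
  assume "jet n M p = jet n M q"
  then have "q \<in> jet n M p" using jet_self[OF M q] by simp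
  then show "same_jet n (mdim M) \<phi> p q" using jet_iff[OF M p D] same_jet_sym by blast
next
  assume e: "same_jet n (mdim M) \<phi> p q"
  then have "q 0 \<in> D" using D by (simp add: same_jet_def)
  then have "r \<in> jet n M p \<longleftrightarrow> r \<in> jet n M q" for r
    using jet_iff[OF M p D, of r n] jet_iff[OF M q D(1), of r n] e same_jet_trans same_jet_sym by blast
  then show "jet n M p = jet n M q" by blast
qed

lemma
  assumes M: "smooth_atlas M" and p: "curve M p" and q: "q \<in> jet n M p"
  shows jet_member_curve: "curve M q" and jet_member_eq: "jet n M q = jet n M p" and jet_member_0: "q 0 = p 0"
proof -
  obtain D \<phi> where D: "(D, \<phi>) \<in> atlas M" "p 0 \<in> D" using chart_exists[OF M curve_point[OF M p]] .
  have *: "curve M q" "same_jet n (mdim M) \<phi> q p" using jet_iff[OF M p D] q by blast+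
  then show "curve M q" "q 0 = p 0" by (simp_all add: same_jet_def)
  then show "jet n M q = jet n M p" using jet_eq_iff[OF M *(1) p D(1)] D(2) *(2) by simp
qed

text \<open>Away from \<open>0\<close> a curve may have arbitrary values, even outside the carrier,
  so group laws hold only for small \<open>t\<close>. This turns such local identities into
  equalities of jets.\<close>

lemma jet_germ_cong:
  assumes M: "smooth_atlas M" and p: "curve M p" and eq: "\<forall>\<^sub>F t in nhds 0. p t = q t"
  shows "jet n M p = jet n M q"
proof -
  obtain D \<phi> where D: "(D, \<phi>) \<in> atlas M" "p 0 \<in> D" using chart_exists[OF M curve_point[OF M p]] .
  have c: "curve_in (mdim M) D \<phi> p" by (rule curve_in_chart[OF M p D])
  have "\<forall>\<^sub>F t in nhds 0. \<phi> (p t) j = \<phi> (q t) j" for j using eq by eventually_elim simp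
  note ev = this
  have "curve_in (mdim M) D \<phi> q" unfolding curve_in_def
  proof (intro conjI allI impI)
    have "\<forall>\<^sub>F t in nhds 0. p t \<in> D" using c by (simp add: curve_in_def)
    with eq show "\<forall>\<^sub>F t in nhds 0. q t \<in> D" by eventually_elim simp
    show "sgerm (\<lambda>t. \<phi> (q t) j)" if "j < mdim M" for j
      by (rule sgerm_ev_cong[OF ev]) (use c that in \<open>simp add: curve_in_def\<close>)
  qed
  then have q: "curve M q" by (rule curve_inI[OF D(1)])
  have "same_jet n (mdim M) \<phi> p q"
    using eventually_nhds_x_imp_x[OF eq] higher_deriv_ev_cong[OF ev] by (simp add: same_jet_def)
  then show "jet n M p = jet n M q" using jet_eq_iff[OF M p q D] by simp
qed

lemma curve_const: "smooth_atlas M \<Longrightarrow> x \<in> points M \<Longrightarrow> curve M (\<lambda>_. x)"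
  by (elim chart_exists) (auto intro!: curve_inI simp: curve_in_def)

lemma curve_compose:
  assumes M: "smooth_atlas M" and N: "smooth_atlas N" and f: "smooth_map M N f" and p: "curve M p"
  shows "curve N (\<lambda>t. f (p t))"
proof -
  obtain D \<phi> where D: "(D, \<phi>) \<in> atlas M" "p 0 \<in> D" using chart_exists[OF M curve_point[OF M p]] .
  obtain E \<psi> where E: "(E, \<psi>) \<in> atlas N" "f (p 0) \<in> E"
    using chart_exists[OF N smooth_map_points[OF M N f curve_point[OF M p]]] .
  show ?thesis
    by (rule curve_inI[OF E(1) smooth_rep_curve[OF smooth_mapD[OF M N f D(1) E(1) D(2) E(2)] curve_in_chart[OF M p D]]])
      (rule chart_esp[OF M D(1)])
qed

lemma jet_compose:
  assumes M: "smooth_atlas M" and N: "smooth_atlas N" and f: "smooth_map M N f" and p: "curve M p"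
    and q: "q \<in> jet n M p"
  shows "jet n N (\<lambda>t. f (q t)) = jet n N (\<lambda>t. f (p t))"
proof -
  obtain D \<phi> where D: "(D, \<phi>) \<in> atlas M" "p 0 \<in> D" using chart_exists[OF M curve_point[OF M p]] .
  obtain E \<psi> where E: "(E, \<psi>) \<in> atlas N" "f (p 0) \<in> E"
    using chart_exists[OF N smooth_map_points[OF M N f curve_point[OF M p]]] .
  have q': "curve M q" "q 0 = p 0" using jet_member_curve[OF M p q] jet_member_0[OF M p q] .
  have "same_jet n (mdim M) \<phi> p q" using q jet_iff[OF M p D] same_jet_sym by blast
  then have "same_jet n (mdim N) \<psi> (\<lambda>t. f (p t)) (\<lambda>t. f (q t))"
    by (intro smooth_rep_same_jet[OF smooth_mapD[OF M N f D(1) E(1) D(2) E(2)] curve_in_chart[OF M p D]])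
      (use q' D curve_in_chart[OF M q'(1) D(1)] chart_esp[OF M D(1)] in auto)
  then have "jet n N (\<lambda>t. f (p t)) = jet n N (\<lambda>t. f (q t))"
    by (rule iffD2[OF jet_eq_iff[OF N curve_compose[OF M N f p] curve_compose[OF M N f q'(1)] E]])
  then show ?thesis by (rule sym)
qed

section \<open>The manifold of jets\<close>

definition jet_dom :: "nat \<Rightarrow> 'a manifold \<Rightarrow> 'a set \<Rightarrow> (real \<Rightarrow> 'a) set set" where
  "jet_dom n M D = {jet n M p | p. curve M p \<and> p 0 \<in> D}"

lemma jet_manifold_simps [simp]:
  "mdim (jet_manifold n M) = Suc n * mdim M"
  "points (jet_manifold n M) = {jet n M p | p. curve M p}"
  by (simp_all add: jet_manifold_def)

lemma atlas_jet_manifold: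
  "c \<in> atlas (jet_manifold n M) \<longleftrightarrow> (\<exists>D \<phi>. (D, \<phi>) \<in> atlas M \<and> c = (jet_dom n M D, jet_coords n M \<phi>))"
  by (auto simp: jet_manifold_def jet_dom_def)

lemma in_atlas_jet: "(D, \<phi>) \<in> atlas M \<Longrightarrow> (jet_dom n M D, jet_coords n M \<phi>) \<in> atlas (jet_manifold n M)"
  unfolding atlas_jet_manifold by blast

lemma jet_in_dom: "curve M p \<Longrightarrow> p 0 \<in> D \<Longrightarrow> jet n M p \<in> jet_dom n M D" by (auto simp: jet_dom_def)

lemma jet_index:
  fixes k n d j :: nat
  assumes "k \<le> n" "j < d"
  shows "k * d + j < Suc n * d" "(k * d + j) div d = k" "(k * d + j) mod d = j"
proof -
  have "k * d + j < k * d + d" using assms by simp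
  also have "\<dots> = Suc k * d" by simp
  also have "\<dots> \<le> Suc n * d" using assms by (intro mult_le_mono1) simp
  finally show "k * d + j < Suc n * d" .
qed (use assms in auto)

lemma jet_index':
  fixes i n d :: nat
  assumes "i < Suc n * d"
  shows "i div d \<le> n" "i mod d < d" "i div d * d + i mod d = i"
  using assms less_mult_imp_div_less[of i "Suc n" d] by (cases "d = 0"; auto simp: less_Suc_eq_le)+

text \<open>The representative picked by \<open>SOME\<close> lies in the jet of \<open>p\<close> and
  so has the same derivatives as \<open>p\<close>.\<close>

lemma jet_coords_jet:
  assumes M: "smooth_atlas M" and p: "curve M p" and D: "(D, \<phi>) \<in> atlas M" "p 0 \<in> D"
  shows "jet_coords n M \<phi> (jet n M p) = (\<lambda>i. if i < Suc n * mdim M then cderiv (i div mdim M) \<phi> p (i mod mdim M) else 0)"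
proof -
  have "(SOME q. q \<in> jet n M p) \<in> jet n M p" by (rule someI[of "\<lambda>q. q \<in> jet n M p", OF jet_self[OF M p]])
  then have "same_jet n (mdim M) \<phi> (SOME q. q \<in> jet n M p) p" using jet_iff[OF M p D] by blast
  then show ?thesis unfolding jet_coords_def using jet_index' by (auto simp: same_jet_def fun_eq_iff)
qed

lemma jet_coords_at:
  assumes "smooth_atlas M" "curve M p" "(D, \<phi>) \<in> atlas M" "p 0 \<in> D" "k \<le> n" "j < mdim M"
  shows "jet_coords n M \<phi> (jet n M p) (k * mdim M + j) = cderiv k \<phi> p j"
  using jet_coords_jet[OF assms(1-4), of n] jet_index[OF assms(5,6)] by simp

definition blk :: "nat \<Rightarrow> (nat \<Rightarrow> real) \<Rightarrow> nat \<Rightarrow> nat \<Rightarrow> real" where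
  "blk d u k = (\<lambda>j. if j < d then u (k * d + j) else 0)"

lemma blk_0: "blk d u 0 = take_coords d u" by (auto simp: blk_def take_coords_def)

lemma blk_jet_coords:
  assumes M: "smooth_atlas M" "curve M p" "(D, \<phi>) \<in> atlas M" "p 0 \<in> D" "k \<le> n" "j < mdim M"
  shows "blk (mdim M) (jet_coords n M \<phi> (jet n M p)) k j = cderiv k \<phi> p j"
  using jet_coords_at[OF assms] assms(6) by (simp add: blk_def)

lemma take_jet_coords:
  assumes M: "smooth_atlas M" "curve M p" "(D, \<phi>) \<in> atlas M" "p 0 \<in> D"
  shows "take_coords (mdim M) (jet_coords n M \<phi> (jet n M p)) = \<phi> (p 0)"
proof (rule esp_eqI[OF take_esp chart_esp[OF assms(1,3,4)]])
  show "take_coords (mdim M) (jet_coords n M \<phi> (jet n M p)) i = \<phi> (p 0) i" if "i < mdim M" for i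
    using blk_jet_coords[OF assms _ that, of 0 n] unfolding blk_0 by simp
qed

lemma jet_coords_esp: "jet_coords n M \<phi> A \<in> esp (Suc n * mdim M)"
  by (auto simp: jet_coords_def esp_iff)

text \<open>Away from \<open>0\<close> the polynomial may leave the image of the chart, where
  \<open>inv_into\<close> is arbitrary; only the germ at \<open>0\<close> matters.\<close>

definition jet_curve :: "nat \<Rightarrow> nat \<Rightarrow> 'a set \<Rightarrow> ('a \<Rightarrow> nat \<Rightarrow> real) \<Rightarrow> (nat \<Rightarrow> real) \<Rightarrow> real \<Rightarrow> 'a" where
  "jet_curve n d D \<phi> u t = inv_into D \<phi> (\<lambda>j. if j < d then taylor n (\<lambda>k. u (k * d + j)) t else 0)"

lemma taylor_0: "taylor n a 0 = a 0"
  using higher_deriv_taylor[of 0 n a] by simp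

lemma
  assumes M: "smooth_atlas M" and D: "(D, \<phi>) \<in> atlas M" and u: "take_coords (mdim M) u \<in> \<phi> ` D"
  shows jet_curve_in: "curve_in (mdim M) D \<phi> (jet_curve n (mdim M) D \<phi> u)"
    and jet_curve_chart: "\<forall>\<^sub>F t in nhds 0. \<phi> (jet_curve n (mdim M) D \<phi> u t) =
      (\<lambda>j. if j < mdim M then taylor n (\<lambda>k. u (k * mdim M + j)) t else 0)"
    and jet_curve_0: "\<phi> (jet_curve n (mdim M) D \<phi> u 0) = take_coords (mdim M) u"
proof -
  let ?c = "\<lambda>t j. if j < mdim M then taylor n (\<lambda>k. u (k * mdim M + j)) t else 0"
  have c0: "?c 0 = take_coords (mdim M) u" by (auto simp: take_coords_def taylor_0)
  have c: "sgerm (\<lambda>t. ?c t j)" for j by (cases "j < mdim M") (simp_all add: sgerm_taylor)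
  have ev: "\<forall>\<^sub>F t in nhds 0. ?c t \<in> \<phi> ` D"
    by (rule sgerm_eventually_in_eopen[where c = ?c, OF chart_eopen[OF M D] _ c]) (use u c0 in simp_all)
  then show eq: "\<forall>\<^sub>F t in nhds 0. \<phi> (jet_curve n (mdim M) D \<phi> u t) = ?c t"
    by eventually_elim (unfold jet_curve_def, rule f_inv_into_f)
  from eventually_nhds_x_imp_x[OF this] c0 show "\<phi> (jet_curve n (mdim M) D \<phi> u 0) = take_coords (mdim M) u" by simp
  show "curve_in (mdim M) D \<phi> (jet_curve n (mdim M) D \<phi> u)" unfolding curve_in_def
  proof (intro conjI allI impI)
    show "\<forall>\<^sub>F t in nhds 0. jet_curve n (mdim M) D \<phi> u t \<in> D"
      using ev by eventually_elim (unfold jet_curve_def, rule inv_into_into)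
    fix j
    have "\<forall>\<^sub>F t in nhds 0. ?c t j = \<phi> (jet_curve n (mdim M) D \<phi> u t) j" using eq by eventually_elim simp
    then show "sgerm (\<lambda>t. \<phi> (jet_curve n (mdim M) D \<phi> u t) j)" by (rule sgerm_ev_cong[OF _ c])
  qed
qed

lemma cderiv_jet_curve:
  assumes M: "smooth_atlas M" and D: "(D, \<phi>) \<in> atlas M" and u: "take_coords (mdim M) u \<in> \<phi> ` D" and "k \<le> n" "j < mdim M"
  shows "cderiv k \<phi> (jet_curve n (mdim M) D \<phi> u) j = u (k * mdim M + j)"
proof -
  have "\<forall>\<^sub>F t in nhds 0. \<phi> (jet_curve n (mdim M) D \<phi> u t) j = taylor n (\<lambda>k. u (k * mdim M + j)) t"
    using jet_curve_chart[OF M D u, of n] by eventually_elim (use assms(5) in simp)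
  from higher_deriv_ev_cong[OF this, of k] show ?thesis using assms(4) by (simp add: higher_deriv_taylor)
qed

lemma jet_coords_jet_curve:
  assumes M: "smooth_atlas M" and D: "(D, \<phi>) \<in> atlas M" and u: "take_coords (mdim M) u \<in> \<phi> ` D" "u \<in> esp (Suc n * mdim M)"
  shows "jet_coords n M \<phi> (jet n M (jet_curve n (mdim M) D \<phi> u)) = u"
proof (rule esp_eqI[OF jet_coords_esp u(2)])
  note c = jet_curve_in[OF M D u(1), of n]
  fix i assume i: "i < Suc n * mdim M"
  show "jet_coords n M \<phi> (jet n M (jet_curve n (mdim M) D \<phi> u)) i = u i"
    using jet_coords_at[OF M curve_inI[OF D c] D curve_in_0[OF c] jet_index'(1,2)[OF i]]
      cderiv_jet_curve[OF M D u(1) jet_index'(1,2)[OF i]] unfolding jet_index'(3)[OF i] by simp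
qed

text \<open>Derivatives of positive order are unconstrained, being realized by
  \<open>jet_curve\<close>; the image is the cylinder over the image of the original chart.\<close>

lemma jet_coords_image:
  assumes M: "smooth_atlas M" and D: "(D, \<phi>) \<in> atlas M"
  shows "jet_coords n M \<phi> ` jet_dom n M D = {u \<in> esp (Suc n * mdim M). take_coords (mdim M) u \<in> \<phi> ` D}"
proof (intro equalityI subsetI)
  fix u assume "u \<in> jet_coords n M \<phi> ` jet_dom n M D"
  then obtain p where p: "curve M p" "p 0 \<in> D" "u = jet_coords n M \<phi> (jet n M p)" unfolding jet_dom_def by blast
  show "u \<in> {u \<in> esp (Suc n * mdim M). take_coords (mdim M) u \<in> \<phi> ` D}"
    using take_jet_coords[OF M p(1) D p(2)] p(2,3) jet_coords_esp by auto
next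
  fix u assume u: "u \<in> {u \<in> esp (Suc n * mdim M). take_coords (mdim M) u \<in> \<phi> ` D}"
  then have c: "curve_in (mdim M) D \<phi> (jet_curve n (mdim M) D \<phi> u)" using jet_curve_in[OF M D] by blast
  then have "jet n M (jet_curve n (mdim M) D \<phi> u) \<in> jet_dom n M D"
    by (intro jet_in_dom curve_inI[OF D] curve_in_0)
  moreover have "jet_coords n M \<phi> (jet n M (jet_curve n (mdim M) D \<phi> u)) = u" using u by (intro jet_coords_jet_curve[OF M D]) auto
  ultimately show "u \<in> jet_coords n M \<phi> ` jet_dom n M D" by (metis imageI)
qed

lemma eopen_take:
  assumes "eopen d U" "d \<le> e"
  shows "eopen e {u \<in> esp e. take_coords d u \<in> U}"
  by (rule eopen_preimage_smooth[OF openin_topspace _ _ assms(1)]) (auto simp: C_infinity_on_take take_coords_def)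

lemma jet_coords_inj:
  assumes M: "smooth_atlas M" and D: "(D, \<phi>) \<in> atlas M"
  shows "inj_on (jet_coords n M \<phi>) (jet_dom n M D)"
proof (rule inj_onI)
  fix A B assume "A \<in> jet_dom n M D" "B \<in> jet_dom n M D" and eq: "jet_coords n M \<phi> A = jet_coords n M \<phi> B"
  then obtain p q where p: "curve M p" "p 0 \<in> D" "A = jet n M p" and q: "curve M q" "q 0 \<in> D" "B = jet n M q"
    unfolding jet_dom_def by blast
  have "\<phi> (p 0) = \<phi> (q 0)"
    using take_jet_coords[OF M p(1) D p(2), of n] take_jet_coords[OF M q(1) D q(2), of n] eq p q by simp
  then have "p 0 = q 0" using chart_inj[OF M D] p q by (auto simp: inj_on_def)
  moreover have "cderiv k \<phi> p j = cderiv k \<phi> q j" if "k \<le> n" "j < mdim M" for k j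
    using jet_coords_at[OF M p(1) D p(2) that] jet_coords_at[OF M q(1) D q(2) that] eq p q by simp
  ultimately show "A = B" using jet_eq_iff[OF M p(1) q(1) D p(2)] p(3) q(3) by (simp add: same_jet_def)
qed

text \<open>A union over all representatives, as in \<open>jet_mult\<close>: its members coincide by
  \<open>jet_map_jet\<close>, so none has to be chosen.\<close>

definition jet_map :: "nat \<Rightarrow> 'b manifold \<Rightarrow> ('a \<Rightarrow> 'b) \<Rightarrow> (real \<Rightarrow> 'a) set \<Rightarrow> (real \<Rightarrow> 'b) set" where
  "jet_map n N f A = (\<Union>p\<in>A. jet n N (\<lambda>t. f (p t)))"

lemma jet_map_jet:
  assumes "smooth_atlas M" "smooth_atlas N" "smooth_map M N f" "curve M p"
  shows "jet_map n N f (jet n M p) = jet n N (\<lambda>t. f (p t))"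
proof -
  have "jet n N (\<lambda>t. f (q t)) = jet n N (\<lambda>t. f (p t))" if "q \<in> jet n M p" for q
    by (rule jet_compose[OF assms that])
  then show ?thesis unfolding jet_map_def using jet_self[OF assms(1,4), of n] by blast
qed

lemma C_infinity_on_blk: "C_infinity_on e V (\<lambda>u. blk d u l i)"
  by (cases "i < d") (simp_all add: blk_def)

text \<open>In jet coordinates the map consists of \<open>jet_comp\<close> applied to a local form
  of \<open>f\<close> and to the blocks of derivatives. With \<open>f\<close> the identity these are
  the transition maps of \<open>jet_manifold\<close>.\<close>

lemma smooth_rep_jet_map:
  assumes M: "smooth_atlas M" and N: "smooth_atlas N" and f: "smooth_map M N f"
    and D: "(D, \<phi>) \<in> atlas M" and E: "(E, \<psi>) \<in> atlas N" and p: "curve M p" "p 0 \<in> D" "f (p 0) \<in> E"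
  shows "smooth_rep (Suc n * mdim M) (jet_dom n M D) (jet_coords n M \<phi>) (Suc n * mdim N) (jet_dom n N E) (jet_coords n N \<psi>)
    (jet_map n N f) (jet n M p)"
proof -
  obtain U g where U: "eopen (mdim M) U" "\<phi> (p 0) \<in> U" "\<And>y. y \<in> D \<Longrightarrow> \<phi> y \<in> U \<Longrightarrow> f y \<in> E \<and> \<psi> (f y) = g (\<phi> y)"
    "\<And>u. u \<in> U \<Longrightarrow> g u \<in> esp (mdim N)" "\<And>j. j < mdim N \<Longrightarrow> C_infinity_on (mdim M) U (\<lambda>u. g u j)"
    using smooth_mapD[OF M N f D E p(2,3)] unfolding smooth_rep_def by blast
  let ?U = "{u \<in> esp (Suc n * mdim M). take_coords (mdim M) u \<in> U}"
  have U': "eopen (Suc n * mdim M) ?U" by (rule eopen_take[OF U(1)]) simp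
  show ?thesis
  proof (rule smooth_repI[where U = ?U and
        g = "\<lambda>u i. jet_comp (mdim M) (i div mdim N) (\<lambda>v. g v (i mod mdim N)) (blk (mdim M) u)"])
    show "jet_coords n M \<phi> (jet n M p) \<in> ?U"
      using take_jet_coords[OF M p(1) D p(2)] U(2) jet_coords_esp by auto
    fix A assume "A \<in> jet_dom n M D" "jet_coords n M \<phi> A \<in> ?U"
    then obtain q where q: "curve M q" "q 0 \<in> D" "A = jet n M q" and "take_coords (mdim M) (jet_coords n M \<phi> A) \<in> U"
      unfolding jet_dom_def by blast
    then have qU: "\<phi> (q 0) \<in> U" using take_jet_coords[OF M q(1) D q(2)] by simp
    then have fE: "f (q 0) \<in> E" using U(3) q by blast
    have A: "jet_map n N f A = jet n N (\<lambda>t. f (q t))" using jet_map_jet[OF M N f q(1)] q(3) by simp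
    show "jet_map n N f A \<in> jet_dom n N E"
      unfolding A by (rule jet_in_dom[OF curve_compose[OF M N f q(1)] fE])
    show "jet_coords n N \<psi> (jet_map n N f A) \<in> esp (Suc n * mdim N)" by (rule jet_coords_esp)
    fix i assume i: "i < Suc n * mdim N"
    note i' = jet_index'[OF i]
    have "jet_coords n N \<psi> (jet_map n N f A) i = cderiv (i div mdim N) \<psi> (\<lambda>t. f (q t)) (i mod mdim N)"
      using jet_coords_at[OF N curve_compose[OF M N f q(1)] E fE i'(1,2)] unfolding i'(3) A .
    also have "\<dots> = jet_comp (mdim M) (i div mdim N) (\<lambda>v. g v (i mod mdim N)) (\<lambda>l i. cderiv l \<phi> q i)"
      by (rule cderiv_compose[OF U(1) _ U(5)[OF i'(2)] curve_in_chart[OF M q(1) D q(2)] qU chart_esp[OF M D]])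
        (use U in auto)
    also have "\<dots> = jet_comp (mdim M) (i div mdim N) (\<lambda>v. g v (i mod mdim N)) (blk (mdim M) (jet_coords n M \<phi> A))"
    proof (rule jet_comp_cong)
      show "(\<lambda>i. cderiv 0 \<phi> q i) = blk (mdim M) (jet_coords n M \<phi> A) 0"
        unfolding blk_0 q(3) take_jet_coords[OF M q(1) D q(2)] by simp
      show "cderiv l \<phi> q j = blk (mdim M) (jet_coords n M \<phi> A) l j" if "l \<le> i div mdim N" "j < mdim M" for l j
        using blk_jet_coords[OF M q(1) D q(2) _ that(2), of l n] that i'(1) q(3) by simp
    qed
    finally show "jet_coords n N \<psi> (jet_map n N f A) i =
      jet_comp (mdim M) (i div mdim N) (\<lambda>v. g v (i mod mdim N)) (blk (mdim M) (jet_coords n M \<phi> A))" .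
  next
    fix i assume i: "i < Suc n * mdim N"
    show "C_infinity_on (Suc n * mdim M) ?U (\<lambda>u. jet_comp (mdim M) (i div mdim N) (\<lambda>v. g v (i mod mdim N)) (blk (mdim M) u))"
      by (rule C_infinity_on_jet_comp[OF U' U(1) U(5)[OF jet_index'(2)[OF i]]]) (auto simp: C_infinity_on_blk blk_0)
  qed (rule U')
qed

lemma jet_map_ident:
  assumes "smooth_atlas M" "curve M p" shows "jet_map n M (\<lambda>x. x) (jet n M p) = jet n M p"
  using jet_map_jet[OF assms(1,1) smooth_map_ident[OF assms(1)] assms(2)] by simp

lemma smooth_atlas_jet:
  assumes M: "smooth_atlas M" shows "smooth_atlas (jet_manifold n M)"
proof (rule smooth_atlasI)
  show "(\<Union>(D, \<phi>)\<in>atlas (jet_manifold n M). D) = points (jet_manifold n M)"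
  proof (intro equalityI subsetI)
    fix A assume "A \<in> points (jet_manifold n M)"
    then obtain p where p: "curve M p" "A = jet n M p" by auto
    obtain D \<phi> where D: "(D, \<phi>) \<in> atlas M" "p 0 \<in> D" using chart_exists[OF M curve_point[OF M p(1)]] .
    then show "A \<in> (\<Union>(D, \<phi>)\<in>atlas (jet_manifold n M). D)"
      using in_atlas_jet[OF D(1), of n] jet_in_dom[OF p(1) D(2), of n] p(2) by blast
  qed (auto simp: atlas_jet_manifold jet_dom_def)
next
  fix C \<theta> assume "(C, \<theta>) \<in> atlas (jet_manifold n M)"
  then obtain D \<phi> where D: "(D, \<phi>) \<in> atlas M" and C: "C = jet_dom n M D" "\<theta> = jet_coords n M \<phi>"
    unfolding atlas_jet_manifold by blast
  show "inj_on \<theta> C" unfolding C by (rule jet_coords_inj[OF M D])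
  show "eopen (mdim (jet_manifold n M)) (\<theta> ` C)"
    unfolding C jet_coords_image[OF M D] jet_manifold_simps by (rule eopen_take[OF chart_eopen[OF M D]]) simp
next
  fix C \<theta> C' \<theta>' A assume "(C, \<theta>) \<in> atlas (jet_manifold n M)" "(C', \<theta>') \<in> atlas (jet_manifold n M)" and A: "A \<in> C" "A \<in> C'"
  then obtain D \<phi> E \<psi> where D: "(D, \<phi>) \<in> atlas M" and C: "C = jet_dom n M D" "\<theta> = jet_coords n M \<phi>"
    and E: "(E, \<psi>) \<in> atlas M" and C': "C' = jet_dom n M E" "\<theta>' = jet_coords n M \<psi>"
    unfolding atlas_jet_manifold by blast
  obtain p where p: "curve M p" "p 0 \<in> D" "A = jet n M p" using A unfolding C jet_dom_def by blast
  obtain q where q: "curve M q" "q 0 \<in> E" "A = jet n M q" using A unfolding C' jet_dom_def by blast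
  have "q \<in> jet n M p" using jet_self[OF M q(1), of n] p(3) q(3) by simp
  then have "p 0 \<in> E" using jet_member_0[OF M p(1)] q(2) by metis
  from smooth_rep_jet_map[OF M M smooth_map_ident[OF M] D E p(1,2) this, of n]
  show "smooth_rep (mdim (jet_manifold n M)) C \<theta> (mdim (jet_manifold n M)) C' \<theta>' (\<lambda>x. x) A"
    unfolding C C' p(3) jet_manifold_simps
    by (rule smooth_rep_cong) (auto simp: jet_dom_def jet_map_ident[OF M])
qed

lemma smooth_map_jet_map:
  assumes M: "smooth_atlas M" and N: "smooth_atlas N" and f: "smooth_map M N f"
  shows "smooth_map (jet_manifold n M) (jet_manifold n N) (jet_map n N f)"
proof (rule smooth_mapI[OF smooth_atlas_jet[OF M] smooth_atlas_jet[OF N]])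
  fix A assume "A \<in> points (jet_manifold n M)"
  then obtain p where p: "curve M p" "A = jet n M p" by auto
  obtain D \<phi> where D: "(D, \<phi>) \<in> atlas M" "p 0 \<in> D" using chart_exists[OF M curve_point[OF M p(1)]] .
  obtain E \<psi> where E: "(E, \<psi>) \<in> atlas N" "f (p 0) \<in> E"
    using chart_exists[OF N smooth_map_points[OF M N f curve_point[OF M p(1)]]] .
  show "\<exists>D \<phi> E \<psi>. (D, \<phi>) \<in> atlas (jet_manifold n M) \<and> (E, \<psi>) \<in> atlas (jet_manifold n N) \<and> A \<in> D \<and>
      smooth_rep (mdim (jet_manifold n M)) D \<phi> (mdim (jet_manifold n N)) E \<psi> (jet_map n N f) A"
    using smooth_rep_jet_map[OF M N f D(1) E(1) p(1) D(2) E(2), of n] in_atlas_jet[OF D(1)] in_atlas_jet[OF E(1)]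
      jet_in_dom[OF p(1) D(2)] unfolding p(2) jet_manifold_simps by blast
qed

definition jet_base :: "(real \<Rightarrow> 'a) set \<Rightarrow> 'a" where
  "jet_base A = (SOME p. p \<in> A) 0"

lemma jet_base_jet: "smooth_atlas M \<Longrightarrow> curve M p \<Longrightarrow> jet_base (jet n M p) = p 0"
  unfolding jet_base_def using jet_member_0[of M p] jet_self[of M p n] someI[of "\<lambda>q. q \<in> jet n M p"] by blast

lemma smooth_map_jet_base:
  assumes M: "smooth_atlas M" shows "smooth_map (jet_manifold n M) M jet_base"
proof (rule smooth_mapI[OF smooth_atlas_jet[OF M] M])
  fix A assume "A \<in> points (jet_manifold n M)"
  then obtain p where p: "curve M p" "A = jet n M p" by auto
  obtain D \<phi> where D: "(D, \<phi>) \<in> atlas M" "p 0 \<in> D" using chart_exists[OF M curve_point[OF M p(1)]] .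
  have "smooth_rep (Suc n * mdim M) (jet_dom n M D) (jet_coords n M \<phi>) (mdim M) D \<phi> jet_base A"
  proof (rule smooth_repI[where U = "esp (Suc n * mdim M)" and g = "take_coords (mdim M)"])
    fix B assume "B \<in> jet_dom n M D"
    then obtain q where q: "curve M q" "q 0 \<in> D" "B = jet n M q" unfolding jet_dom_def by blast
    show "jet_base B \<in> D" using q jet_base_jet[OF M q(1)] by simp
    then show "\<phi> (jet_base B) \<in> esp (mdim M)" by (rule chart_esp[OF M D(1)])
    show "\<phi> (jet_base B) j = take_coords (mdim M) (jet_coords n M \<phi> B) j" for j
      using take_jet_coords[OF M q(1) D(1) q(2)] jet_base_jet[OF M q(1)] q(3) by simp
  qed (simp_all add: jet_coords_esp C_infinity_on_take del: mult_Suc)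
  then show "\<exists>C \<theta> E \<psi>. (C, \<theta>) \<in> atlas (jet_manifold n M) \<and> (E, \<psi>) \<in> atlas M \<and> A \<in> C \<and>
      smooth_rep (mdim (jet_manifold n M)) C \<theta> (mdim M) E \<psi> jet_base A"
    using in_atlas_jet[OF D(1)] D jet_in_dom[OF p(1) D(2)] unfolding p(2) jet_manifold_simps by blast
qed

text \<open>Jets over the same point share a jet chart; jets over distinct points are separated by
  pulling neighbourhoods back along \<open>jet_base\<close>.\<close>

lemma smooth_manifold_jet:
  assumes "smooth_manifold M" shows "smooth_manifold (jet_manifold n M)"
proof -
  have M: "smooth_atlas M" and H: "Hausdorff_space (mtop M)" using assms by (auto simp: smooth_manifold_iff)
  note J = smooth_atlas_jet[OF M, of n]
  have "Hausdorff_space (mtop (jet_manifold n M))"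
    unfolding Hausdorff_space_def
  proof (intro allI impI)
    fix A B assume AB: "A \<in> topspace (mtop (jet_manifold n M)) \<and> B \<in> topspace (mtop (jet_manifold n M)) \<and> A \<noteq> B"
    then obtain p q where p: "curve M p" "A = jet n M p" and q: "curve M q" "B = jet n M q"
      by (auto simp: topspace_mtop[OF J])
    show "\<exists>U V. openin (mtop (jet_manifold n M)) U \<and> openin (mtop (jet_manifold n M)) V \<and> A \<in> U \<and> B \<in> V \<and> disjnt U V"
    proof (cases "p 0 = q 0")
      case True
      obtain D \<phi> where D: "(D, \<phi>) \<in> atlas M" "p 0 \<in> D" using chart_exists[OF M curve_point[OF M p(1)]] .
      show ?thesis
        by (rule separated_in_chart[OF J in_atlas_jet[OF D(1)]]) (use jet_in_dom[OF p(1)] jet_in_dom[OF q(1)] p q D True AB in auto)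
    next
      case False
      then have "jet_base A \<noteq> jet_base B" using jet_base_jet[OF M] p q by simp
      then show ?thesis
        by (intro separated_by_map[OF H]) (use AB smooth_map_jet_base[OF M] in \<open>auto simp: smooth_map_def\<close>)
    qed
  qed
  then show ?thesis using J by (simp add: smooth_manifold_iff)
qed

section \<open>Jets of pairs and jets of constant curves\<close>

lemma curve_in_Pair:
  assumes "curve_in d D \<phi> p" "curve_in e E \<psi> q"
  shows "curve_in (d + e) (D \<times> E) (prod_chart d \<phi> \<psi>) (\<lambda>t. (p t, q t))"
proof -
  have "sgerm (\<lambda>t. append_coords d (\<phi> (p t)) (\<psi> (q t)) j)" if "j < d + e" for j
    using assms that by (cases "j < d") (auto simp: append_coords_def curve_in_def)
  then show ?thesis using assms by (auto simp: eventually_conj_iff curve_in_def)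
qed

lemma cderiv_Pair:
  "(deriv ^^ k) (\<lambda>t. append_coords d (\<phi> (p t)) (\<psi> (q t)) j) 0 = (if j < d then cderiv k \<phi> p j else cderiv k \<psi> q (j - d))"
  by (cases "j < d") (simp_all add: append_coords_def)

lemma curve_Pair:
  assumes "curve M p" "curve N q" shows "curve (prod_manifold M N) (\<lambda>t. (p t, q t))"
proof -
  obtain D \<phi> where D: "(D, \<phi>) \<in> atlas M" "curve_in (mdim M) D \<phi> p" using assms(1) unfolding curve_iff by blast
  obtain E \<psi> where E: "(E, \<psi>) \<in> atlas N" "curve_in (mdim N) E \<psi> q" using assms(2) unfolding curve_iff by blast
  show ?thesis using curve_inI[OF in_atlas_prod[OF D(1) E(1)]] curve_in_Pair[OF D(2) E(2)] by simp
qed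

definition jet_pair :: "nat \<Rightarrow> 'a manifold \<Rightarrow> 'b manifold \<Rightarrow> (real \<Rightarrow> 'a) set \<Rightarrow> (real \<Rightarrow> 'b) set \<Rightarrow> (real \<Rightarrow> 'a \<times> 'b) set" where
  "jet_pair n M N A B = (\<Union>p\<in>A. \<Union>q\<in>B. jet n (prod_manifold M N) (\<lambda>t. (p t, q t)))"

lemma jet_pair_jet:
  assumes M: "smooth_atlas M" and N: "smooth_atlas N" and p: "curve M p" and q: "curve N q"
  shows "jet_pair n M N (jet n M p) (jet n N q) = jet n (prod_manifold M N) (\<lambda>t. (p t, q t))"
proof -
  obtain D \<phi> where D: "(D, \<phi>) \<in> atlas M" "p 0 \<in> D" using chart_exists[OF M curve_point[OF M p]] .
  obtain E \<psi> where E: "(E, \<psi>) \<in> atlas N" "q 0 \<in> E" using chart_exists[OF N curve_point[OF N q]] .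
  have "jet n (prod_manifold M N) (\<lambda>t. (p' t, q' t)) = jet n (prod_manifold M N) (\<lambda>t. (p t, q t))"
    if p': "p' \<in> jet n M p" and q': "q' \<in> jet n N q" for p' q'
  proof -
    have 1: "same_jet n (mdim M) \<phi> p' p" "same_jet n (mdim N) \<psi> q' q" "curve M p'" "curve N q'"
      using that jet_iff[OF M p D] jet_iff[OF N q E] by blast+
    then have "same_jet n (mdim M + mdim N) (prod_chart (mdim M) \<phi> \<psi>) (\<lambda>t. (p' t, q' t)) (\<lambda>t. (p t, q t))"
      by (auto simp: same_jet_def cderiv_Pair)
    moreover have "(p' 0, q' 0) \<in> D \<times> E" using 1 D E by (simp add: same_jet_def)
    ultimately show ?thesis
      using jet_eq_iff[OF smooth_atlas_prod[OF M N] curve_Pair[OF 1(3,4)] curve_Pair[OF p q] in_atlas_prod[OF D(1) E(1)], of n]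
      by simp
  qed
  then show ?thesis unfolding jet_pair_def using jet_self[OF M p, of n] jet_self[OF N q, of n] by blast
qed

lemma smooth_map_jet_pair:
  assumes M: "smooth_atlas M" and N: "smooth_atlas N"
  shows "smooth_map (prod_manifold (jet_manifold n M) (jet_manifold n N)) (jet_manifold n (prod_manifold M N))
    (\<lambda>(A, B). jet_pair n M N A B)"
proof (rule smooth_mapI[OF smooth_atlas_prod[OF smooth_atlas_jet[OF M] smooth_atlas_jet[OF N]] smooth_atlas_jet[OF smooth_atlas_prod[OF M N]]])
  fix X assume "X \<in> points (prod_manifold (jet_manifold n M) (jet_manifold n N))"
  then obtain p q where p: "curve M p" and q: "curve N q" and X: "X = (jet n M p, jet n N q)" by auto
  obtain D \<phi> where D: "(D, \<phi>) \<in> atlas M" "p 0 \<in> D" using chart_exists[OF M curve_point[OF M p]] .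
  obtain E \<psi> where E: "(E, \<psi>) \<in> atlas N" "q 0 \<in> E" using chart_exists[OF N curve_point[OF N q]] .
  let ?m = "mdim M" let ?n = "mdim N" let ?P = "prod_manifold M N"
  \<comment> \<open>In the product of two jet charts all derivatives from \<open>M\<close> precede
    those from \<open>N\<close>, whereas the chart for jets of pairs lists both for each order. With
    \<open>l\<close> the order and \<open>r\<close> the position within its block, \<open>?g\<close>
    is the resulting reindexing.\<close>
  let ?g = "\<lambda>u i. let l = i div (?m + ?n); r = i mod (?m + ?n) in
    if r < ?m then u (l * ?m + r) else u (Suc n * ?m + (l * ?n + (r - ?m)))"
  have "smooth_rep (Suc n * ?m + Suc n * ?n) (jet_dom n M D \<times> jet_dom n N E)
      (prod_chart (Suc n * ?m) (jet_coords n M \<phi>) (jet_coords n N \<psi>)) (Suc n * (?m + ?n))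
      (jet_dom n ?P (D \<times> E)) (jet_coords n ?P (prod_chart ?m \<phi> \<psi>)) (\<lambda>(A, B). jet_pair n M N A B) X"
  proof (rule smooth_repI[where U = "esp (Suc n * ?m + Suc n * ?n)" and g = ?g])
    show "prod_chart (Suc n * ?m) (jet_coords n M \<phi>) (jet_coords n N \<psi>) X \<in> esp (Suc n * ?m + Suc n * ?n)"
      unfolding X prod.case by (rule append_esp[OF jet_coords_esp])
    fix Y assume "Y \<in> jet_dom n M D \<times> jet_dom n N E"
    then obtain p q where p: "curve M p" "p 0 \<in> D" and q: "curve N q" "q 0 \<in> E" and Y: "Y = (jet n M p, jet n N q)"
      unfolding jet_dom_def by blast
    have e: "(\<lambda>(A, B). jet_pair n M N A B) Y = jet n ?P (\<lambda>t. (p t, q t))"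
      unfolding Y using jet_pair_jet[OF M N p(1) q(1)] by simp
    have m: "(p 0, q 0) \<in> D \<times> E" using p q by simp
    show "(\<lambda>(A, B). jet_pair n M N A B) Y \<in> jet_dom n ?P (D \<times> E)"
      unfolding e by (rule jet_in_dom[OF curve_Pair[OF p(1) q(1)] m])
    show "jet_coords n ?P (prod_chart ?m \<phi> \<psi>) ((\<lambda>(A, B). jet_pair n M N A B) Y) \<in> esp (Suc n * (?m + ?n))"
      using jet_coords_esp[of n ?P] by simp
    fix i assume i: "i < Suc n * (?m + ?n)"
    note i' = jet_index'[OF i]
    have "jet_coords n ?P (prod_chart ?m \<phi> \<psi>) (jet n ?P (\<lambda>t. (p t, q t))) i =
        cderiv (i div (?m + ?n)) (prod_chart ?m \<phi> \<psi>) (\<lambda>t. (p t, q t)) (i mod (?m + ?n))"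
      using jet_coords_at[OF smooth_atlas_prod[OF M N] curve_Pair[OF p(1) q(1)] in_atlas_prod[OF D(1) E(1)] m, of "i div (?m + ?n)" n "i mod (?m + ?n)"] i'
      by simp
    also have "\<dots> = ?g (prod_chart (Suc n * ?m) (jet_coords n M \<phi>) (jet_coords n N \<psi>) Y) i"
    proof (cases "i mod (?m + ?n) < ?m")
      case True
      then show ?thesis
        using jet_coords_at[OF M p(1) D(1) p(2) i'(1) True] jet_index(1)[OF i'(1) True]
        by (simp only: prod.case cderiv_Pair) (simp add: Y append_coords_def Let_def)
    next
      case False
      then have r: "i mod (?m + ?n) - ?m < ?n" using i'(2) by linarith
      show ?thesis
        using False jet_coords_at[OF N q(1) E(1) q(2) i'(1) r]
        by (simp only: prod.case cderiv_Pair) (simp add: Y append_coords_def Let_def)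
    qed
    finally show "jet_coords n ?P (prod_chart ?m \<phi> \<psi>) ((\<lambda>(A, B). jet_pair n M N A B) Y) i =
        ?g (prod_chart (Suc n * ?m) (jet_coords n M \<phi>) (jet_coords n N \<psi>) Y) i" unfolding e .
  next
    fix i show "C_infinity_on (Suc n * ?m + Suc n * ?n) (esp (Suc n * ?m + Suc n * ?n)) (\<lambda>u. ?g u i)"
      by (cases "i mod (?m + ?n) < ?m") (simp_all add: Let_def)
  qed simp
  moreover have "X \<in> jet_dom n M D \<times> jet_dom n N E" unfolding X using jet_in_dom[OF p D(2)] jet_in_dom[OF q E(2)] by simp
  ultimately show "\<exists>C \<theta> E \<psi>. (C, \<theta>) \<in> atlas (prod_manifold (jet_manifold n M) (jet_manifold n N)) \<and>
      (E, \<psi>) \<in> atlas (jet_manifold n (prod_manifold M N)) \<and> X \<in> C \<and>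
      smooth_rep (mdim (prod_manifold (jet_manifold n M) (jet_manifold n N))) C \<theta> (mdim (jet_manifold n (prod_manifold M N)))
        E \<psi> (\<lambda>(A, B). jet_pair n M N A B) X"
    using in_atlas_prod[OF in_atlas_jet[OF D(1)] in_atlas_jet[OF E(1)], of n n] in_atlas_jet[OF in_atlas_prod[OF D(1) E(1)], of n]
    unfolding jet_manifold_simps prod_manifold_simps by blast
qed

text \<open>The derivatives of a constant curve vanish, so its jet coordinates are those of the
  point padded by zeros, which is what \<open>take_coords\<close> produces.\<close>

lemma smooth_map_const_jet:
  assumes M: "smooth_atlas M" shows "smooth_map M (jet_manifold n M) (\<lambda>x. jet n M (\<lambda>_. x))"
proof (rule smooth_mapI[OF M smooth_atlas_jet[OF M]])
  fix x assume x: "x \<in> points M"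
  obtain D \<phi> where D: "(D, \<phi>) \<in> atlas M" "x \<in> D" using chart_exists[OF M x] .
  have "smooth_rep (mdim M) D \<phi> (Suc n * mdim M) (jet_dom n M D) (jet_coords n M \<phi>) (\<lambda>x. jet n M (\<lambda>_. x)) x"
  proof (rule smooth_repI[where U = "esp (mdim M)" and g = "take_coords (mdim M)"])
    fix y assume y: "y \<in> D"
    then have c: "curve M (\<lambda>_. y)" using curve_const[OF M] chart_subset[OF M D(1)] by blast
    show "jet n M (\<lambda>_. y) \<in> jet_dom n M D" using jet_in_dom[OF c] y by simp
    fix i assume i: "i < Suc n * mdim M"
    have "i < mdim M \<longleftrightarrow> i div mdim M = 0" using jet_index'(2,3)[OF i] by (metis div_eq_0_iff gr_implies_not0 div_less)
    then show "jet_coords n M \<phi> (jet n M (\<lambda>_. y)) i = take_coords (mdim M) (\<phi> y) i"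
      using jet_coords_jet[OF M c D(1), of n] y i jet_index'(3)[OF i] by (auto simp: take_coords_def higher_deriv_const_0)
  qed (use D chart_esp[OF M D(1)] jet_coords_esp in \<open>simp_all add: C_infinity_on_take del: mult_Suc\<close>)
  then show "\<exists>C \<theta> E \<psi>. (C, \<theta>) \<in> atlas M \<and> (E, \<psi>) \<in> atlas (jet_manifold n M) \<and> x \<in> C \<and>
      smooth_rep (mdim M) C \<theta> (mdim (jet_manifold n M)) E \<psi> (\<lambda>x. jet n M (\<lambda>_. x)) x"
    using in_atlas_jet[OF D(1)] D unfolding jet_manifold_simps by blast
qed

section \<open>Tangent groups\<close>

lemma
  assumes "lie_group G"
  shows lie_group_group: "group G" and lie_group_manifold: "smooth_manifold (mfd G)"
    and lie_group_atlas: "smooth_atlas (mfd G)" and lie_group_points: "points (mfd G) = carrier G"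
    and lie_group_smooth_mult: "smooth_map (prod_manifold (mfd G) (mfd G)) (mfd G) (\<lambda>(x, y). x \<otimes>\<^bsub>G\<^esub> y)"
    and lie_group_smooth_inv: "smooth_map (mfd G) (mfd G) (\<lambda>x. inv\<^bsub>G\<^esub> x)"
  using assms by (auto simp: lie_group_def smooth_manifold_iff)

lemma smooth_map_mult:
  assumes G: "lie_group G" and P: "smooth_atlas P" and f: "smooth_map P (mfd G) f" and g: "smooth_map P (mfd G) g"
  shows "smooth_map P (mfd G) (\<lambda>x. f x \<otimes>\<^bsub>G\<^esub> g x)"
  using smooth_map_compose[OF P _ _ smooth_map_Pair[OF _ _ P f g] lie_group_smooth_mult[OF G]]
    lie_group_atlas[OF G] smooth_atlas_prod by auto

lemma smooth_map_inv:
  assumes G: "lie_group G" and P: "smooth_atlas P" and f: "smooth_map P (mfd G) f"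
  shows "smooth_map P (mfd G) (\<lambda>x. inv\<^bsub>G\<^esub> (f x))"
  by (rule smooth_map_compose[OF P lie_group_atlas[OF G] lie_group_atlas[OF G] f lie_group_smooth_inv[OF G]])

lemma curve_eventually_points: "smooth_atlas M \<Longrightarrow> curve M p \<Longrightarrow> \<forall>\<^sub>F t in nhds 0. p t \<in> points M"
proof -
  assume M: "smooth_atlas M" and "curve M p"
  then obtain D \<phi> where "(D, \<phi>) \<in> atlas M" "curve_in (mdim M) D \<phi> p" unfolding curve_iff by blast
  then show ?thesis using chart_subset[OF M] unfolding curve_in_def by (auto elim!: eventually_mono)
qed

lemma curve_mult:
  assumes G: "lie_group G" and p: "curve (mfd G) p" and q: "curve (mfd G) q"
  shows "curve (mfd G) (\<lambda>t. p t \<otimes>\<^bsub>G\<^esub> q t)"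
  using curve_compose[OF smooth_atlas_prod lie_group_atlas[OF G] lie_group_smooth_mult[OF G] curve_Pair[OF p q]]
    lie_group_atlas[OF G] by simp

lemma curve_inv:
  assumes G: "lie_group G" and p: "curve (mfd G) p"
  shows "curve (mfd G) (\<lambda>t. inv\<^bsub>G\<^esub> p t)"
  by (rule curve_compose[OF lie_group_atlas[OF G] lie_group_atlas[OF G] lie_group_smooth_inv[OF G] p])

lemma curve_one: "lie_group G \<Longrightarrow> curve (mfd G) (\<lambda>_. \<one>\<^bsub>G\<^esub>)"
  using curve_const[OF lie_group_atlas] lie_group_points lie_group_group group.is_monoid monoid.one_closed by metis

lemma jet_mult_jet:
  assumes G: "lie_group G" and p: "curve (mfd G) p" and q: "curve (mfd G) q"
  shows "jet_mult n G (jet n (mfd G) p) (jet n (mfd G) q) = jet n (mfd G) (\<lambda>t. p t \<otimes>\<^bsub>G\<^esub> q t)"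
proof -
  note M = lie_group_atlas[OF G]
  note MM = smooth_atlas_prod[OF M M]
  have "jet n (mfd G) (\<lambda>t. p' t \<otimes>\<^bsub>G\<^esub> q' t) = jet n (mfd G) (\<lambda>t. p t \<otimes>\<^bsub>G\<^esub> q t)"
    if p': "p' \<in> jet n (mfd G) p" and q': "q' \<in> jet n (mfd G) q" for p' q'
  proof -
    note c = jet_member_curve[OF M p p'] jet_member_curve[OF M q q']
    have "jet n (prod_manifold (mfd G) (mfd G)) (\<lambda>t. (p' t, q' t)) = jet n (prod_manifold (mfd G) (mfd G)) (\<lambda>t. (p t, q t))"
      using jet_pair_jet[OF M M p q, of n] jet_pair_jet[OF M M c, of n] jet_member_eq[OF M p p'] jet_member_eq[OF M q q'] by simp
    then have "(\<lambda>t. (p' t, q' t)) \<in> jet n (prod_manifold (mfd G) (mfd G)) (\<lambda>t. (p t, q t))"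
      using jet_self[OF MM curve_Pair[OF c], of n] by simp
    from jet_compose[OF MM M lie_group_smooth_mult[OF G] curve_Pair[OF p q] this] show ?thesis by simp
  qed
  then show ?thesis unfolding jet_mult_def using jet_self[OF M p, of n] jet_self[OF M q, of n] by blast
qed

text \<open>The product of jets is the jet of the multiplication map after passing from pairs of
  jets to jets of pairs, and both maps are smooth.\<close>

lemma smooth_map_jet_mult:
  assumes G: "lie_group G"
  shows "smooth_map (prod_manifold (jet_manifold n (mfd G)) (jet_manifold n (mfd G))) (jet_manifold n (mfd G))
    (\<lambda>(A, B). jet_mult n G A B)"
proof -
  note M = lie_group_atlas[OF G]
  note MM = smooth_atlas_prod[OF M M]
  note J = smooth_atlas_jet[OF M, of n]
  show ?thesis
  proof (rule smooth_map_cong[OF smooth_atlas_prod[OF J J] J])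
    show "smooth_map (prod_manifold (jet_manifold n (mfd G)) (jet_manifold n (mfd G))) (jet_manifold n (mfd G))
      (\<lambda>X. jet_map n (mfd G) (\<lambda>(x, y). x \<otimes>\<^bsub>G\<^esub> y) ((\<lambda>(A, B). jet_pair n (mfd G) (mfd G) A B) X))"
      by (rule smooth_map_compose[OF smooth_atlas_prod[OF J J] smooth_atlas_jet[OF MM] J smooth_map_jet_pair[OF M M]
        smooth_map_jet_map[OF MM M lie_group_smooth_mult[OF G]]])
    fix X assume "X \<in> points (prod_manifold (jet_manifold n (mfd G)) (jet_manifold n (mfd G)))"
    then obtain p q where p: "curve (mfd G) p" and q: "curve (mfd G) q" and X: "X = (jet n (mfd G) p, jet n (mfd G) q)"
      by auto
    show "jet_map n (mfd G) (\<lambda>(x, y). x \<otimes>\<^bsub>G\<^esub> y) ((\<lambda>(A, B). jet_pair n (mfd G) (mfd G) A B) X) = (\<lambda>(A, B). jet_mult n G A B) X"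
      using jet_map_jet[OF MM M lie_group_smooth_mult[OF G] curve_Pair[OF p q]]
      unfolding X prod.case jet_pair_jet[OF M M p q] jet_mult_jet[OF G p q] by simp
  qed
qed

lemma tangent_group_simps [simp]:
  "carrier (tangent_group n G) = {jet n (mfd G) p | p. curve (mfd G) p}"
  "A \<otimes>\<^bsub>tangent_group n G\<^esub> B = jet_mult n G A B"
  "\<one>\<^bsub>tangent_group n G\<^esub> = jet n (mfd G) (\<lambda>_. \<one>\<^bsub>G\<^esub>)"
  "mfd (tangent_group n G) = jet_manifold n (mfd G)"
  by (simp_all add: tangent_group_def)

lemma
  assumes G: "lie_group G" and p: "curve (mfd G) p"
  shows jet_mult_one_left: "jet_mult n G (jet n (mfd G) (\<lambda>_. \<one>\<^bsub>G\<^esub>)) (jet n (mfd G) p) = jet n (mfd G) p"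
    and jet_mult_inv_left: "jet_mult n G (jet n (mfd G) (\<lambda>t. inv\<^bsub>G\<^esub> p t)) (jet n (mfd G) p) = jet n (mfd G) (\<lambda>_. \<one>\<^bsub>G\<^esub>)"
proof -
  note M = lie_group_atlas[OF G]
  have ev: "\<forall>\<^sub>F t in nhds 0. p t \<in> carrier G" using curve_eventually_points[OF M p] lie_group_points[OF G] by simp
  interpret group G by (rule lie_group_group[OF G])
  have "\<forall>\<^sub>F t in nhds 0. p t = \<one>\<^bsub>G\<^esub> \<otimes>\<^bsub>G\<^esub> p t" using ev by eventually_elim simp
  from jet_germ_cong[OF M p this] show "jet_mult n G (jet n (mfd G) (\<lambda>_. \<one>\<^bsub>G\<^esub>)) (jet n (mfd G) p) = jet n (mfd G) p"
    using jet_mult_jet[OF G curve_one[OF G] p] by simp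
  have "\<forall>\<^sub>F t in nhds 0. \<one>\<^bsub>G\<^esub> = inv\<^bsub>G\<^esub> p t \<otimes>\<^bsub>G\<^esub> p t" using ev by eventually_elim simp
  from jet_germ_cong[OF M curve_one[OF G] this]
  show "jet_mult n G (jet n (mfd G) (\<lambda>t. inv\<^bsub>G\<^esub> p t)) (jet n (mfd G) p) = jet n (mfd G) (\<lambda>_. \<one>\<^bsub>G\<^esub>)"
    using jet_mult_jet[OF G curve_inv[OF G p] p] by simp
qed

lemma jet_mult_assoc:
  assumes G: "lie_group G" and p: "curve (mfd G) p" and q: "curve (mfd G) q" and r: "curve (mfd G) r"
  shows "jet_mult n G (jet_mult n G (jet n (mfd G) p) (jet n (mfd G) q)) (jet n (mfd G) r) =
    jet_mult n G (jet n (mfd G) p) (jet_mult n G (jet n (mfd G) q) (jet n (mfd G) r))"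
proof -
  note M = lie_group_atlas[OF G]
  interpret group G by (rule lie_group_group[OF G])
  have "\<forall>\<^sub>F t in nhds 0. p t \<in> carrier G" "\<forall>\<^sub>F t in nhds 0. q t \<in> carrier G" "\<forall>\<^sub>F t in nhds 0. r t \<in> carrier G"
    using curve_eventually_points[OF M p] curve_eventually_points[OF M q] curve_eventually_points[OF M r]
      lie_group_points[OF G] by simp_all
  then have "\<forall>\<^sub>F t in nhds 0. p t \<otimes>\<^bsub>G\<^esub> q t \<otimes>\<^bsub>G\<^esub> r t = p t \<otimes>\<^bsub>G\<^esub> (q t \<otimes>\<^bsub>G\<^esub> r t)"
    by eventually_elim (rule m_assoc)
  from jet_germ_cong[OF M curve_mult[OF G curve_mult[OF G p q] r] this] show ?thesis
    using jet_mult_jet[OF G] curve_mult[OF G] p q r by simp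
qed

lemma group_tangent_group:
  assumes G: "lie_group G" shows "group (tangent_group n G)"
proof (rule groupI)
  fix A B assume "A \<in> carrier (tangent_group n G)" "B \<in> carrier (tangent_group n G)"
  then show "A \<otimes>\<^bsub>tangent_group n G\<^esub> B \<in> carrier (tangent_group n G)"
    using jet_mult_jet[OF G] curve_mult[OF G] by auto
next
  show "\<one>\<^bsub>tangent_group n G\<^esub> \<in> carrier (tangent_group n G)" using curve_one[OF G] by auto
next
  fix A B C assume "A \<in> carrier (tangent_group n G)" "B \<in> carrier (tangent_group n G)" "C \<in> carrier (tangent_group n G)"
  then show "A \<otimes>\<^bsub>tangent_group n G\<^esub> B \<otimes>\<^bsub>tangent_group n G\<^esub> C = A \<otimes>\<^bsub>tangent_group n G\<^esub> (B \<otimes>\<^bsub>tangent_group n G\<^esub> C)"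
    using jet_mult_assoc[OF G] by auto
next
  fix A assume "A \<in> carrier (tangent_group n G)"
  then obtain p where p: "curve (mfd G) p" "A = jet n (mfd G) p" by auto
  show "\<one>\<^bsub>tangent_group n G\<^esub> \<otimes>\<^bsub>tangent_group n G\<^esub> A = A" using jet_mult_one_left[OF G p(1)] p(2) by simp
  show "\<exists>B\<in>carrier (tangent_group n G). B \<otimes>\<^bsub>tangent_group n G\<^esub> A = \<one>\<^bsub>tangent_group n G\<^esub>"
    using jet_mult_inv_left[OF G p(1)] curve_inv[OF G p(1)] p(2) by auto
qed

lemma inv_tangent_group:
  assumes G: "lie_group G" and p: "curve (mfd G) p"
  shows "inv\<^bsub>tangent_group n G\<^esub> (jet n (mfd G) p) = jet n (mfd G) (\<lambda>t. inv\<^bsub>G\<^esub> p t)"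
  by (rule group.inv_equality[OF group_tangent_group[OF G]])
    (use jet_mult_inv_left[OF G p] curve_inv[OF G p] p in auto)

lemma lie_group_tangent_group:
  assumes G: "lie_group G" shows "lie_group (tangent_group n G)"
  unfolding lie_group_def
proof (intro conjI)
  note M = lie_group_atlas[OF G]
  show "group (tangent_group n G)" by (rule group_tangent_group[OF G])
  show "smooth_manifold (mfd (tangent_group n G))" using smooth_manifold_jet[OF lie_group_manifold[OF G]] by simp
  show "points (mfd (tangent_group n G)) = carrier (tangent_group n G)" by simp
  show "smooth_map (prod_manifold (mfd (tangent_group n G)) (mfd (tangent_group n G))) (mfd (tangent_group n G))
     (\<lambda>(x, y). x \<otimes>\<^bsub>tangent_group n G\<^esub> y)"
    using smooth_map_jet_mult[OF G] by simp
  show "smooth_map (mfd (tangent_group n G)) (mfd (tangent_group n G)) (\<lambda>x. inv\<^bsub>tangent_group n G\<^esub> x)"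
    unfolding tangent_group_simps
  proof (rule smooth_map_cong[OF smooth_atlas_jet[OF M] smooth_atlas_jet[OF M] smooth_map_jet_map[OF M M lie_group_smooth_inv[OF G]]])
    fix A assume "A \<in> points (jet_manifold n (mfd G))"
    then obtain p where p: "curve (mfd G) p" "A = jet n (mfd G) p" by auto
    show "jet_map n (mfd G) (m_inv G) A = inv\<^bsub>tangent_group n G\<^esub> A"
      unfolding p(2) jet_map_jet[OF M M lie_group_smooth_inv[OF G] p(1)] inv_tangent_group[OF G p(1)] ..
  qed
qed

section \<open>Jets at the identity\<close>

definition jets_at :: "nat \<Rightarrow> 'a manifold \<Rightarrow> 'a \<Rightarrow> (real \<Rightarrow> 'a) set set" where
  "jets_at m M x = {jet m M p | p. curve M p \<and> p 0 = x}"

definition fibre_chart :: "nat \<Rightarrow> 'a manifold \<Rightarrow> ('a \<Rightarrow> nat \<Rightarrow> real) \<Rightarrow> (real \<Rightarrow> 'a) set \<Rightarrow> nat \<Rightarrow> real" where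
  "fibre_chart m M \<phi> A = drop_coords (mdim M) (jet_coords m M \<phi> A)"

lemma tangent_group_at_one_simps [simp]:
  "carrier (tangent_group_at_one m G) = jets_at m (mfd G) \<one>\<^bsub>G\<^esub>"
  "A \<otimes>\<^bsub>tangent_group_at_one m G\<^esub> B = jet_mult m G A B"
  "\<one>\<^bsub>tangent_group_at_one m G\<^esub> = jet m (mfd G) (\<lambda>_. \<one>\<^bsub>G\<^esub>)"
  "points (mfd (tangent_group_at_one m G)) = jets_at m (mfd G) \<one>\<^bsub>G\<^esub>"
  "mdim (mfd (tangent_group_at_one m G)) = m * mdim (mfd G)"
  by (simp_all add: tangent_group_at_one_def jets_at_def Let_def)

lemma atlas_tangent_group_at_one:
  "c \<in> atlas (mfd (tangent_group_at_one m G)) \<longleftrightarrow>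
    (\<exists>D \<phi>. (D, \<phi>) \<in> atlas (mfd G) \<and> \<one>\<^bsub>G\<^esub> \<in> D \<and> c = (jets_at m (mfd G) \<one>\<^bsub>G\<^esub>, fibre_chart m (mfd G) \<phi>))"
  by (auto simp: tangent_group_at_one_def Let_def jets_at_def fibre_chart_def[abs_def] drop_coords_def)

lemma jets_at_dom: "x \<in> D \<Longrightarrow> jets_at m M x \<subseteq> jet_dom m M D"
  by (auto simp: jets_at_def jet_dom_def)

lemma take_jets_at:
  assumes "smooth_atlas M" "(D, \<phi>) \<in> atlas M" "x \<in> D" "A \<in> jets_at m M x"
  shows "take_coords (mdim M) (jet_coords m M \<phi> A) = \<phi> x"
  using assms take_jet_coords[OF assms(1) _ assms(2)] by (auto simp: jets_at_def)

lemma jet_coords_fibre_chart: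
  assumes "smooth_atlas M" "(D, \<phi>) \<in> atlas M" "x \<in> D" "A \<in> jets_at m M x"
  shows "jet_coords m M \<phi> A = append_coords (mdim M) (\<phi> x) (fibre_chart m M \<phi> A)"
  using append_take_drop[of "mdim M" "jet_coords m M \<phi> A"] take_jets_at[OF assms] by (simp add: fibre_chart_def)

lemma fibre_chart_esp: "fibre_chart m M \<phi> A \<in> esp (m * mdim M)"
  using jet_coords_esp[of m M \<phi> A] unfolding fibre_chart_def by (intro drop_esp) simp

lemma fibre_chart_inj:
  assumes "smooth_atlas M" "(D, \<phi>) \<in> atlas M" "x \<in> D"
  shows "inj_on (fibre_chart m M \<phi>) (jets_at m M x)"
proof (rule inj_onI)
  fix A B assume AB: "A \<in> jets_at m M x" "B \<in> jets_at m M x" "fibre_chart m M \<phi> A = fibre_chart m M \<phi> B"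
  then have "jet_coords m M \<phi> A = jet_coords m M \<phi> B" using jet_coords_fibre_chart[OF assms] by simp
  then show "A = B" using jet_coords_inj[OF assms(1,2), of m] AB jets_at_dom[OF assms(3), of m M] by (auto simp: inj_on_def)
qed

text \<open>Over a fixed base point all remaining coordinates are free, so every
  \<open>fibre_chart\<close> is a global chart of the fibre onto a full Euclidean space.\<close>

lemma fibre_chart_image:
  assumes M: "smooth_atlas M" and D: "(D, \<phi>) \<in> atlas M" "x \<in> D"
  shows "fibre_chart m M \<phi> ` jets_at m M x = esp (m * mdim M)"
proof (intro equalityI subsetI)
  fix v assume v: "v \<in> esp (m * mdim M)"
  define u where "u = append_coords (mdim M) (\<phi> x) v"
  have u: "take_coords (mdim M) u = \<phi> x" "u \<in> esp (Suc m * mdim M)"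
    using append_esp[OF v] by (simp_all add: u_def take_append[OF chart_esp[OF M D]])
  then have "u \<in> jet_coords m M \<phi> ` jet_dom m M D"
    unfolding jet_coords_image[OF M D(1)] using D(2) by simp
  then obtain p where p: "curve M p" "p 0 \<in> D" "u = jet_coords m M \<phi> (jet m M p)" unfolding jet_dom_def by blast
  have "\<phi> (p 0) = \<phi> x" using take_jet_coords[OF M p(1) D(1) p(2), of m] p(3) u by simp
  then have "p 0 = x" using chart_inj[OF M D(1)] p D by (auto simp: inj_on_def)
  then have "jet m M p \<in> jets_at m M x" using p by (auto simp: jets_at_def)
  moreover have "fibre_chart m M \<phi> (jet m M p) = v" unfolding fibre_chart_def p(3)[symmetric] u_def by (rule drop_append)
  ultimately show "v \<in> fibre_chart m M \<phi> ` jets_at m M x" by blast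
qed (use fibre_chart_esp in blast)

lemma smooth_rep_jets_at_inclusion:
  assumes M: "smooth_atlas M" and D: "(D, \<phi>) \<in> atlas M" "x \<in> D"
  shows "smooth_rep (m * mdim M) (jets_at m M x) (fibre_chart m M \<phi>) (Suc m * mdim M) (jet_dom m M D) (jet_coords m M \<phi>) (\<lambda>A. A) A"
proof (rule smooth_repI[where U = "esp (m * mdim M)" and g = "\<lambda>u. append_coords (mdim M) (\<phi> x) u"])
  fix B assume "B \<in> jets_at m M x"
  then show "B \<in> jet_dom m M D" using jets_at_dom[OF D(2), of m M] by blast
  show "jet_coords m M \<phi> B i = append_coords (mdim M) (\<phi> x) (fibre_chart m M \<phi> B) i" for i
    using jet_coords_fibre_chart[OF M D \<open>B \<in> jets_at m M x\<close>] by simp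
next
  fix i
  show "C_infinity_on (m * mdim M) (esp (m * mdim M)) (\<lambda>u. append_coords (mdim M) (\<phi> x) u i)"
    by (cases "i < mdim M") (simp_all add: append_coords_def)
qed (use fibre_chart_esp jet_coords_esp in auto)

lemma smooth_rep_into_jets_at:
  assumes r: "smooth_rep d C \<theta> (Suc m * mdim M) (jet_dom m M E) (jet_coords m M \<psi>) f y"
    and f: "\<And>y. y \<in> C \<Longrightarrow> f y \<in> jets_at m M x"
  shows "smooth_rep d C \<theta> (m * mdim M) (jets_at m M x) (fibre_chart m M \<psi>) f y"
proof -
  obtain U g where U: "eopen d U" "\<theta> y \<in> U"
    "\<And>y. y \<in> C \<Longrightarrow> \<theta> y \<in> U \<Longrightarrow> f y \<in> jet_dom m M E \<and> jet_coords m M \<psi> (f y) = g (\<theta> y)"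
    "\<And>j. j < Suc m * mdim M \<Longrightarrow> C_infinity_on d U (\<lambda>u. g u j)"
    using r unfolding smooth_rep_def by blast
  show ?thesis
  proof (rule smooth_repI[where U = U and g = "\<lambda>u. drop_coords (mdim M) (g u)"])
    show "C_infinity_on d U (\<lambda>u. drop_coords (mdim M) (g u) j)" if "j < m * mdim M" for j
      using U(4)[of "j + mdim M"] that by (simp add: drop_coords_def)
    show "fibre_chart m M \<psi> (f y) j = drop_coords (mdim M) (g (\<theta> y)) j" if "y \<in> C" "\<theta> y \<in> U" for y j
      using U(3)[OF that] by (simp add: fibre_chart_def)
  qed (use U f fibre_chart_esp in auto)
qed

lemma smooth_atlas_at_one:
  assumes G: "lie_group G" shows "smooth_atlas (mfd (tangent_group_at_one m G))"
proof (rule smooth_atlasI)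
  note M = lie_group_atlas[OF G]
  have "\<one>\<^bsub>G\<^esub> \<in> points (mfd G)" using curve_point[OF M curve_one[OF G]] .
  then obtain D \<phi> where D: "(D, \<phi>) \<in> atlas (mfd G)" "\<one>\<^bsub>G\<^esub> \<in> D" using chart_exists[OF M] by blast
  show "(\<Union>(D, \<phi>)\<in>atlas (mfd (tangent_group_at_one m G)). D) = points (mfd (tangent_group_at_one m G))"
  proof (intro equalityI subsetI)
    fix A assume "A \<in> points (mfd (tangent_group_at_one m G))"
    moreover have "(jets_at m (mfd G) \<one>\<^bsub>G\<^esub>, fibre_chart m (mfd G) \<phi>) \<in> atlas (mfd (tangent_group_at_one m G))"
      using D unfolding atlas_tangent_group_at_one by blast
    ultimately show "A \<in> (\<Union>(D, \<phi>)\<in>atlas (mfd (tangent_group_at_one m G)). D)" by force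
  qed (auto simp: atlas_tangent_group_at_one)
next
  note M = lie_group_atlas[OF G]
  fix C \<theta> assume "(C, \<theta>) \<in> atlas (mfd (tangent_group_at_one m G))"
  then obtain D \<phi> where D: "(D, \<phi>) \<in> atlas (mfd G)" "\<one>\<^bsub>G\<^esub> \<in> D"
    and C: "C = jets_at m (mfd G) \<one>\<^bsub>G\<^esub>" "\<theta> = fibre_chart m (mfd G) \<phi>" unfolding atlas_tangent_group_at_one by blast
  show "inj_on \<theta> C" unfolding C by (rule fibre_chart_inj[OF M D])
  show "eopen (mdim (mfd (tangent_group_at_one m G))) (\<theta> ` C)"
    unfolding C fibre_chart_image[OF M D] tangent_group_at_one_simps by (rule openin_topspace)
next
  note M = lie_group_atlas[OF G]
  fix C \<theta> C' \<theta>' A assume "(C, \<theta>) \<in> atlas (mfd (tangent_group_at_one m G))" "(C', \<theta>') \<in> atlas (mfd (tangent_group_at_one m G))"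
    and A: "A \<in> C" "A \<in> C'"
  then obtain D \<phi> E \<psi> where D: "(D, \<phi>) \<in> atlas (mfd G)" "\<one>\<^bsub>G\<^esub> \<in> D"
    and C: "C = jets_at m (mfd G) \<one>\<^bsub>G\<^esub>" "\<theta> = fibre_chart m (mfd G) \<phi>"
    and E: "(E, \<psi>) \<in> atlas (mfd G)" "\<one>\<^bsub>G\<^esub> \<in> E"
    and C': "C' = jets_at m (mfd G) \<one>\<^bsub>G\<^esub>" "\<theta>' = fibre_chart m (mfd G) \<psi>"
    unfolding atlas_tangent_group_at_one by blast
  have m: "A \<in> jet_dom m (mfd G) D" "A \<in> jet_dom m (mfd G) E"
    using A C jets_at_dom[OF D(2), of m "mfd G"] jets_at_dom[OF E(2), of m "mfd G"] by auto
  have t: "smooth_rep (Suc m * mdim (mfd G)) (jet_dom m (mfd G) D) (jet_coords m (mfd G) \<phi>)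
      (Suc m * mdim (mfd G)) (jet_dom m (mfd G) E) (jet_coords m (mfd G) \<psi>) (\<lambda>A. A) A"
    using smooth_rep_transition[OF smooth_atlas_jet[OF M] in_atlas_jet[OF D(1)] in_atlas_jet[OF E(1)] m] by simp
  have "smooth_rep (m * mdim (mfd G)) C \<theta> (Suc m * mdim (mfd G)) (jet_dom m (mfd G) E) (jet_coords m (mfd G) \<psi>) (\<lambda>A. A) A"
    unfolding C by (rule smooth_rep_compose[where f = "\<lambda>A. A", OF smooth_rep_jets_at_inclusion[OF M D] t])
      (use A C in simp)
  then show "smooth_rep (mdim (mfd (tangent_group_at_one m G))) C \<theta> (mdim (mfd (tangent_group_at_one m G))) C' \<theta>' (\<lambda>x. x) A"
    unfolding C' tangent_group_at_one_simps by (rule smooth_rep_into_jets_at) (simp add: C)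
qed

lemma smooth_map_at_one_inclusion:
  assumes G: "lie_group G"
  shows "smooth_map (mfd (tangent_group_at_one m G)) (jet_manifold m (mfd G)) (\<lambda>A. A)"
proof (rule smooth_mapI[OF smooth_atlas_at_one[OF G] smooth_atlas_jet[OF lie_group_atlas[OF G]]])
  note M = lie_group_atlas[OF G]
  fix A assume A: "A \<in> points (mfd (tangent_group_at_one m G))"
  obtain D \<phi> where D: "(D, \<phi>) \<in> atlas (mfd G)" "\<one>\<^bsub>G\<^esub> \<in> D"
    using chart_exists[OF M curve_point[OF M curve_one[OF G]]] by blast
  have "(jets_at m (mfd G) \<one>\<^bsub>G\<^esub>, fibre_chart m (mfd G) \<phi>) \<in> atlas (mfd (tangent_group_at_one m G))"
    using D unfolding atlas_tangent_group_at_one by blast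
  then show "\<exists>C \<theta> E \<psi>. (C, \<theta>) \<in> atlas (mfd (tangent_group_at_one m G)) \<and> (E, \<psi>) \<in> atlas (jet_manifold m (mfd G)) \<and> A \<in> C \<and>
      smooth_rep (mdim (mfd (tangent_group_at_one m G))) C \<theta> (mdim (jet_manifold m (mfd G))) E \<psi> (\<lambda>A. A) A"
    using smooth_rep_jets_at_inclusion[OF M D] in_atlas_jet[OF D(1)] A
    unfolding tangent_group_at_one_simps jet_manifold_simps by blast
qed

text \<open>The fibre is embedded: smoothness into it can be checked in \<open>jet_manifold\<close>,
  by dropping the constant base coordinates. Together with the smooth inclusion this transfers the
  Lie group structure of \<open>tangent_group m G\<close> to the fibre.\<close>

lemma smooth_map_into_at_one:
  assumes G: "lie_group G" and P: "smooth_atlas P" and f: "smooth_map P (jet_manifold m (mfd G)) f"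
    and fx: "\<And>x. x \<in> points P \<Longrightarrow> f x \<in> jets_at m (mfd G) \<one>\<^bsub>G\<^esub>"
  shows "smooth_map P (mfd (tangent_group_at_one m G)) f"
proof (rule smooth_mapI[OF P smooth_atlas_at_one[OF G]])
  note M = lie_group_atlas[OF G]
  fix x assume x: "x \<in> points P"
  obtain C \<theta> where C: "(C, \<theta>) \<in> atlas P" "x \<in> C" using chart_exists[OF P x] .
  obtain D \<phi> where D: "(D, \<phi>) \<in> atlas (mfd G)" "\<one>\<^bsub>G\<^esub> \<in> D"
    using chart_exists[OF M curve_point[OF M curve_one[OF G]]] by blast
  have "(jets_at m (mfd G) \<one>\<^bsub>G\<^esub>, fibre_chart m (mfd G) \<phi>) \<in> atlas (mfd (tangent_group_at_one m G))"
    using D unfolding atlas_tangent_group_at_one by blast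
  moreover have "smooth_rep (mdim P) C \<theta> (Suc m * mdim (mfd G)) (jet_dom m (mfd G) D) (jet_coords m (mfd G) \<phi>) f x"
    using smooth_mapD[OF P smooth_atlas_jet[OF M] f C(1) in_atlas_jet[OF D(1)] C(2)] fx[OF x] jets_at_dom[OF D(2), of m "mfd G"]
    by auto
  then have "smooth_rep (mdim P) C \<theta> (m * mdim (mfd G)) (jets_at m (mfd G) \<one>\<^bsub>G\<^esub>) (fibre_chart m (mfd G) \<phi>) f x"
    by (rule smooth_rep_into_jets_at) (use fx chart_subset[OF P C(1)] in blast)
  ultimately show "\<exists>C \<theta> E \<psi>. (C, \<theta>) \<in> atlas P \<and> (E, \<psi>) \<in> atlas (mfd (tangent_group_at_one m G)) \<and> x \<in> C \<and>
      smooth_rep (mdim P) C \<theta> (mdim (mfd (tangent_group_at_one m G))) E \<psi> f x"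
    using C unfolding tangent_group_at_one_simps by blast
qed

lemma jets_at_mult:
  assumes G: "lie_group G" and A: "A \<in> jets_at m (mfd G) x" and B: "B \<in> jets_at m (mfd G) y"
  shows "jet_mult m G A B \<in> jets_at m (mfd G) (x \<otimes>\<^bsub>G\<^esub> y)"
proof -
  obtain p q where p: "curve (mfd G) p" "p 0 = x" "A = jet m (mfd G) p" and q: "curve (mfd G) q" "q 0 = y" "B = jet m (mfd G) q"
    using A B unfolding jets_at_def by blast
  then show ?thesis using jet_mult_jet[OF G p(1) q(1)] curve_mult[OF G p(1) q(1)] unfolding jets_at_def by auto
qed

lemma jets_at_inv:
  assumes G: "lie_group G" and A: "A \<in> jets_at m (mfd G) x"
  shows "inv\<^bsub>tangent_group m G\<^esub> A \<in> jets_at m (mfd G) (inv\<^bsub>G\<^esub> x)"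
proof -
  obtain p where p: "curve (mfd G) p" "p 0 = x" "A = jet m (mfd G) p" using A unfolding jets_at_def by blast
  then show ?thesis using inv_tangent_group[OF G p(1)] curve_inv[OF G p(1)] unfolding jets_at_def by auto
qed

lemma jets_at_subset: "jets_at m (mfd G) x \<subseteq> carrier (tangent_group m G)"
  by (auto simp: jets_at_def)

lemma jet_one_in_jets_at: "lie_group G \<Longrightarrow> jet m (mfd G) (\<lambda>_. \<one>\<^bsub>G\<^esub>) \<in> jets_at m (mfd G) \<one>\<^bsub>G\<^esub>"
  using curve_one by (auto simp: jets_at_def)

lemma group_at_one:
  assumes G: "lie_group G" shows "group (tangent_group_at_one m G)"
proof -
  interpret G: group G by (rule lie_group_group[OF G])
  interpret T: group "tangent_group m G" by (rule group_tangent_group[OF G])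
  let ?F = "jets_at m (mfd G) \<one>\<^bsub>G\<^esub>"
  have sub: "A \<in> carrier (tangent_group m G)" if "A \<in> ?F" for A using that jets_at_subset[of m G "\<one>\<^bsub>G\<^esub>"] by blast
  show ?thesis
  proof (rule groupI, unfold tangent_group_at_one_simps)
    show "jet_mult m G A B \<in> ?F" if "A \<in> ?F" "B \<in> ?F" for A B using jets_at_mult[OF G that] by simp
    show "jet m (mfd G) (\<lambda>_. \<one>\<^bsub>G\<^esub>) \<in> ?F" by (rule jet_one_in_jets_at[OF G])
    show "jet_mult m G (jet_mult m G A B) C = jet_mult m G A (jet_mult m G B C)" if "A \<in> ?F" "B \<in> ?F" "C \<in> ?F" for A B C
      using T.m_assoc[OF sub sub sub, OF that] by simp
    show "jet_mult m G (jet m (mfd G) (\<lambda>_. \<one>\<^bsub>G\<^esub>)) A = A" if "A \<in> ?F" for A using T.l_one[OF sub[OF that]] by simp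
    show "\<exists>B\<in>?F. jet_mult m G B A = jet m (mfd G) (\<lambda>_. \<one>\<^bsub>G\<^esub>)" if "A \<in> ?F" for A
      using T.l_inv[OF sub[OF that]] jets_at_inv[OF G that] by auto
  qed
qed

lemma inv_at_one:
  assumes G: "lie_group G" and A: "A \<in> jets_at m (mfd G) \<one>\<^bsub>G\<^esub>"
  shows "inv\<^bsub>tangent_group_at_one m G\<^esub> A = inv\<^bsub>tangent_group m G\<^esub> A"
proof -
  interpret G: group G by (rule lie_group_group[OF G])
  interpret T: group "tangent_group m G" by (rule group_tangent_group[OF G])
  have "A \<in> carrier (tangent_group m G)" using A jets_at_subset[of m G "\<one>\<^bsub>G\<^esub>"] by blast
  from T.l_inv[OF this] show ?thesis
    by (intro group.inv_equality[OF group_at_one[OF G]]) (use A jets_at_inv[OF G A] in auto)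
qed

lemma lie_group_at_one:
  assumes G: "lie_group G" shows "lie_group (tangent_group_at_one m G)"
  unfolding lie_group_def
proof (intro conjI)
  note M = lie_group_atlas[OF G]
  note K = smooth_atlas_at_one[OF G, of m]
  note T = lie_group_tangent_group[OF G, of m]
  note J = lie_group_atlas[OF T]
  note KK = smooth_atlas_prod[OF K K]
  interpret G: group G by (rule lie_group_group[OF G])
  let ?K = "mfd (tangent_group_at_one m G)"
  show "group (tangent_group_at_one m G)" by (rule group_at_one[OF G])
  obtain D \<phi> where D: "(D, \<phi>) \<in> atlas (mfd G)" "\<one>\<^bsub>G\<^esub> \<in> D"
    using chart_exists[OF M curve_point[OF M curve_one[OF G]]] by blast
  have c: "(jets_at m (mfd G) \<one>\<^bsub>G\<^esub>, fibre_chart m (mfd G) \<phi>) \<in> atlas ?K"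
    using D unfolding atlas_tangent_group_at_one by blast
  \<comment> \<open>A single chart covers the fibre, so any two of its points can be separated
    there.\<close>
  have "Hausdorff_space (mtop ?K)"
    unfolding Hausdorff_space_def topspace_mtop[OF K] using separated_in_chart[OF K c] by simp
  then show "smooth_manifold ?K" using K by (simp add: smooth_manifold_iff)
  show "points ?K = carrier (tangent_group_at_one m G)" by simp
  have incl: "smooth_map ?K (mfd (tangent_group m G)) (\<lambda>A. A)" using smooth_map_at_one_inclusion[OF G] by simp
  have "smooth_map (prod_manifold ?K ?K) (mfd (tangent_group m G)) (\<lambda>X. fst X \<otimes>\<^bsub>tangent_group m G\<^esub> snd X)"
    by (rule smooth_map_mult[OF T KK smooth_map_compose[OF KK K J smooth_map_fst[OF K K] incl]
        smooth_map_compose[OF KK K J smooth_map_snd[OF K K] incl]])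
  then have "smooth_map (prod_manifold ?K ?K) ?K (\<lambda>X. jet_mult m G (fst X) (snd X))"
    by (intro smooth_map_into_at_one[OF G KK]) (use jets_at_mult[OF G] in fastforce)+
  then show "smooth_map (prod_manifold ?K ?K) ?K (\<lambda>(x, y). x \<otimes>\<^bsub>tangent_group_at_one m G\<^esub> y)"
    by (simp add: case_prod_beta')
  have "smooth_map ?K (mfd (tangent_group m G)) (\<lambda>A. inv\<^bsub>tangent_group m G\<^esub> A)"
    by (rule smooth_map_inv[OF T K incl])
  then have "smooth_map ?K ?K (\<lambda>A. inv\<^bsub>tangent_group m G\<^esub> A)"
    by (intro smooth_map_into_at_one[OF G K]) (use jets_at_inv[OF G] in fastforce)+
  then show "smooth_map ?K ?K (\<lambda>x. inv\<^bsub>tangent_group_at_one m G\<^esub> x)"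
    by (rule smooth_map_cong[OF K K]) (use inv_at_one[OF G] in simp)
qed

section \<open>Factorizations of Lie groups\<close>

text \<open>
  The mutual actions come from factoring \<open>p h \<otimes> i k\<close> in the opposite order.
\<close>

lemma double_cross_product_factorization:
  fixes L :: "'l lie" and K :: "'k lie" and H :: "'h lie"
  assumes L: "lie_group L" and K: "lie_group K" and H: "lie_group H"
    and i: "i \<in> hom K L" "smooth_map (mfd K) (mfd L) i"
    and p: "p \<in> hom H L" "smooth_map (mfd H) (mfd L) p"
    and a: "smooth_map (mfd L) (mfd K) a" and b: "smooth_map (mfd L) (mfd H) b"
    and fac: "\<And>w. w \<in> carrier L \<Longrightarrow> i (a w) \<otimes>\<^bsub>L\<^esub> p (b w) = w"
    and a_eq: "\<And>k h. k \<in> carrier K \<Longrightarrow> h \<in> carrier H \<Longrightarrow> a (i k \<otimes>\<^bsub>L\<^esub> p h) = k"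
    and b_eq: "\<And>k h. k \<in> carrier K \<Longrightarrow> h \<in> carrier H \<Longrightarrow> b (i k \<otimes>\<^bsub>L\<^esub> p h) = h"
  defines "lact \<equiv> \<lambda>h k. a (p h \<otimes>\<^bsub>L\<^esub> i k)" and "ract \<equiv> \<lambda>h k. b (p h \<otimes>\<^bsub>L\<^esub> i k)"
    and "\<Phi> \<equiv> \<lambda>(k, h). i k \<otimes>\<^bsub>L\<^esub> p h"
  shows "mutual_actions K H lact ract" and "lie_group_iso (double_cross_product K H lact ract) L \<Phi>"
proof -
  interpret L: group L by (rule lie_group_group[OF L])
  interpret K: group K by (rule lie_group_group[OF K])
  interpret H: group H by (rule lie_group_group[OF H])
  note aL = lie_group_atlas[OF L] and aK = lie_group_atlas[OF K] and aH = lie_group_atlas[OF H]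
  note aKH = smooth_atlas_prod[OF aK aH] and aHK = smooth_atlas_prod[OF aH aK]
  have [simp]: "i k \<in> carrier L" if "k \<in> carrier K" for k using i(1) that by (auto simp: hom_def)
  have [simp]: "p h \<in> carrier L" if "h \<in> carrier H" for h using p(1) that by (auto simp: hom_def)
  have [simp]: "a w \<in> carrier K" if "w \<in> carrier L" for w
    using smooth_map_points[OF aL aK a] lie_group_points[OF L] lie_group_points[OF K] that by simp
  have [simp]: "b w \<in> carrier H" if "w \<in> carrier L" for w
    using smooth_map_points[OF aL aH b] lie_group_points[OF L] lie_group_points[OF H] that by simp
  have i_mult: "i (k \<otimes>\<^bsub>K\<^esub> k') = i k \<otimes>\<^bsub>L\<^esub> i k'" if "k \<in> carrier K" "k' \<in> carrier K" for k k'
    using i(1) that by (auto simp: hom_def)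
  have p_mult: "p (h \<otimes>\<^bsub>H\<^esub> h') = p h \<otimes>\<^bsub>L\<^esub> p h'" if "h \<in> carrier H" "h' \<in> carrier H" for h h'
    using p(1) that by (auto simp: hom_def)
  have i_one: "i \<one>\<^bsub>K\<^esub> = \<one>\<^bsub>L\<^esub>" by (rule hom_one[OF i(1) K.is_group L.is_group])
  have p_one: "p \<one>\<^bsub>H\<^esub> = \<one>\<^bsub>L\<^esub>" by (rule hom_one[OF p(1) H.is_group L.is_group])
  have lr [simp]: "lact h k \<in> carrier K" "ract h k \<in> carrier H" if "h \<in> carrier H" "k \<in> carrier K" for h k
    using that by (simp_all add: lact_def ract_def)
  have swap: "p h \<otimes>\<^bsub>L\<^esub> i k = i (lact h k) \<otimes>\<^bsub>L\<^esub> p (ract h k)" if "h \<in> carrier H" "k \<in> carrier K" for h k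
    using fac[of "p h \<otimes>\<^bsub>L\<^esub> i k"] that by (simp add: lact_def ract_def)
  have lactI: "lact h k = k'" and ractI: "ract h k = h'"
    if "p h \<otimes>\<^bsub>L\<^esub> i k = i k' \<otimes>\<^bsub>L\<^esub> p h'" "k' \<in> carrier K" "h' \<in> carrier H" for h k h' k'
    using that by (simp_all add: lact_def ract_def a_eq b_eq)
  \<comment> \<open>Here \<open>i k\<close> is moved through a product of two elements of
    \<open>H\<close>. Comparing the unique factors gives at once that \<open>lact\<close> is an
    action and how \<open>ract\<close> treats products; \<open>K2\<close> does the same with the
    roles of the groups exchanged.\<close>
  have H2: "p (h\<^sub>1 \<otimes>\<^bsub>H\<^esub> h\<^sub>2) \<otimes>\<^bsub>L\<^esub> i k = i (lact h\<^sub>1 (lact h\<^sub>2 k)) \<otimes>\<^bsub>L\<^esub> p (ract h\<^sub>1 (lact h\<^sub>2 k) \<otimes>\<^bsub>H\<^esub> ract h\<^sub>2 k)"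
    if h: "h\<^sub>1 \<in> carrier H" "h\<^sub>2 \<in> carrier H" "k \<in> carrier K" for h\<^sub>1 h\<^sub>2 k
  proof -
    have "p (h\<^sub>1 \<otimes>\<^bsub>H\<^esub> h\<^sub>2) \<otimes>\<^bsub>L\<^esub> i k = p h\<^sub>1 \<otimes>\<^bsub>L\<^esub> i (lact h\<^sub>2 k) \<otimes>\<^bsub>L\<^esub> p (ract h\<^sub>2 k)"
      using h by (simp add: p_mult L.m_assoc swap[of h\<^sub>2 k])
    also have "\<dots> = i (lact h\<^sub>1 (lact h\<^sub>2 k)) \<otimes>\<^bsub>L\<^esub> p (ract h\<^sub>1 (lact h\<^sub>2 k)) \<otimes>\<^bsub>L\<^esub> p (ract h\<^sub>2 k)"
      using h by (simp add: swap[of h\<^sub>1 "lact h\<^sub>2 k"])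
    finally show ?thesis using h by (simp add: p_mult L.m_assoc)
  qed
  have K2: "p h \<otimes>\<^bsub>L\<^esub> i (k\<^sub>1 \<otimes>\<^bsub>K\<^esub> k\<^sub>2) = i (lact h k\<^sub>1 \<otimes>\<^bsub>K\<^esub> lact (ract h k\<^sub>1) k\<^sub>2) \<otimes>\<^bsub>L\<^esub> p (ract (ract h k\<^sub>1) k\<^sub>2)"
    if h: "h \<in> carrier H" "k\<^sub>1 \<in> carrier K" "k\<^sub>2 \<in> carrier K" for h k\<^sub>1 k\<^sub>2
  proof -
    have "p h \<otimes>\<^bsub>L\<^esub> i (k\<^sub>1 \<otimes>\<^bsub>K\<^esub> k\<^sub>2) = p h \<otimes>\<^bsub>L\<^esub> i k\<^sub>1 \<otimes>\<^bsub>L\<^esub> i k\<^sub>2"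
      using h by (simp add: i_mult L.m_assoc)
    also have "\<dots> = i (lact h k\<^sub>1) \<otimes>\<^bsub>L\<^esub> (p (ract h k\<^sub>1) \<otimes>\<^bsub>L\<^esub> i k\<^sub>2)"
      using h by (simp add: swap[of h k\<^sub>1] L.m_assoc)
    also have "\<dots> = i (lact h k\<^sub>1) \<otimes>\<^bsub>L\<^esub> (i (lact (ract h k\<^sub>1) k\<^sub>2) \<otimes>\<^bsub>L\<^esub> p (ract (ract h k\<^sub>1) k\<^sub>2))"
      using h by (simp add: swap[of "ract h k\<^sub>1" k\<^sub>2])
    finally show ?thesis using h by (simp add: i_mult L.m_assoc)
  qed
  have sw: "smooth_map (prod_manifold (mfd H) (mfd K)) (mfd L) (\<lambda>x. p (fst x) \<otimes>\<^bsub>L\<^esub> i (snd x))"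
    by (rule smooth_map_mult[OF L aHK smooth_map_compose[OF aHK aH aL smooth_map_fst[OF aH aK] p(2)]
        smooth_map_compose[OF aHK aK aL smooth_map_snd[OF aH aK] i(2)]])
  show "mutual_actions K H lact ract"
    unfolding mutual_actions_def
  proof (intro conjI ballI K H)
    show "smooth_map (prod_manifold (mfd H) (mfd K)) (mfd K) (\<lambda>(h, k). lact h k)"
      using smooth_map_compose[OF aHK aL aK sw a] by (simp add: lact_def case_prod_beta')
    show "smooth_map (prod_manifold (mfd H) (mfd K)) (mfd H) (\<lambda>(h, k). ract h k)"
      using smooth_map_compose[OF aHK aL aH sw b] by (simp add: ract_def case_prod_beta')
  qed (auto intro!: lactI ractI simp: H2 K2 i_one p_one)
  define \<Psi> where "\<Psi> w = (a w, b w)" for w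
  let ?D = "double_cross_product K H lact ract"
  have D: "carrier ?D = carrier K \<times> carrier H" "mfd ?D = prod_manifold (mfd K) (mfd H)" "\<one>\<^bsub>?D\<^esub> = (\<one>\<^bsub>K\<^esub>, \<one>\<^bsub>H\<^esub>)"
    by (simp_all add: double_cross_product_def)
  have m: "x \<otimes>\<^bsub>?D\<^esub> y = (fst x \<otimes>\<^bsub>K\<^esub> lact (snd x) (fst y), ract (snd x) (fst y) \<otimes>\<^bsub>H\<^esub> snd y)" for x y
    by (simp add: double_cross_product_def case_prod_beta)
  have \<Phi>_in: "\<Phi> x \<in> carrier L" if "x \<in> carrier ?D" for x using that by (auto simp: D \<Phi>_def)
  have \<Psi>_in: "\<Psi> w \<in> carrier ?D" if "w \<in> carrier L" for w using that by (simp add: D \<Psi>_def)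
  have \<Phi>\<Psi>: "\<Phi> (\<Psi> w) = w" if "w \<in> carrier L" for w using that by (simp add: \<Phi>_def \<Psi>_def fac)
  have \<Psi>\<Phi>: "\<Psi> (\<Phi> x) = x" if "x \<in> carrier ?D" for x using that by (auto simp: \<Phi>_def \<Psi>_def D a_eq b_eq)
  have m_in: "x \<otimes>\<^bsub>?D\<^esub> y \<in> carrier ?D" if "x \<in> carrier ?D" "y \<in> carrier ?D" for x y
    using that by (auto simp: D m)
  have \<Phi>_mult: "\<Phi> (x \<otimes>\<^bsub>?D\<^esub> y) = \<Phi> x \<otimes>\<^bsub>L\<^esub> \<Phi> y" if xy: "x \<in> carrier ?D" "y \<in> carrier ?D" for x y
  proof -
    obtain k h k' h' where x: "x = (k, h)" "k \<in> carrier K" "h \<in> carrier H" and y: "y = (k', h')" "k' \<in> carrier K" "h' \<in> carrier H"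
      using xy by (auto simp: D)
    have "\<Phi> x \<otimes>\<^bsub>L\<^esub> \<Phi> y = i k \<otimes>\<^bsub>L\<^esub> (p h \<otimes>\<^bsub>L\<^esub> i k') \<otimes>\<^bsub>L\<^esub> p h'" using x y by (simp add: \<Phi>_def L.m_assoc)
    also have "\<dots> = \<Phi> (x \<otimes>\<^bsub>?D\<^esub> y)" using x y by (simp add: swap \<Phi>_def m i_mult p_mult L.m_assoc)
    finally show ?thesis by simp
  qed
  have m_eq: "x \<otimes>\<^bsub>?D\<^esub> y = \<Psi> (\<Phi> x \<otimes>\<^bsub>L\<^esub> \<Phi> y)" if "x \<in> carrier ?D" "y \<in> carrier ?D" for x y
    using \<Psi>\<Phi>[OF m_in[OF that]] \<Phi>_mult[OF that] by simp
  have \<Phi>_one: "\<Phi> \<one>\<^bsub>?D\<^esub> = \<one>\<^bsub>L\<^esub>" by (simp add: D \<Phi>_def i_one p_one)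
  have one_in: "\<one>\<^bsub>?D\<^esub> \<in> carrier ?D" by (simp add: D)
  \<comment> \<open>The group laws are transported from \<open>L\<close> along the bijection
    \<open>\<Phi>\<close>, \<open>m_eq\<close> being the transported product.\<close>
  have gD: "group ?D"
  proof (rule groupI)
    show "x \<otimes>\<^bsub>?D\<^esub> y \<otimes>\<^bsub>?D\<^esub> z = x \<otimes>\<^bsub>?D\<^esub> (y \<otimes>\<^bsub>?D\<^esub> z)" if "x \<in> carrier ?D" "y \<in> carrier ?D" "z \<in> carrier ?D" for x y z
      using that by (simp add: m_eq[OF m_in] m_eq[OF _ m_in] \<Phi>_mult L.m_assoc \<Phi>_in)
    show "\<one>\<^bsub>?D\<^esub> \<otimes>\<^bsub>?D\<^esub> x = x" if "x \<in> carrier ?D" for x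
      unfolding m_eq[OF one_in that] \<Phi>_one L.l_one[OF \<Phi>_in[OF that]] by (rule \<Psi>\<Phi>[OF that])
    show "\<exists>y\<in>carrier ?D. y \<otimes>\<^bsub>?D\<^esub> x = \<one>\<^bsub>?D\<^esub>" if "x \<in> carrier ?D" for x
    proof
      show inv_in: "\<Psi> (inv\<^bsub>L\<^esub> (\<Phi> x)) \<in> carrier ?D" using \<Phi>_in[OF that] by (intro \<Psi>_in) simp
      have "\<Psi> (inv\<^bsub>L\<^esub> (\<Phi> x)) \<otimes>\<^bsub>?D\<^esub> x = \<Psi> (\<Phi> \<one>\<^bsub>?D\<^esub>)"
        unfolding m_eq[OF inv_in that] \<Phi>_one using \<Phi>_in[OF that] by (simp add: \<Phi>\<Psi>)
      then show "\<Psi> (inv\<^bsub>L\<^esub> (\<Phi> x)) \<otimes>\<^bsub>?D\<^esub> x = \<one>\<^bsub>?D\<^esub>" unfolding \<Psi>\<Phi>[OF one_in] .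
    qed
  qed (use m_in one_in in auto)
  interpret D: group ?D by (rule gD)
  have inv_eq: "inv\<^bsub>?D\<^esub> x = \<Psi> (inv\<^bsub>L\<^esub> (\<Phi> x))" if "x \<in> carrier ?D" for x
  proof (rule D.inv_equality[OF _ that])
    show inv_in: "\<Psi> (inv\<^bsub>L\<^esub> (\<Phi> x)) \<in> carrier ?D" using \<Phi>_in[OF that] by (intro \<Psi>_in) simp
    have "\<Psi> (inv\<^bsub>L\<^esub> (\<Phi> x)) \<otimes>\<^bsub>?D\<^esub> x = \<Psi> (\<Phi> \<one>\<^bsub>?D\<^esub>)"
      unfolding m_eq[OF inv_in that] \<Phi>_one using \<Phi>_in[OF that] by (simp add: \<Phi>\<Psi>)
    then show "\<Psi> (inv\<^bsub>L\<^esub> (\<Phi> x)) \<otimes>\<^bsub>?D\<^esub> x = \<one>\<^bsub>?D\<^esub>" unfolding \<Psi>\<Phi>[OF one_in] .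
  qed
  have s\<Phi>: "smooth_map (mfd ?D) (mfd L) \<Phi>"
    using smooth_map_mult[OF L aKH smooth_map_compose[OF aKH aK aL smooth_map_fst[OF aK aH] i(2)]
        smooth_map_compose[OF aKH aH aL smooth_map_snd[OF aK aH] p(2)]] by (simp add: D \<Phi>_def case_prod_beta')
  have s\<Psi>: "smooth_map (mfd L) (mfd ?D) \<Psi>"
    unfolding D \<Psi>_def by (rule smooth_map_Pair[OF aK aH aL a b])
  have aD: "smooth_atlas (mfd ?D)" using aKH by (simp add: D)
  note aDD = smooth_atlas_prod[OF aD aD]
  have pD: "points (mfd ?D) = carrier ?D" using lie_group_points[OF K] lie_group_points[OF H] by (simp add: D)
  have lD: "lie_group ?D"
    unfolding lie_group_def
  proof (intro conjI gD pD)
    show "smooth_manifold (mfd ?D)" using smooth_manifold_prod[OF lie_group_manifold[OF K] lie_group_manifold[OF H]] by (simp add: D)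
    have "smooth_map (prod_manifold (mfd ?D) (mfd ?D)) (mfd L) (\<lambda>x. \<Phi> (fst x) \<otimes>\<^bsub>L\<^esub> \<Phi> (snd x))"
      by (rule smooth_map_mult[OF L aDD smooth_map_compose[OF aDD aD aL smooth_map_fst[OF aD aD] s\<Phi>]
          smooth_map_compose[OF aDD aD aL smooth_map_snd[OF aD aD] s\<Phi>]])
    from smooth_map_compose[OF aDD aL aD this s\<Psi>]
    show "smooth_map (prod_manifold (mfd ?D) (mfd ?D)) (mfd ?D) (\<lambda>(x, y). x \<otimes>\<^bsub>?D\<^esub> y)"
      by (rule smooth_map_cong[OF aDD aD]) (auto simp: pD m_eq)
    from smooth_map_compose[OF aD aL aD smooth_map_inv[OF L aD s\<Phi>] s\<Psi>]
    show "smooth_map (mfd ?D) (mfd ?D) (m_inv ?D)"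
      by (rule smooth_map_cong[OF aD aD]) (simp add: pD inv_eq)
  qed
  have bij: "bij_betw \<Phi> (carrier ?D) (carrier L)"
    by (rule bij_betw_byWitness[where f' = \<Psi>]) (use \<Psi>\<Phi> \<Phi>\<Psi> \<Phi>_in \<Psi>_in in blast)+
  show "lie_group_iso ?D L \<Phi>"
    unfolding lie_group_iso_def
  proof (intro conjI lD L s\<Phi>)
    show "\<Phi> \<in> iso ?D L" using bij \<Phi>_in \<Phi>_mult by (auto simp: iso_def hom_def)
    show "smooth_map (mfd L) (mfd ?D) (inv_into (carrier ?D) \<Phi>)"
    proof (rule smooth_map_cong[OF aL aD s\<Psi>])
      fix w assume "w \<in> points (mfd L)"
      then have w: "w \<in> carrier L" using lie_group_points[OF L] by simp
      then show "\<Psi> w = inv_into (carrier ?D) \<Phi> w"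
        using inv_into_f_f[OF bij_betw_imp_inj_on[OF bij] \<Psi>_in[OF w]] \<Phi>\<Psi>[OF w] by simp
    qed
  qed
qed

section \<open>Prolongations and the zero section\<close>

lemma eventually_shift:
  fixes P :: "real \<Rightarrow> bool"
  assumes "\<forall>\<^sub>F t in nhds 0. P t" shows "\<forall>\<^sub>F s in nhds 0. \<forall>\<^sub>F t in nhds 0. P (s + t)"
proof -
  obtain \<epsilon> where \<epsilon>: "\<epsilon> > 0" "\<And>t. \<bar>t\<bar> < \<epsilon> \<Longrightarrow> P t" using assms by (auto simp: eventually_nhds_0_real)
  have "\<forall>\<^sub>F t in nhds 0. P (s + t)" if "\<bar>s\<bar> < \<epsilon>" for s
    unfolding eventually_nhds_0_real by (rule exI[of _ "\<epsilon> - \<bar>s\<bar>"]) (use that \<epsilon> in auto)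
  then show ?thesis using \<epsilon>(1) unfolding eventually_nhds_0_real[of "\<lambda>s. \<forall>\<^sub>F t in nhds 0. P (s + t)"] by blast
qed

lemma higher_deriv_shift: "(deriv ^^ k) (\<lambda>t. f (s + t)) = (\<lambda>t. (deriv ^^ k) (f :: real \<Rightarrow> real) (s + t))"
proof
  fix u
  have "(deriv ^^ k) (\<lambda>t. f (s + t)) u = (deriv ^^ k) (\<lambda>t. f (s + (u + t))) 0"
    by (rule sgerm_shift_deriv[symmetric])
  also have "\<dots> = (deriv ^^ k) f (s + u)" using sgerm_shift_deriv[of k f "s + u"] by (simp add: add.assoc)
  finally show "(deriv ^^ k) (\<lambda>t. f (s + t)) u = (deriv ^^ k) f (s + u)" .
qed

lemma sgerm_shift: "sgerm f \<Longrightarrow> \<forall>\<^sub>F s in nhds 0. sgerm (\<lambda>t. f (s + t))"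
proof -
  assume "sgerm f"
  then have "\<forall>\<^sub>F s in nhds 0. \<forall>\<^sub>F t in nhds 0. \<forall>k. (deriv ^^ k) f field_differentiable at (s + t)"
    unfolding sgerm_def by (rule eventually_shift)
  moreover have "(\<lambda>t. (deriv ^^ k) f (s + t)) field_differentiable at t" if "(deriv ^^ k) f field_differentiable at (s + t)" for k s t
    using that DERIV_shift[of "(deriv ^^ k) f" _ t s] unfolding field_differentiable_def by (auto simp: add.commute)
  ultimately show ?thesis unfolding sgerm_def higher_deriv_shift by (auto elim!: eventually_mono)
qed

lemma sgerm_higher_deriv: "sgerm f \<Longrightarrow> sgerm ((deriv ^^ k) f)"
  by (induction k) (auto intro: sgerm_deriv)

lemma curve_in_shift:
  assumes p: "curve_in d D \<phi> p" shows "\<forall>\<^sub>F s in nhds 0. curve_in d D \<phi> (\<lambda>t. p (s + t))"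
proof -
  have "\<forall>\<^sub>F s in nhds 0. \<forall>\<^sub>F t in nhds 0. p (s + t) \<in> D"
    by (rule eventually_shift) (use p in \<open>simp add: curve_in_def\<close>)
  moreover have "\<forall>\<^sub>F s in nhds 0. \<forall>j\<in>{..<d}. sgerm (\<lambda>t. \<phi> (p (s + t)) j)"
    by (intro eventually_ball_finite ballI sgerm_shift) (use p in \<open>auto simp: curve_in_def\<close>)
  ultimately show ?thesis by eventually_elim (simp add: curve_in_def)
qed

definition shift_jets :: "nat \<Rightarrow> 'a manifold \<Rightarrow> (real \<Rightarrow> 'a) \<Rightarrow> real \<Rightarrow> (real \<Rightarrow> 'a) set" where
  "shift_jets m M p = (\<lambda>s. jet m M (\<lambda>t. p (s + t)))"

lemma shift_jets_0: "shift_jets m M p 0 = jet m M p"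
  by (simp add: shift_jets_def)

text \<open>For \<open>p(s + t)\<close> the derivative of order \<open>k\<close> in \<open>t\<close>
  at \<open>t = 0\<close> is \<open>p^(k)(s)\<close>, so \<open>l\<close> further derivatives in
  \<open>s\<close> produce order \<open>l + k\<close>. A first-order jet in \<open>s\<close>
  therefore sees precisely the \<open>Suc m\<close>-jet of \<open>p\<close>.\<close>

lemma
  assumes M: "smooth_atlas M" and D: "(D, \<phi>) \<in> atlas M" and p: "curve_in (mdim M) D \<phi> p"
  shows curve_in_shift_jets: "curve_in (Suc m * mdim M) (jet_dom m M D) (jet_coords m M \<phi>) (shift_jets m M p)"
    and curve_shift_jets: "curve (jet_manifold m M) (shift_jets m M p)"
    and cderiv_shift_jets: "i < Suc m * mdim M \<Longrightarrow> cderiv l (jet_coords m M \<phi>) (shift_jets m M p) i =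
      cderiv (l + i div mdim M) \<phi> p (i mod mdim M)"
proof -
  note ev = curve_in_shift[OF p]
  from ev have coords: "\<forall>\<^sub>F s in nhds 0. jet_coords m M \<phi> (shift_jets m M p s) =
      (\<lambda>i. if i < Suc m * mdim M then (deriv ^^ (i div mdim M)) (\<lambda>t. \<phi> (p t) (i mod mdim M)) s else 0)"
  proof eventually_elim
    case (elim s)
    note c = curve_inI[OF D elim] curve_in_0[OF elim]
    show ?case unfolding shift_jets_def jet_coords_jet[OF M c(1) D c(2)]
      by (simp only: sgerm_shift_deriv[of _ "\<lambda>t. \<phi> (p t) _"])
  qed
  have comp: "\<forall>\<^sub>F s in nhds 0. (deriv ^^ (i div mdim M)) (\<lambda>t. \<phi> (p t) (i mod mdim M)) s = jet_coords m M \<phi> (shift_jets m M p s) i"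
    if "i < Suc m * mdim M" for i
    using coords by eventually_elim (use that in simp)
  show cin: "curve_in (Suc m * mdim M) (jet_dom m M D) (jet_coords m M \<phi>) (shift_jets m M p)"
    unfolding curve_in_def
  proof (intro conjI allI impI)
    from ev show "\<forall>\<^sub>F s in nhds 0. shift_jets m M p s \<in> jet_dom m M D"
      by eventually_elim (unfold shift_jets_def, intro jet_in_dom curve_inI[OF D] curve_in_0)
    fix i assume i: "i < Suc m * mdim M"
    have "sgerm (\<lambda>t. \<phi> (p t) (i mod mdim M))" using p jet_index'(2)[OF i] by (simp add: curve_in_def)
    then show "sgerm (\<lambda>s. jet_coords m M \<phi> (shift_jets m M p s) i)"
      by (rule sgerm_ev_cong[OF comp[OF i] sgerm_higher_deriv])
  qed
  show "curve (jet_manifold m M) (shift_jets m M p)"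
    by (rule curve_inI[OF in_atlas_jet[OF D]]) (use cin in simp)
  show "cderiv l (jet_coords m M \<phi>) (shift_jets m M p) i = cderiv (l + i div mdim M) \<phi> p (i mod mdim M)"
    if "i < Suc m * mdim M"
    using higher_deriv_ev_cong[OF comp[OF that], of l] by (simp add: funpow_add)
qed

lemma prolongation_jet:
  assumes M: "smooth_atlas (mfd G)" and p: "curve (mfd G) p"
  shows "prolongation (Suc m) G (jet (Suc m) (mfd G) p) = jet 1 (jet_manifold m (mfd G)) (shift_jets m (mfd G) p)"
proof -
  let ?M = "mfd G"
  obtain D \<phi> where D: "(D, \<phi>) \<in> atlas ?M" "p 0 \<in> D" using chart_exists[OF M curve_point[OF M p]] .
  note J = smooth_atlas_jet[OF M, of m]
  have "jet 1 (jet_manifold m ?M) (shift_jets m ?M q) = jet 1 (jet_manifold m ?M) (shift_jets m ?M p)"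
    if q: "q \<in> jet (Suc m) ?M p" for q
  proof -
    have s: "curve ?M q" "same_jet (Suc m) (mdim ?M) \<phi> q p" using q jet_iff[OF M p D] by blast+
    then have q0: "q 0 \<in> D" using D by (simp add: same_jet_def)
    have "same_jet m (mdim ?M) \<phi> q p" using s(2) by (simp add: same_jet_def)
    then have e: "jet m ?M q = jet m ?M p" using jet_eq_iff[OF M s(1) p D(1) q0] by blast
    note cp = curve_in_chart[OF M p D] and cq = curve_in_chart[OF M s(1) D(1) q0]
    have "same_jet 1 (Suc m * mdim ?M) (jet_coords m ?M \<phi>) (shift_jets m ?M q) (shift_jets m ?M p)"
      unfolding same_jet_def shift_jets_0
    proof (intro conjI e allI impI)
      fix l i assume l: "l \<le> (1::nat)" and i: "i < Suc m * mdim ?M"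
      have "l + i div mdim ?M \<le> Suc m" using l jet_index'(1)[OF i] by simp
      then show "cderiv l (jet_coords m ?M \<phi>) (shift_jets m ?M q) i = cderiv l (jet_coords m ?M \<phi>) (shift_jets m ?M p) i"
        unfolding cderiv_shift_jets[OF M D(1) cp i] cderiv_shift_jets[OF M D(1) cq i]
        using s(2) jet_index'(2)[OF i] by (simp add: same_jet_def)
    qed
    then show ?thesis
      using jet_eq_iff[OF J curve_shift_jets[OF M D(1) cq] curve_shift_jets[OF M D(1) cp] in_atlas_jet[OF D(1)], of 1]
        curve_in_0[OF curve_in_shift_jets[OF M D(1) cq]] by simp
  qed
  moreover have "prolongation (Suc m) G A = (\<Union>p\<in>A. jet 1 (jet_manifold m ?M) (shift_jets m ?M p))" for A
    by (simp add: prolongation_def shift_jets_def)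
  ultimately show ?thesis using jet_self[OF M p, of "Suc m"] by blast
qed

lemma curve_shift_jets':
  assumes M: "smooth_atlas M" and p: "curve M p"
  shows "curve (jet_manifold m M) (shift_jets m M p)"
proof -
  obtain D \<phi> where D: "(D, \<phi>) \<in> atlas M" "p 0 \<in> D" using chart_exists[OF M curve_point[OF M p]] .
  show ?thesis by (rule curve_shift_jets[OF M D(1) curve_in_chart[OF M p D]])
qed

lemma eventually_shift_curve:
  assumes M: "smooth_atlas M" and p: "curve M p"
  shows "\<forall>\<^sub>F s in nhds 0. curve M (\<lambda>t. p (s + t))"
proof -
  obtain D \<phi> where D: "(D, \<phi>) \<in> atlas M" "p 0 \<in> D" using chart_exists[OF M curve_point[OF M p]] .
  from curve_in_shift[OF curve_in_chart[OF M p D]] show ?thesis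
    by eventually_elim (rule curve_inI[OF D(1)])
qed

lemma smooth_map_prolongation:
  assumes M: "smooth_atlas (mfd G)"
  shows "smooth_map (jet_manifold (Suc m) (mfd G)) (jet_manifold 1 (jet_manifold m (mfd G))) (prolongation (Suc m) G)"
proof -
  let ?M = "mfd G" let ?d = "mdim ?M" let ?e = "Suc m * ?d"
  note J = smooth_atlas_jet[OF M, of m]
  note JJ = smooth_atlas_jet[OF J, of 1]
  show ?thesis
  proof (rule smooth_mapI[OF smooth_atlas_jet[OF M] JJ])
    fix A assume "A \<in> points (jet_manifold (Suc m) ?M)"
    then obtain p where p: "curve ?M p" "A = jet (Suc m) ?M p" by auto
    obtain D \<phi> where D: "(D, \<phi>) \<in> atlas ?M" "p 0 \<in> D" using chart_exists[OF M curve_point[OF M p(1)]] .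
    have "smooth_rep (Suc (Suc m) * ?d) (jet_dom (Suc m) ?M D) (jet_coords (Suc m) ?M \<phi>)
       (Suc 1 * ?e) (jet_dom 1 (jet_manifold m ?M) (jet_dom m ?M D)) (jet_coords 1 (jet_manifold m ?M) (jet_coords m ?M \<phi>))
       (prolongation (Suc m) G) A"
    \<comment> \<open>The coordinates of the prolongation are among those of the jet, with
      repetitions: the entry for order \<open>l = i div ?e\<close> in \<open>s\<close> and order
      \<open>k = (i mod ?e) div ?d\<close> in \<open>t\<close> is taken from block
      \<open>l + k\<close>.\<close>
    proof (rule smooth_repI[where U = "esp (Suc (Suc m) * ?d)" and
          g = "\<lambda>u i. u ((i div ?e + (i mod ?e) div ?d) * ?d + (i mod ?e) mod ?d)"])
      fix B assume "B \<in> jet_dom (Suc m) ?M D"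
      then obtain q where q: "curve ?M q" "q 0 \<in> D" "B = jet (Suc m) ?M q" unfolding jet_dom_def by blast
      note cq = curve_in_chart[OF M q(1) D(1) q(2)]
      note cs = curve_in_shift_jets[OF M D(1) cq, of m] and cs' = curve_shift_jets[OF M D(1) cq, of m]
      show "prolongation (Suc m) G B \<in> jet_dom 1 (jet_manifold m ?M) (jet_dom m ?M D)"
        unfolding q(3) prolongation_jet[OF M q(1)] by (rule jet_in_dom[OF cs' curve_in_0[OF cs]])
      show "jet_coords 1 (jet_manifold m ?M) (jet_coords m ?M \<phi>) (prolongation (Suc m) G B) \<in> esp (Suc 1 * ?e)"
        using jet_coords_esp[of 1 "jet_manifold m ?M"] by simp
      fix i assume i: "i < Suc 1 * ?e"
      note i' = jet_index'[OF i]
      note i'' = jet_index'[OF i'(2)]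
      have l: "i div ?e + (i mod ?e) div ?d \<le> Suc m" using i'(1) i''(1) by simp
      have "jet_coords 1 (jet_manifold m ?M) (jet_coords m ?M \<phi>) (prolongation (Suc m) G B) i =
          cderiv (i div ?e) (jet_coords m ?M \<phi>) (shift_jets m ?M q) (i mod ?e)"
        using jet_coords_at[OF J cs' in_atlas_jet[OF D(1)] curve_in_0[OF cs] i'(1), of "i mod ?e"] i'(2,3)
        unfolding q(3) prolongation_jet[OF M q(1)] by simp
      also have "\<dots> = jet_coords (Suc m) ?M \<phi> B ((i div ?e + (i mod ?e) div ?d) * ?d + (i mod ?e) mod ?d)"
        unfolding cderiv_shift_jets[OF M D(1) cq i'(2)] q(3) jet_coords_at[OF M q(1) D(1) q(2) l i''(2)] ..
      finally show "jet_coords 1 (jet_manifold m ?M) (jet_coords m ?M \<phi>) (prolongation (Suc m) G B) i =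
          jet_coords (Suc m) ?M \<phi> B ((i div ?e + (i mod ?e) div ?d) * ?d + (i mod ?e) mod ?d)" .
    qed (rule openin_topspace jet_coords_esp C_infinity_on_proj)+
    then show "\<exists>C \<theta> E \<psi>. (C, \<theta>) \<in> atlas (jet_manifold (Suc m) ?M) \<and> (E, \<psi>) \<in> atlas (jet_manifold 1 (jet_manifold m ?M)) \<and> A \<in> C \<and>
      smooth_rep (mdim (jet_manifold (Suc m) ?M)) C \<theta> (mdim (jet_manifold 1 (jet_manifold m ?M))) E \<psi> (prolongation (Suc m) G) A"
      using in_atlas_jet[OF D(1), of "Suc m"] in_atlas_jet[OF in_atlas_jet[OF D(1)], of 1 m] jet_in_dom[OF p(1) D(2), of "Suc m"] p(2)
      unfolding jet_manifold_simps by blast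
  qed
qed

text \<open>For small \<open>s\<close> the shifted curves are again curves, so their product passes
  to \<open>m\<close>-jets; agreement for small \<open>s\<close> is enough by
  \<open>jet_germ_cong\<close>.\<close>

lemma prolongation_hom:
  assumes G: "lie_group G"
  shows "prolongation (Suc m) G \<in> hom (tangent_group (Suc m) G) (tangent_group 1 (tangent_group m G))"
proof (rule homI)
  note M = lie_group_atlas[OF G]
  note T = lie_group_tangent_group[OF G, of m]
  note J = smooth_atlas_jet[OF M, of m]
  fix A B assume "A \<in> carrier (tangent_group (Suc m) G)"
  then obtain p where p: "curve (mfd G) p" "A = jet (Suc m) (mfd G) p" by auto
  note cp = curve_shift_jets'[OF M p(1), of m]
  show "prolongation (Suc m) G A \<in> carrier (tangent_group 1 (tangent_group m G))"
    unfolding p(2) prolongation_jet[OF M p(1)] using cp by auto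
  assume "B \<in> carrier (tangent_group (Suc m) G)"
  then obtain q where q: "curve (mfd G) q" "B = jet (Suc m) (mfd G) q" by auto
  note cq = curve_shift_jets'[OF M q(1), of m]
  have "\<forall>\<^sub>F s in nhds 0. shift_jets m (mfd G) (\<lambda>t. p t \<otimes>\<^bsub>G\<^esub> q t) s =
      shift_jets m (mfd G) p s \<otimes>\<^bsub>tangent_group m G\<^esub> shift_jets m (mfd G) q s"
    using eventually_shift_curve[OF M p(1)] eventually_shift_curve[OF M q(1)]
    by eventually_elim (simp add: shift_jets_def jet_mult_jet[OF G])
  from jet_germ_cong[OF J curve_shift_jets'[OF M curve_mult[OF G p(1) q(1)]] this, of 1]
  show "prolongation (Suc m) G (A \<otimes>\<^bsub>tangent_group (Suc m) G\<^esub> B) =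
      prolongation (Suc m) G A \<otimes>\<^bsub>tangent_group 1 (tangent_group m G)\<^esub> prolongation (Suc m) G B"
    using jet_mult_jet[OF T, of "shift_jets m (mfd G) p" "shift_jets m (mfd G) q" 1] cp cq
    by (simp add: p(2) q(2) jet_mult_jet[OF G p(1) q(1)] prolongation_jet[OF M] p(1) q(1) curve_mult[OF G p(1) q(1)])
qed

lemma zero_section_hom:
  assumes G: "lie_group G"
  shows "zero_section m G \<in> hom (tangent_group_at_one m G) (tangent_group 1 (tangent_group m G))"
proof (rule homI)
  note M = lie_group_atlas[OF G]
  note T = lie_group_tangent_group[OF G, of m]
  note J = smooth_atlas_jet[OF M, of m]
  have c: "curve (mfd (tangent_group m G)) (\<lambda>_. A)" if "A \<in> carrier (tangent_group_at_one m G)" for A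
    using that jets_at_subset[of m G "\<one>\<^bsub>G\<^esub>"] by (intro curve_const[OF lie_group_atlas[OF T]]) auto
  fix A B assume A: "A \<in> carrier (tangent_group_at_one m G)"
  show "zero_section m G A \<in> carrier (tangent_group 1 (tangent_group m G))"
    using c[OF A] by (auto simp: zero_section_def)
  assume B: "B \<in> carrier (tangent_group_at_one m G)"
  show "zero_section m G (A \<otimes>\<^bsub>tangent_group_at_one m G\<^esub> B) =
      zero_section m G A \<otimes>\<^bsub>tangent_group 1 (tangent_group m G)\<^esub> zero_section m G B"
    using jet_mult_jet[OF T c[OF A] c[OF B], of 1] by (simp add: zero_section_def)
qed

lemma smooth_map_zero_section:
  assumes G: "lie_group G"
  shows "smooth_map (mfd (tangent_group_at_one m G)) (jet_manifold 1 (jet_manifold m (mfd G))) (zero_section m G)"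
proof -
  note M = lie_group_atlas[OF G]
  note J = smooth_atlas_jet[OF M, of m]
  show ?thesis
    using smooth_map_compose[OF smooth_atlas_at_one[OF G] J smooth_atlas_jet[OF J] smooth_map_at_one_inclusion[OF G] smooth_map_const_jet[OF J, of 1]]
    by (simp add: zero_section_def[abs_def])
qed

text \<open>The projection of the \<open>n\<close>-th onto the \<open>m\<close>-th order tangent
  manifold. It later recovers the first factor \<open>A\<close>, once \<open>B\<close> is known,
  from the base jet and the truncation of \<open>B\<close>.\<close>

definition jet_trunc :: "nat \<Rightarrow> 'a manifold \<Rightarrow> (real \<Rightarrow> 'a) set \<Rightarrow> (real \<Rightarrow> 'a) set" where
  "jet_trunc m M A = (\<Union>p\<in>A. jet m M p)"

lemma jet_trunc_jet:
  assumes M: "smooth_atlas M" and p: "curve M p" and mn: "m \<le> n"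
  shows "jet_trunc m M (jet n M p) = jet m M p"
proof -
  obtain D \<phi> where D: "(D, \<phi>) \<in> atlas M" "p 0 \<in> D" using chart_exists[OF M curve_point[OF M p]] .
  have "jet m M q = jet m M p" if "q \<in> jet n M p" for q
  proof -
    have "curve M q" "same_jet n (mdim M) \<phi> q p" using that jet_iff[OF M p D] by blast+
    then show ?thesis using jet_eq_iff[OF M _ p D(1), of q m] D mn by (simp add: same_jet_def)
  qed
  then show ?thesis unfolding jet_trunc_def using jet_self[OF M p, of n] by blast
qed

lemma smooth_map_jet_trunc:
  assumes M: "smooth_atlas M" and mn: "m \<le> n"
  shows "smooth_map (jet_manifold n M) (jet_manifold m M) (jet_trunc m M)"
proof (rule smooth_mapI[OF smooth_atlas_jet[OF M] smooth_atlas_jet[OF M]])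
  fix A assume "A \<in> points (jet_manifold n M)"
  then obtain p where p: "curve M p" "A = jet n M p" by auto
  obtain D \<phi> where D: "(D, \<phi>) \<in> atlas M" "p 0 \<in> D" using chart_exists[OF M curve_point[OF M p(1)]] .
  have "smooth_rep (Suc n * mdim M) (jet_dom n M D) (jet_coords n M \<phi>) (Suc m * mdim M) (jet_dom m M D) (jet_coords m M \<phi>)
      (jet_trunc m M) A"
  proof (rule smooth_repI[where U = "esp (Suc n * mdim M)" and g = "\<lambda>u. u"])
    fix B assume "B \<in> jet_dom n M D"
    then obtain q where q: "curve M q" "q 0 \<in> D" "B = jet n M q" unfolding jet_dom_def by blast
    show "jet_trunc m M B \<in> jet_dom m M D" unfolding q(3) jet_trunc_jet[OF M q(1) mn] by (rule jet_in_dom[OF q(1,2)])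
    fix i assume i: "i < Suc m * mdim M"
    have "i div mdim M \<le> n" using jet_index'(1)[OF i] mn by simp
    from jet_coords_at[OF M q(1) D(1) q(2) this jet_index'(2)[OF i]] jet_coords_at[OF M q(1) D(1) q(2) jet_index'(1,2)[OF i]]
    show "jet_coords m M \<phi> (jet_trunc m M B) i = jet_coords n M \<phi> B i"
      unfolding q(3) jet_trunc_jet[OF M q(1) mn] jet_index'(3)[OF i] by simp
  qed (rule openin_topspace jet_coords_esp C_infinity_on_proj)+
  then show "\<exists>C \<theta> E \<psi>. (C, \<theta>) \<in> atlas (jet_manifold n M) \<and> (E, \<psi>) \<in> atlas (jet_manifold m M) \<and> A \<in> C \<and>
      smooth_rep (mdim (jet_manifold n M)) C \<theta> (mdim (jet_manifold m M)) E \<psi> (jet_trunc m M) A"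
    using in_atlas_jet[OF D(1)] jet_in_dom[OF p(1) D(2)] p(2) unfolding jet_manifold_simps by blast
qed

section \<open>Interchanging derivatives\<close>

abbreviation pt :: "real \<Rightarrow> real \<Rightarrow> nat \<Rightarrow> real" where
  "pt s t \<equiv> (\<lambda>i. if i = 0 then s else if i = Suc 0 then t else 0)"

lemma pt_upd: "(pt s t)(Suc 0 := t') = pt s t'" "(pt s t)(0 := s') = pt s' t"
  by (auto simp: fun_eq_iff)

lemma C_infinity_on_pd_funpow:
  assumes "eopen d U" "C_infinity_on d U f" "i < d" shows "C_infinity_on d U ((pd i ^^ k) f)"
  by (induction k) (use assms C_infinity_on_pd in auto)

lemma pd_funpow_commute:
  assumes U: "eopen d U" and f: "C_infinity_on d U f" and ij: "i < d" "j < d" and x: "x \<in> U"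
  shows "pd i ((pd j ^^ k) f) x = (pd j ^^ k) (pd i f) x"
  using x
proof (induction k arbitrary: x)
  case (Suc k)
  have "pd i (pd j ((pd j ^^ k) f)) x = pd j (pd i ((pd j ^^ k) f)) x"
    by (rule pd_commute[OF U C_infinity_on_pd_funpow[OF U f ij(2)] ij Suc.prems])
  also have "\<dots> = pd j ((pd j ^^ k) (pd i f)) x"
    by (rule pd_cong[OF U Suc.prems ij(2) Suc.IH])
  finally show ?case by simp
qed simp

lemma eventually_pt_in:
  assumes "eopen 2 Q" "pt s t \<in> Q"
  shows "\<forall>\<^sub>F t' in nhds t. pt s t' \<in> Q" "\<forall>\<^sub>F s' in nhds s. pt s' t \<in> Q"
  using eventually_upd_in[OF assms, of 1] eventually_upd_in[OF assms, of 0] by (simp_all add: pt_upd)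

text \<open>\<open>pd\<close> is itself a derivative along a coordinate line. The equality must hold
  at all parameters near \<open>t\<close> before it can be differentiated once more, whence
  \<open>t\<close> is arbitrary in the induction and \<open>Q\<close> open.\<close>

lemma higher_deriv_pd:
  assumes Q: "eopen 2 Q" and st: "pt s t \<in> Q"
  shows "(deriv ^^ k) (\<lambda>t. f (pt s t)) t = (pd (Suc 0) ^^ k) f (pt s t)"
  using st
proof (induction k arbitrary: t)
  case (Suc k)
  have "(deriv ^^ Suc k) (\<lambda>t. f (pt s t)) t = deriv (\<lambda>t. (pd (Suc 0) ^^ k) f (pt s t)) t"
    using eventually_pt_in(1)[OF Q Suc.prems]
    by (simp del: One_nat_def) (intro deriv_cong_ev refl, auto elim!: eventually_mono intro: Suc.IH)
  then show ?case by (simp add: pd_def[of "Suc 0" "(pd (Suc 0) ^^ k) f"] pt_upd)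
qed simp

text \<open>With one-variable derivatives rewritten as \<open>pd\<close>, symmetry of mixed partial
  derivatives moves the derivative in \<open>s\<close> past the \<open>k\<close> derivatives in
  \<open>t\<close>, one at a time.\<close>

lemma deriv_higher_deriv_commute:
  assumes Q: "eopen 2 Q" and f: "C_infinity_on 2 Q f" and 0: "pt 0 0 \<in> Q"
  shows "deriv (\<lambda>s. (deriv ^^ k) (\<lambda>t. f (pt s t)) 0) 0 = (deriv ^^ k) (\<lambda>t. deriv (\<lambda>s. f (pt s t)) 0) 0"
proof -
  have "deriv (\<lambda>s. (deriv ^^ k) (\<lambda>t. f (pt s t)) 0) 0 = deriv (\<lambda>s. (pd (Suc 0) ^^ k) f (pt s 0)) 0"
    using eventually_pt_in(2)[OF Q 0]
    by (intro deriv_cong_ev refl) (auto elim!: eventually_mono intro: higher_deriv_pd[OF Q])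
  also have "\<dots> = pd 0 ((pd (Suc 0) ^^ k) f) (pt 0 0)" by (simp add: pd_def pt_upd)
  also have "\<dots> = (pd (Suc 0) ^^ k) (pd 0 f) (pt 0 0)" by (rule pd_funpow_commute[OF Q f _ _ 0]) auto
  also have "\<dots> = (deriv ^^ k) (\<lambda>t. pd 0 f (pt 0 t)) 0" by (rule higher_deriv_pd[OF Q 0, symmetric])
  also have "(\<lambda>t. pd 0 f (pt 0 t)) = (\<lambda>t. deriv (\<lambda>s. f (pt s t)) 0)" by (simp add: pd_def pt_upd)
  finally show ?thesis .
qed

text \<open>Nested neighbourhoods fit iterated one-variable derivatives: the range of the inner
  variable may depend on the outer one.\<close>

lemma eventually_pt_in_both:
  assumes Q: "eopen 2 Q" and 0: "pt 0 0 \<in> Q"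
  shows "\<forall>\<^sub>F s in nhds 0. \<forall>\<^sub>F t in nhds 0. pt s t \<in> Q" "\<forall>\<^sub>F t in nhds 0. \<forall>\<^sub>F s in nhds 0. pt s t \<in> Q"
proof -
  have "\<forall>\<^sub>F s in nhds 0. pt s 0 \<in> Q" using eventually_pt_in(2)[OF Q 0] .
  then show "\<forall>\<^sub>F s in nhds 0. \<forall>\<^sub>F t in nhds 0. pt s t \<in> Q" by eventually_elim (rule eventually_pt_in(1)[OF Q])
  have "\<forall>\<^sub>F t in nhds 0. pt 0 t \<in> Q" using eventually_pt_in(1)[OF Q 0] .
  then show "\<forall>\<^sub>F t in nhds 0. \<forall>\<^sub>F s in nhds 0. pt s t \<in> Q" by eventually_elim (rule eventually_pt_in(2)[OF Q])
qed

lemma sum_lessThan_add: "(\<Sum>i<a + b. f i) = (\<Sum>i<a. f i) + (\<Sum>i<(b::nat). f (a + i) :: real)"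
  by (induction b) (simp_all add: add.assoc)

section \<open>The factorization in a chart\<close>

locale group_chart =
  fixes G :: "'a lie" and D :: "'a set" and \<phi> :: "'a \<Rightarrow> nat \<Rightarrow> real"
  assumes lie: "lie_group G" and chart: "(D, \<phi>) \<in> atlas (mfd G)"
begin

abbreviation M :: "'a manifold" where "M \<equiv> mfd G"
abbreviation d :: nat where "d \<equiv> mdim (mfd G)"

sublocale group G by (rule lie_group_group[OF lie])

lemmas atl = lie_group_atlas[OF lie]
lemmas atl2 = smooth_atlas_prod[OF atl atl]
lemmas atl3 = smooth_atlas_prod[OF atl atl2]
lemmas \<phi>_esp = chart_esp[OF atl chart]

lemma D_carrier: "x \<in> D \<Longrightarrow> x \<in> carrier G"
  using chart_subset[OF atl chart] lie_group_points[OF lie] by auto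

lemma \<phi>_inj: "x \<in> D \<Longrightarrow> y \<in> D \<Longrightarrow> \<phi> x = \<phi> y \<Longrightarrow> x = y"
  using chart_inj[OF atl chart] by (auto simp: inj_on_def)

text \<open>With \<open>q = w c^(-1)\<close>, the value \<open>q(t) c(s + t)\<close> is
  \<open>tri (w t, c t, c (s + t))\<close>. Since \<open>tri (x, y, y) = x\<close>, all entries and
  the value stay in one chart near a common base point, wherever that chart lies in the
  group.\<close>

definition tri :: "'a \<times> 'a \<times> 'a \<Rightarrow> 'a" where
  "tri = (\<lambda>(x, y, z). x \<otimes>\<^bsub>G\<^esub> inv\<^bsub>G\<^esub> y \<otimes>\<^bsub>G\<^esub> z)"

abbreviation chart3 :: "'a \<times> 'a \<times> 'a \<Rightarrow> nat \<Rightarrow> real" where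
  "chart3 \<equiv> prod_chart d \<phi> (prod_chart d \<phi> \<phi>)"

abbreviation trip :: "(nat \<Rightarrow> real) \<Rightarrow> (nat \<Rightarrow> real) \<Rightarrow> (nat \<Rightarrow> real) \<Rightarrow> nat \<Rightarrow> real" where
  "trip a b c \<equiv> append_coords d a (append_coords d b c)"

abbreviation d3 :: nat where "d3 \<equiv> d + (d + d)"

lemma tri_same: "x \<in> carrier G \<Longrightarrow> y \<in> carrier G \<Longrightarrow> tri (x, y, y) = x"
  by (simp add: tri_def m_assoc)

text \<open>This cancellation is what makes the derivative of \<open>tri\<close> in its last
  argument explicitly invertible, see \<open>dtri_dtri\<close>.\<close>

lemma tri_tri: "x \<in> carrier G \<Longrightarrow> y \<in> carrier G \<Longrightarrow> z \<in> carrier G \<Longrightarrow> tri (x, y, tri (y, x, z)) = z"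
  by (simp add: tri_def m_assoc) (simp add: m_assoc[symmetric])

lemma smooth_map_tri: "smooth_map (prod_manifold M (prod_manifold M M)) M tri"
proof -
  note s = smooth_map_snd[OF atl atl2]
  have "smooth_map (prod_manifold M (prod_manifold M M)) M (\<lambda>p. fst p \<otimes>\<^bsub>G\<^esub> inv\<^bsub>G\<^esub> fst (snd p) \<otimes>\<^bsub>G\<^esub> snd (snd p))"
    by (intro smooth_map_mult[OF lie atl3] smooth_map_inv[OF lie atl3] smooth_map_fst[OF atl atl2]
        smooth_map_compose[OF atl3 atl2 atl s smooth_map_fst[OF atl atl]]
        smooth_map_compose[OF atl3 atl2 atl s smooth_map_snd[OF atl atl]])
  then show ?thesis by (simp add: tri_def case_prod_beta')
qed

lemma chart3_in_atlas: "(D \<times> D \<times> D, chart3) \<in> atlas (prod_manifold M (prod_manifold M M))"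
  using in_atlas_prod[OF chart in_atlas_prod[OF chart chart]] by simp

definition U3 :: "(nat \<Rightarrow> real) set" where "U3 = chart3 ` (D \<times> D \<times> D \<inter> tri -` D)"

definition mu :: "nat \<Rightarrow> (nat \<Rightarrow> real) \<Rightarrow> real" where
  "mu j u = \<phi> (tri (inv_into (D \<times> D \<times> D) chart3 u)) j"

lemma eopen_U3: "eopen d3 U3"
  using eopen_chart_vimage[OF atl3 atl smooth_map_tri chart3_in_atlas chart] by (simp add: U3_def)

lemma C_infinity_on_mu: "j < d \<Longrightarrow> C_infinity_on d3 U3 (mu j)"
  using C_infinity_on_chart_vimage[OF atl3 atl smooth_map_tri chart3_in_atlas chart] by (simp add: U3_def mu_def[abs_def])

lemma trip_in_U3_iff:
  assumes "x \<in> D" "y \<in> D" "z \<in> D"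
  shows "trip (\<phi> x) (\<phi> y) (\<phi> z) \<in> U3 \<longleftrightarrow> tri (x, y, z) \<in> D"
    and "mu j (trip (\<phi> x) (\<phi> y) (\<phi> z)) = \<phi> (tri (x, y, z)) j"
proof -
  have e: "trip (\<phi> x) (\<phi> y) (\<phi> z) = chart3 (x, y, z)" by simp
  have m: "(x, y, z) \<in> D \<times> D \<times> D" using assms by simp
  note inj = chart_inj[OF atl3 chart3_in_atlas]
  show "trip (\<phi> x) (\<phi> y) (\<phi> z) \<in> U3 \<longleftrightarrow> tri (x, y, z) \<in> D"
    unfolding e U3_def inj_on_image_mem_iff[OF inj m Int_lower1] using m by simp
  show "mu j (trip (\<phi> x) (\<phi> y) (\<phi> z)) = \<phi> (tri (x, y, z)) j"
    unfolding e mu_def inv_into_f_f[OF inj m] ..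
qed

text \<open>
  In the chart, \<open>dtri\<close> is the map \<open>(x, y, v) \<mapsto> (d/dz) (x y\<^sup>-\<^sup>1 z) v\<close> at \<open>z = y\<close>.
\<close>

definition dtri :: "nat \<Rightarrow> (nat \<Rightarrow> real) \<Rightarrow> real" where
  "dtri j y = (\<Sum>i<d. pd (d + d + i) (mu j)
     (trip (take_coords d y) (take_coords d (drop_coords d y)) (take_coords d (drop_coords d y))) * y (d + d + i))"

text \<open>The third block is a tangent vector and hence unrestricted, in contrast to the points in
  the first two.\<close>

definition V3 :: "(nat \<Rightarrow> real) set" where
  "V3 = {y \<in> esp d3. take_coords d y \<in> \<phi> ` D \<and> take_coords d (drop_coords d y) \<in> \<phi> ` D}"

lemma trip_at: "trip a b c (d + d + i) = c i"
  by (simp add: append_coords_def)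

lemma trip_apply: "trip a b c i = (if i < d then a i else if i < d + d then b (i - d) else c (i - (d + d)))"
  by (auto simp: append_coords_def)

lemma C_infinity_on_trip:
  assumes "\<And>i. i < d \<Longrightarrow> C_infinity_on k U (\<lambda>y. a y i)" "\<And>i. i < d \<Longrightarrow> C_infinity_on k U (\<lambda>y. b y i)"
    "\<And>i. i < d \<Longrightarrow> C_infinity_on k U (\<lambda>y. c y i)" "i < d3"
  shows "C_infinity_on k U (\<lambda>y. trip (a y) (b y) (c y) i)"
  using assms unfolding trip_apply by (cases "i < d"; cases "i < d + d") auto

lemma trip_in_V3: "a \<in> \<phi> ` D \<Longrightarrow> b \<in> \<phi> ` D \<Longrightarrow> c \<in> esp d \<Longrightarrow> trip a b c \<in> V3"
  using \<phi>_esp by (auto simp: V3_def take_append drop_append append_esp)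

lemma eopen_V3: "eopen d3 V3"
proof -
  have "eopen d3 {y \<in> {y \<in> esp d3. take_coords d y \<in> \<phi> ` D}. take_coords d (drop_coords d y) \<in> \<phi> ` D}"
    by (rule eopen_preimage_smooth[OF eopen_take[OF chart_eopen[OF atl chart]] _ _ chart_eopen[OF atl chart]])
      (auto simp: take_coords_def drop_coords_def)
  then show ?thesis by (simp add: V3_def conj_assoc)
qed

text \<open>\<open>mu\<close> is differentiated only at triples \<open>(x, y, y)\<close>, where
  \<open>tri\<close> has the value \<open>x\<close>; so the evaluation point belongs to
  \<open>U3\<close> for all \<open>x\<close> and \<open>y\<close> in the chart.\<close>

lemma C_infinity_on_dtri:
  assumes j: "j < d" shows "C_infinity_on d3 V3 (dtri j)"
  unfolding dtri_def
proof (intro C_infinity_on_sum C_infinity_on_mult C_infinity_on_proj)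
  fix i assume "i \<in> {..<d}"
  then have i: "d + d + i < d3" by simp
  let ?g = "\<lambda>y. trip (take_coords d y) (take_coords d (drop_coords d y)) (take_coords d (drop_coords d y))"
  show "C_infinity_on d3 V3 (\<lambda>y. pd (d + d + i) (mu j) (?g y))"
  proof (rule C_infinity_on_compose[OF eopen_V3 eopen_U3 _ _ C_infinity_on_pd[OF eopen_U3 C_infinity_on_mu[OF j] i]])
    fix y assume "y \<in> V3"
    then obtain a b where "a \<in> D" "b \<in> D" "take_coords d y = \<phi> a" "take_coords d (drop_coords d y) = \<phi> b"
      unfolding V3_def by blast
    then show "?g y \<in> U3" using trip_in_U3_iff(1)[of a b b] tri_same D_carrier by simp
  next
    fix i assume i: "i < d3"
    have "C_infinity_on d3 V3 (\<lambda>y. take_coords d (drop_coords d y) i)" for i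
      by (cases "i < d") (simp_all add: take_coords_def drop_coords_def)
    then show "C_infinity_on d3 V3 (\<lambda>y. ?g y i)"
      by (intro C_infinity_on_trip[OF _ _ _ i] C_infinity_on_take)
  qed
qed

section \<open>The differentiated equation along curves\<close>

definition vel :: "(real \<Rightarrow> 'a) \<Rightarrow> real \<Rightarrow> nat \<Rightarrow> real" where
  "vel c t = (\<lambda>i. if i < d then deriv (\<lambda>t. \<phi> (c t) i) t else 0)"

abbreviation cin :: "(real \<Rightarrow> 'a) \<Rightarrow> bool" where "cin \<equiv> curve_in d D \<phi>"

lemma cin_curve: "cin c \<Longrightarrow> curve M c"
  by (rule curve_inI[OF chart])

lemma cin_D: "cin c \<Longrightarrow> \<forall>\<^sub>F t in nhds 0. c t \<in> D"
  by (simp add: curve_in_def)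

lemma curve_tri:
  assumes "curve M x" "curve M y" "curve M z" shows "curve M (\<lambda>t. tri (x t, y t, z t))"
  by (rule curve_compose[OF atl3 atl smooth_map_tri curve_Pair[OF assms(1) curve_Pair[OF assms(2,3)]]])

lemma cin_tri:
  assumes x: "x \<in> D" and z: "cin z"
  shows "cin (\<lambda>s. tri (x, z 0, z s))"
proof (rule curve_in_chart[OF atl _ chart])
  have "z 0 \<in> D" by (rule curve_in_0[OF z])
  then show "tri (x, z 0, z 0) \<in> D" using x D_carrier tri_same by simp
  have "curve M (\<lambda>_. x)" "curve M (\<lambda>_. z 0)"
    using curve_const[OF atl] chart_subset[OF atl chart] x \<open>z 0 \<in> D\<close> by blast+
  then show "curve M (\<lambda>s. tri (x, z 0, z s))" by (rule curve_tri[OF _ _ cin_curve[OF z]])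
qed

text \<open>The chain rule for \<open>mu\<close> along a curve whose first two blocks are constant:
  only the last \<open>d\<close> partial derivatives survive, and they make up
  \<open>dtri\<close>.\<close>

lemma DERIV_tri:
  assumes x: "x \<in> D" and z: "cin z" and j: "j < d"
  shows "((\<lambda>s. \<phi> (tri (x, z 0, z s)) j) has_real_derivative dtri j (trip (\<phi> x) (\<phi> (z 0)) (vel z 0))) (at 0)"
proof -
  have z0: "z 0 \<in> D" by (rule curve_in_0[OF z])
  have zg: "sgerm (\<lambda>s. \<phi> (z s) i)" if "i < d" for i using z that by (simp add: curve_in_def)
  define c where "c s = trip (\<phi> x) (\<phi> (z 0)) (\<phi> (z s))" for s
  have c0: "c 0 \<in> U3" unfolding c_def using trip_in_U3_iff(1)[OF x z0 z0] tri_same x z0 D_carrier by simp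
  have "((\<lambda>s. mu j (c s)) has_real_derivative
      (\<Sum>i<d3. pd i (mu j) (c 0) * (if i < d + d then 0 else vel z 0 (i - (d + d))))) (at 0)"
  proof (rule DERIV_compose_curve[OF eopen_U3, where c = c and t\<^sub>0 = 0])
    show "c 0 \<in> U3" by (rule c0)
    show "C_k_on (Suc 0) d3 U3 (mu j)" using C_infinity_on_mu[OF j] by (simp only: C_infinity_on_def)
    show "\<forall>\<^sub>F t in nhds 0. c t \<in> esp d3"
      using cin_D[OF z] by eventually_elim (simp add: c_def append_esp \<phi>_esp)
    fix i assume i: "i < d3"
    show "((\<lambda>t. c t i) has_real_derivative (if i < d + d then 0 else vel z 0 (i - (d + d)))) (at 0)"
    proof (cases "i < d + d")
      case True
      then have "c t i = trip (\<phi> x) (\<phi> (z 0)) (\<lambda>_. 0) i" for t by (simp add: c_def trip_apply)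
      then show ?thesis using True by simp
    next
      case False
      then have "i - (d + d) < d" using i by simp
      then show ?thesis using False sgerm_has_derivative_0[OF zg] by (simp add: c_def trip_apply vel_def)
    qed
  qed
  moreover have "(\<Sum>i<d3. pd i (mu j) (c 0) * (if i < d + d then 0 else vel z 0 (i - (d + d)))) =
      dtri j (trip (\<phi> x) (\<phi> (z 0)) (vel z 0))"
    unfolding add.assoc[symmetric] sum_lessThan_add[of _ "d + d"]
    by (simp add: dtri_def c_def trip_at take_append drop_append \<phi>_esp x z0)
  moreover have "\<forall>\<^sub>F s in nhds 0. mu j (c s) = \<phi> (tri (x, z 0, z s)) j"
    using cin_D[OF z] by eventually_elim (simp add: c_def trip_in_U3_iff(2) x z0)
  ultimately show ?thesis by (simp add: DERIV_cong_ev)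
qed

text \<open>Differentiates \<open>tri (x, y, tri (y, x, z s)) = z s\<close> at \<open>s = 0\<close>
  along a curve \<open>z\<close> through \<open>x\<close> with velocity \<open>v\<close>.\<close>

lemma dtri_dtri:
  assumes a: "a \<in> \<phi> ` D" and b: "b \<in> \<phi> ` D" and v: "v \<in> esp d" and j: "j < d"
  shows "dtri j (trip a b (\<lambda>i. if i < d then dtri i (trip b a v) else 0)) = v j"
proof -
  obtain x y where x: "x \<in> D" "a = \<phi> x" and y: "y \<in> D" "b = \<phi> y" using a b by blast
  \<comment> \<open>Coordinates of a first-order jet with base point \<open>a\<close> and velocity
    \<open>v\<close>, from which \<open>jet_curve\<close> builds the curve \<open>z\<close>.\<close>
  define u where "u = append_coords d a v"
  have u: "take_coords d u = \<phi> x" using x \<phi>_esp by (simp add: u_def take_append)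
  then have u': "take_coords d u \<in> \<phi> ` D" using x by simp
  define z where "z = jet_curve 1 d D \<phi> u"
  have z: "cin z" unfolding z_def by (rule jet_curve_in[OF atl chart u'])
  note zD = curve_in_0[OF z]
  have z0: "z 0 = x" by (rule \<phi>_inj[OF zD x(1)]) (use jet_curve_0[OF atl chart u', of 1] u in \<open>simp add: z_def\<close>)
  have velz: "vel z 0 = v"
  proof (rule esp_eqI[OF _ v])
    fix i assume i: "i < d"
    then show "vel z 0 i = v i"
      using cderiv_jet_curve[OF atl chart u', of 1 1 i] by (simp add: vel_def z_def u_def append_coords_def)
  qed (simp add: vel_def esp_iff)
  define h where "h s = tri (y, z 0, z s)" for s
  have h: "cin h" unfolding h_def by (rule cin_tri[OF y(1) z])
  have h0: "h 0 = y" using tri_same y x D_carrier by (simp add: h_def z0)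
  have velh: "vel h 0 = (\<lambda>i. if i < d then dtri i (trip b a v) else 0)"
  proof -
    have "deriv (\<lambda>s. \<phi> (h s) i) 0 = dtri i (trip b a v)" if "i < d" for i
      using DERIV_imp_deriv[OF DERIV_tri[OF y(1) z that]] by (simp add: h_def z0 velz x(2) y(2))
    then show ?thesis by (auto simp: vel_def)
  qed
  have "((\<lambda>s. \<phi> (tri (x, h 0, h s)) j) has_real_derivative dtri j (trip a b (vel h 0))) (at 0)"
    using DERIV_tri[OF x(1) h j] by (simp add: h0 x(2) y(2))
  moreover have "\<forall>\<^sub>F s in nhds 0. \<phi> (tri (x, h 0, h s)) j = \<phi> (z s) j"
    using cin_D[OF z] by eventually_elim (simp add: h_def z0 tri_same tri_tri x y D_carrier)
  ultimately have "((\<lambda>s. \<phi> (z s) j) has_real_derivative dtri j (trip a b (vel h 0))) (at 0)"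
    by (simp add: DERIV_cong_ev)
  then have "dtri j (trip a b (vel h 0)) = vel z 0 j" using DERIV_imp_deriv j by (fastforce simp: vel_def)
  then show ?thesis by (simp add: velh velz)
qed

lemma sgerm_trip:
  assumes "\<And>i. i < d \<Longrightarrow> sgerm (\<lambda>t. a t i)" "\<And>i. i < d \<Longrightarrow> sgerm (\<lambda>t. b t i)" "\<And>i. i < d \<Longrightarrow> sgerm (\<lambda>t. c t i)" "i < d3"
  shows "sgerm (\<lambda>t. trip (a t) (b t) (c t) i)"
  using assms unfolding trip_apply by (cases "i < d"; cases "i < d + d") auto

lemma higher_deriv_trip:
  "(deriv ^^ k) (\<lambda>t. trip (a t) (b t) (c t) i) 0 =
    trip (\<lambda>i. (deriv ^^ k) (\<lambda>t. a t i) 0) (\<lambda>i. (deriv ^^ k) (\<lambda>t. b t i) 0) (\<lambda>i. (deriv ^^ k) (\<lambda>t. c t i) 0) i"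
  unfolding trip_apply by (cases "i < d"; cases "i < d + d") simp_all

text \<open>Derivatives in \<open>s\<close> of jet coordinates become derivatives in
  \<open>t\<close> of \<open>dtri\<close>. The auxiliary variable disappears, and what is left is a
  condition on the curves \<open>w\<close> and \<open>c\<close> alone.\<close>

lemma dtri_tri_commute:
  assumes w: "cin w" and c: "cin c" and wc: "w 0 = c 0" and j: "j < d"
  shows "deriv (\<lambda>s. (deriv ^^ k) (\<lambda>t. \<phi> (tri (w t, c t, c (s + t))) j) 0) 0 =
    (deriv ^^ k) (\<lambda>t. dtri j (trip (\<phi> (w t)) (\<phi> (c t)) (vel c t))) 0"
proof -
  have "\<forall>\<^sub>F t in nhds 0. \<forall>i\<in>{..<d}. (\<forall>k. (deriv ^^ k) (\<lambda>t. \<phi> (w t) i) field_differentiable at t) \<and>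
      (\<forall>k. (deriv ^^ k) (\<lambda>t. \<phi> (c t) i) field_differentiable at t)"
    using w c by (intro eventually_ball_finite ballI eventually_conj) (auto simp: curve_in_def sgerm_def)
  from eventually_conj[OF this eventually_conj[OF cin_D[OF w] cin_D[OF c]]]
  obtain \<epsilon> where \<epsilon>: "\<epsilon> > 0" "\<And>t. \<bar>t\<bar> < \<epsilon> \<Longrightarrow> w t \<in> D" "\<And>t. \<bar>t\<bar> < \<epsilon> \<Longrightarrow> c t \<in> D"
    "\<And>t i k. \<bar>t\<bar> < \<epsilon> \<Longrightarrow> i < d \<Longrightarrow> (deriv ^^ k) (\<lambda>t. \<phi> (w t) i) field_differentiable at t"
    "\<And>t i k. \<bar>t\<bar> < \<epsilon> \<Longrightarrow> i < d \<Longrightarrow> (deriv ^^ k) (\<lambda>t. \<phi> (c t) i) field_differentiable at t"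
    unfolding eventually_nhds_0_real by auto
  \<comment> \<open>The radius is halved so that \<open>s + t\<close> stays within \<epsilon> as
    well.\<close>
  define Q0 where "Q0 = {y \<in> esp 2. \<forall>i<2. \<bar>y i - 0\<bar> < \<epsilon> / 2}"
  have Q0: "eopen 2 Q0" unfolding Q0_def by (rule eopen_box)
  have Q0D: "\<bar>y 1\<bar> < \<epsilon>" "\<bar>y 0 + y 1\<bar> < \<epsilon>" if "y \<in> Q0" for y
  proof -
    have "\<bar>y 0\<bar> < \<epsilon> / 2" "\<bar>y 1\<bar> < \<epsilon> / 2" using that by (auto simp: Q0_def)
    then show "\<bar>y 1\<bar> < \<epsilon>" "\<bar>y 0 + y 1\<bar> < \<epsilon>" by linarith+
  qed
  have lift: "C_infinity_on 2 Q0 (\<lambda>y. f (r y))"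
    if f: "\<And>k t. \<bar>t\<bar> < \<epsilon> \<Longrightarrow> (deriv ^^ k) f field_differentiable at t" and r: "C_infinity_on 2 Q0 r"
      and rb: "\<And>y. y \<in> Q0 \<Longrightarrow> \<bar>r y\<bar> < \<epsilon>" for f :: "real \<Rightarrow> real" and r :: "(nat \<Rightarrow> real) \<Rightarrow> real"
  proof -
    have F: "C_infinity_on 1 {x \<in> esp 1. \<bar>x 0\<bar> < \<epsilon>} (\<lambda>x. f (x 0))"
      using f C_infinity_on_interval by blast
    have "C_infinity_on 2 Q0 (\<lambda>y. if i = 0 then r y else 0)" for i :: nat using r by (cases "i = 0") simp_all
    from C_infinity_on_compose[where g = "\<lambda>y i. if i = 0 then r y else 0", OF Q0 eopen_interval _ this F]
    show ?thesis using rb by (simp add: esp_iff)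
  qed
  define \<Gamma> where "\<Gamma> y = trip (\<phi> (w (y 1))) (\<phi> (c (y 1))) (\<phi> (c (y 0 + y 1)))" for y :: "nat \<Rightarrow> real"
  have \<Gamma>: "C_infinity_on 2 Q0 (\<lambda>y. \<Gamma> y i)" if "i < d3" for i
    unfolding \<Gamma>_def
  proof (rule C_infinity_on_trip[OF _ _ _ that])
    show "C_infinity_on 2 Q0 (\<lambda>y. \<phi> (w (y 1)) i)" if "i < d" for i
      by (rule lift[OF \<epsilon>(4)[OF _ that] C_infinity_on_proj Q0D(1)])
    show "C_infinity_on 2 Q0 (\<lambda>y. \<phi> (c (y 1)) i)" if "i < d" for i
      by (rule lift[OF \<epsilon>(5)[OF _ that] C_infinity_on_proj Q0D(1)])
    show "C_infinity_on 2 Q0 (\<lambda>y. \<phi> (c (y 0 + y 1)) i)" if "i < d" for i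
      by (rule lift[OF \<epsilon>(5)[OF _ that] C_infinity_on_add[OF C_infinity_on_proj C_infinity_on_proj] Q0D(2)])
  qed
  \<comment> \<open>On \<open>Q0\<close> the three curves stay in the chart, but the value of
    \<open>tri\<close> may leave it; \<open>Q\<close> is the open part where it does not.\<close>
  define Q where "Q = {y \<in> Q0. \<Gamma> y \<in> U3}"
  have Q: "eopen 2 Q" unfolding Q_def
  proof (rule eopen_preimage_smooth[OF Q0 \<Gamma> _ eopen_U3])
    fix y i assume "y \<in> Q0" "d3 \<le> i"
    moreover have "\<Gamma> y \<in> esp d3" unfolding \<Gamma>_def using \<epsilon>(3) Q0D(2)[OF \<open>y \<in> Q0\<close>] by (intro append_esp \<phi>_esp)
    ultimately show "\<Gamma> y i = 0" by (simp add: esp_iff)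
  qed
  define f where "f y = mu j (\<Gamma> y)" for y
  have f: "C_infinity_on 2 Q f" unfolding f_def
  proof (rule C_infinity_on_compose[OF Q eopen_U3 _ _ C_infinity_on_mu[OF j]])
    show "C_infinity_on 2 Q (\<lambda>x. \<Gamma> x i)" if "i < d3" for i
      by (rule C_infinity_on_subset[OF \<Gamma>[OF that]]) (auto simp: Q_def)
  qed (simp add: Q_def)
  have c0: "c 0 \<in> D" by (rule curve_in_0[OF c])
  have 0: "pt 0 0 \<in> Q"
  proof -
    have "trip (\<phi> (c 0)) (\<phi> (c 0)) (\<phi> (c 0)) \<in> U3"
      using trip_in_U3_iff(1)[OF c0 c0 c0] tri_same[OF D_carrier[OF c0] D_carrier[OF c0]] c0 by simp
    then show ?thesis using \<epsilon>(1) by (simp add: Q_def Q0_def \<Gamma>_def esp_iff wc)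
  qed
  have f_eq: "f (pt s t) = \<phi> (tri (w t, c t, c (s + t))) j" if "pt s t \<in> Q" for s t
  proof -
    have "pt s t \<in> Q0" using that by (simp add: Q_def)
    from Q0D[OF this] \<epsilon>(2,3) show ?thesis by (simp add: f_def \<Gamma>_def trip_in_U3_iff(2))
  qed
  note ev = eventually_pt_in_both[OF Q 0]
  have "\<forall>\<^sub>F s in nhds 0. (deriv ^^ k) (\<lambda>t. \<phi> (tri (w t, c t, c (s + t))) j) 0 = (deriv ^^ k) (\<lambda>t. f (pt s t)) 0"
    using ev(1) by eventually_elim (rule higher_deriv_ev_cong, erule eventually_mono, rule f_eq[symmetric])
  then have "deriv (\<lambda>s. (deriv ^^ k) (\<lambda>t. \<phi> (tri (w t, c t, c (s + t))) j) 0) 0 = deriv (\<lambda>s. (deriv ^^ k) (\<lambda>t. f (pt s t)) 0) 0"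
    by (rule deriv_cong_ev) simp
  also have "\<dots> = (deriv ^^ k) (\<lambda>t. deriv (\<lambda>s. f (pt s t)) 0) 0"
    by (rule deriv_higher_deriv_commute[OF Q f 0])
  also have "\<dots> = (deriv ^^ k) (\<lambda>t. dtri j (trip (\<phi> (w t)) (\<phi> (c t)) (vel c t))) 0"
  proof (rule higher_deriv_ev_cong)
    show "\<forall>\<^sub>F t in nhds 0. deriv (\<lambda>s. f (pt s t)) 0 = dtri j (trip (\<phi> (w t)) (\<phi> (c t)) (vel c t))"
      using ev(2) curve_in_shift[OF c] cin_D[OF w]
    proof eventually_elim
      case (elim t)
      \<comment> \<open>\<open>DERIV_tri\<close> concerns the parameter \<open>0\<close>, so it is
        applied to \<open>c\<close> shifted by \<open>t\<close>; writing \<open>t + 0\<close>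
        exhibits the starting point of the shifted curve.\<close>
      have "\<forall>\<^sub>F s in nhds 0. f (pt s t) = \<phi> (tri (w t, c (t + 0), c (t + s))) j"
        using elim(1) by eventually_elim (simp add: f_eq add.commute)
      then have "deriv (\<lambda>s. f (pt s t)) 0 = deriv (\<lambda>s. \<phi> (tri (w t, c (t + 0), c (t + s))) j) 0"
        by (rule deriv_cong_ev) simp
      also have "\<dots> = dtri j (trip (\<phi> (w t)) (\<phi> (c (t + 0))) (vel (\<lambda>s. c (t + s)) 0))"
        by (rule DERIV_imp_deriv[OF DERIV_tri[OF elim(3,2) j]])
      also have "vel (\<lambda>s. c (t + s)) 0 = vel c t"
        using sgerm_shift_deriv[of 1 "\<lambda>t. \<phi> (c t) _" t] by (auto simp: vel_def)
      finally show ?case by simp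
    qed
  qed
  finally show ?thesis .
qed

text \<open>
  Since \<open>dtri(a, b, dtri(b, a, v)) = v\<close>, the equations \<open>dtri(a, b, u) = v\<close> and \<open>u = dtri(b, a, v)\<close> are equivalent, also
  up to order \<open>m\<close>.
\<close>

lemma dtri_transfer:
  assumes a: "\<And>i. i < d \<Longrightarrow> sgerm (\<lambda>t. a t i)" "\<forall>\<^sub>F t in nhds 0. a t \<in> \<phi> ` D"
    and b: "\<And>i. i < d \<Longrightarrow> sgerm (\<lambda>t. b t i)" "\<forall>\<^sub>F t in nhds 0. b t \<in> \<phi> ` D"
    and u: "\<And>i. i < d \<Longrightarrow> sgerm (\<lambda>t. u t i)" "\<And>t. u t \<in> esp d"
    and v: "\<And>i. i < d \<Longrightarrow> sgerm (\<lambda>t. v t i)" "\<And>t. v t \<in> esp d"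
    and eq: "\<And>k j. k \<le> m \<Longrightarrow> j < d \<Longrightarrow>
      (deriv ^^ k) (\<lambda>t. dtri j (trip (a t) (b t) (u t))) 0 = (deriv ^^ k) (\<lambda>t. v t j) 0"
    and k: "k \<le> m" and j: "j < d"
  shows "(deriv ^^ k) (\<lambda>t. dtri j (trip (b t) (a t) (v t))) 0 = (deriv ^^ k) (\<lambda>t. u t j) 0"
proof -
  have V: "\<forall>\<^sub>F t in nhds 0. trip (a t) (b t) (u t) \<in> V3" using a(2) b(2) by eventually_elim (intro trip_in_V3 u(2))
  have W: "\<forall>\<^sub>F t in nhds 0. trip (b t) (a t) (v t) \<in> V3" using a(2) b(2) by eventually_elim (intro trip_in_V3 v(2))
  \<comment> \<open>\<open>v'\<close> is the exact value of \<open>dtri\<close> at \<open>a\<close>,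
    \<open>b\<close>, \<open>u\<close>, whereas \<open>v\<close> agrees with it only up to order
    \<open>m\<close>. Derivatives of order \<open>k \<le> m\<close> of the exchanged expression see
    only these orders, so \<open>v\<close> may be traded for \<open>v'\<close>, to which
    \<open>dtri_dtri\<close> applies.\<close>
  define v' where "v' t = (\<lambda>i. if i < d then dtri i (trip (a t) (b t) (u t)) else 0)" for t
  have v': "sgerm (\<lambda>t. v' t i)" if "i < d" for i
    using sgerm_compose[OF eopen_V3 C_infinity_on_dtri[OF that] sgerm_trip[OF a(1) b(1) u(1)] V] that
    by (simp add: v'_def)
  have V': "\<forall>\<^sub>F t in nhds 0. trip (b t) (a t) (v' t) \<in> V3"
    using a(2) b(2) by eventually_elim (intro trip_in_V3, auto simp: v'_def esp_iff)
  have jets: "(deriv ^^ l) (\<lambda>t. v t i) 0 = (deriv ^^ l) (\<lambda>t. v' t i) 0" if "l \<le> m" "i < d" for l i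
    using eq[OF that] that(2) by (simp add: v'_def)
  have "(deriv ^^ k) (\<lambda>t. dtri j (trip (b t) (a t) (v t))) 0 =
      jet_comp d3 k (dtri j) (\<lambda>l i. (deriv ^^ l) (\<lambda>t. trip (b t) (a t) (v t) i) 0)"
    by (rule higher_deriv_compose[OF eopen_V3 C_infinity_on_dtri[OF j] sgerm_trip[OF b(1) a(1) v(1)] W])
  also have "\<dots> = jet_comp d3 k (dtri j) (\<lambda>l i. (deriv ^^ l) (\<lambda>t. trip (b t) (a t) (v' t) i) 0)"
  proof (rule jet_comp_cong)
    have "v 0 = v' 0"
      by (rule esp_eqI[OF v(2)]) (use jets[of 0] in \<open>auto simp: v'_def esp_iff\<close>)
    then show "(\<lambda>i. (deriv ^^ 0) (\<lambda>t. trip (b t) (a t) (v t) i) 0) = (\<lambda>i. (deriv ^^ 0) (\<lambda>t. trip (b t) (a t) (v' t) i) 0)"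
      by simp
    show "(deriv ^^ l) (\<lambda>t. trip (b t) (a t) (v t) i) 0 = (deriv ^^ l) (\<lambda>t. trip (b t) (a t) (v' t) i) 0"
      if "l \<le> k" "i < d3" for l i
      unfolding higher_deriv_trip using that k jets[of l "i - (d + d)"] by (auto simp: trip_apply)
  qed
  also have "\<dots> = (deriv ^^ k) (\<lambda>t. dtri j (trip (b t) (a t) (v' t))) 0"
    by (rule higher_deriv_compose[OF eopen_V3 C_infinity_on_dtri[OF j] sgerm_trip[OF b(1) a(1) v'] V', symmetric])
  also have "\<dots> = (deriv ^^ k) (\<lambda>t. u t j) 0"
  proof (rule higher_deriv_ev_cong)
    show "\<forall>\<^sub>F t in nhds 0. dtri j (trip (b t) (a t) (v' t)) = u t j"
      using a(2) b(2) by eventually_elim (unfold v'_def, rule dtri_dtri, use u(2) j in auto)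
  qed
  finally show ?thesis .
qed

end

section \<open>Products of a zero-section element and a prolongation\<close>

lemma jets_at_unique:
  assumes M: "smooth_atlas M" and A: "A \<in> jets_at m M x" "A \<in> jets_at m M y" shows "x = y"
proof -
  have "jet_base A = z" if "A \<in> jets_at m M z" for z
    using that jet_base_jet[OF M] unfolding jets_at_def by blast
  then show ?thesis using A by metis
qed

text \<open>The image of the pair \<open>(A, B)\<close> under the isomorphism to be constructed; to
  factor \<open>X\<close> is to solve \<open>jet_product m G A B = X\<close>.\<close>

definition jet_product :: "nat \<Rightarrow> 'a lie \<Rightarrow> (real \<Rightarrow> 'a) set \<Rightarrow> (real \<Rightarrow> 'a) set \<Rightarrow> (real \<Rightarrow> (real \<Rightarrow> 'a) set) set" where
  "jet_product m G A B = jet_mult 1 (tangent_group m G) (zero_section m G A) (prolongation (Suc m) G B)"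

text \<open>The zero section is represented by the constant curve \<open>A\<close>, so the product
  is the class of \<open>s \<mapsto> A [t \<mapsto> c(s + t)]\<close>, whose value at
  \<open>s = 0\<close> is the base jet.\<close>

lemma
  assumes G: "lie_group G" and A: "A \<in> jets_at m (mfd G) x" and c: "curve (mfd G) c"
  shows jet_product_eq: "jet_product m G A (jet (Suc m) (mfd G) c) =
      jet 1 (jet_manifold m (mfd G)) (\<lambda>s. jet_mult m G A (shift_jets m (mfd G) c s))"
    and curve_jet_product: "curve (jet_manifold m (mfd G)) (\<lambda>s. jet_mult m G A (shift_jets m (mfd G) c s))"
    and jet_base_jet_product: "jet_base (jet_product m G A (jet (Suc m) (mfd G) c)) = jet_mult m G A (jet m (mfd G) c)"
proof -
  note atl = lie_group_atlas[OF G]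
  note T = lie_group_tangent_group[OF G, of m]
  note J = smooth_atlas_jet[OF atl, of m]
  have "A \<in> points (jet_manifold m (mfd G))" using A by (auto simp: jets_at_def)
  then have cA: "curve (mfd (tangent_group m G)) (\<lambda>_. A)" using curve_const[OF J] by simp
  have cs: "curve (mfd (tangent_group m G)) (shift_jets m (mfd G) c)" using curve_shift_jets'[OF atl c] by simp
  show eq: "jet_product m G A (jet (Suc m) (mfd G) c) =
      jet 1 (jet_manifold m (mfd G)) (\<lambda>s. jet_mult m G A (shift_jets m (mfd G) c s))"
    using jet_mult_jet[OF T cA cs, of 1] by (simp add: jet_product_def zero_section_def prolongation_jet[OF atl c])
  show cu: "curve (jet_manifold m (mfd G)) (\<lambda>s. jet_mult m G A (shift_jets m (mfd G) c s))"
    using curve_mult[OF T cA cs] by simp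
  show "jet_base (jet_product m G A (jet (Suc m) (mfd G) c)) = jet_mult m G A (jet m (mfd G) c)"
    unfolding eq jet_base_jet[OF J cu] shift_jets_0 ..
qed

context group_chart
begin

abbreviation JM :: "nat \<Rightarrow> (real \<Rightarrow> 'a) set manifold" where "JM m \<equiv> jet_manifold m M"
abbreviation coords1 :: "nat \<Rightarrow> (real \<Rightarrow> (real \<Rightarrow> 'a) set) set \<Rightarrow> nat \<Rightarrow> real" where
  "coords1 m \<equiv> jet_coords 1 (JM m) (jet_coords m M \<phi>)"
abbreviation dom1 :: "nat \<Rightarrow> (real \<Rightarrow> (real \<Rightarrow> 'a) set) set set" where
  "dom1 m \<equiv> jet_dom 1 (JM m) (jet_dom m M D)"

text \<open>With \<open>A\<close> the jet of \<open>w c^(-1)\<close> the product is represented by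
  \<open>s \<mapsto> [t \<mapsto> tri (w t, c t, c (s + t))]\<close>. At \<open>s = 0\<close> this
  is the jet of \<open>w\<close>, as \<open>tri (x, y, y) = x\<close>; its derivative in
  \<open>s\<close> comes from \<open>dtri_tri_commute\<close>.\<close>

lemma
  fixes m :: nat
  assumes w: "cin w" and c: "cin c" and wc: "w 0 = c 0"
  defines "X \<equiv> jet_product m G (jet_mult m G (jet m M w) (jet m M (\<lambda>t. inv\<^bsub>G\<^esub> c t))) (jet (Suc m) M c)"
  shows jet_product_dom: "X \<in> dom1 m"
    and jet_product_base_coords: "k \<le> m \<Longrightarrow> j < d \<Longrightarrow> coords1 m X (k * d + j) = cderiv k \<phi> w j"
    and jet_product_fibre_coords: "k \<le> m \<Longrightarrow> j < d \<Longrightarrow> coords1 m X (Suc m * d + (k * d + j)) =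
      (deriv ^^ k) (\<lambda>t. dtri j (trip (\<phi> (w t)) (\<phi> (c t)) (vel c t))) 0"
proof -
  note J = smooth_atlas_jet[OF atl, of m]
  note cw = cin_curve[OF w] and cc = cin_curve[OF c]
  note cA = curve_mult[OF lie cw curve_inv[OF lie cc]]
  define A where "A = jet_mult m G (jet m M w) (jet m M (\<lambda>t. inv\<^bsub>G\<^esub> c t))"
  have A: "A = jet m M (\<lambda>t. w t \<otimes>\<^bsub>G\<^esub> inv\<^bsub>G\<^esub> c t)"
    unfolding A_def by (rule jet_mult_jet[OF lie cw curve_inv[OF lie cc]])
  then have Aat: "A \<in> jets_at m M (w 0 \<otimes>\<^bsub>G\<^esub> inv\<^bsub>G\<^esub> c 0)" using cA by (auto simp: jets_at_def)
  define R where "R s = jet_mult m G A (shift_jets m M c s)" for s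
  have X: "X = jet 1 (JM m) R" and cR: "curve (JM m) R"
    using jet_product_eq[OF lie Aat cc] curve_jet_product[OF lie Aat cc] by (simp_all add: X_def A_def R_def[abs_def])
  have R: "\<forall>\<^sub>F s in nhds 0. R s = jet m M (\<lambda>t. tri (w t, c t, c (s + t)))"
    using eventually_shift_curve[OF atl cc]
    by eventually_elim (simp add: R_def shift_jets_def A jet_mult_jet[OF lie cA] tri_def)
  have "\<forall>\<^sub>F t in nhds 0. w t = tri (w t, c t, c t)"
    using cin_D[OF w] cin_D[OF c] by eventually_elim (simp add: tri_same D_carrier)
  from jet_germ_cong[OF atl cw this] have R0: "R 0 = jet m M w"
    using eventually_nhds_x_imp_x[OF R] by simp
  have R0D: "R 0 \<in> jet_dom m M D" unfolding R0 by (rule jet_in_dom[OF cw curve_in_0[OF w]])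
  show "X \<in> dom1 m" unfolding X by (rule jet_in_dom[OF cR R0D])
  have co: "coords1 m X (l * (Suc m * d) + i) = cderiv l (jet_coords m M \<phi>) R i" if "l \<le> 1" "i < Suc m * d" for l i
    using jet_coords_at[OF J cR in_atlas_jet[OF chart] R0D that(1), of i] that(2) unfolding X jet_manifold_simps by blast
  show "coords1 m X (k * d + j) = cderiv k \<phi> w j" if kj: "k \<le> m" "j < d"
    using co[OF _ jet_index(1)[OF kj], of 0] jet_coords_at[OF atl cw chart curve_in_0[OF w] kj] by (simp add: R0)
  show "coords1 m X (Suc m * d + (k * d + j)) = (deriv ^^ k) (\<lambda>t. dtri j (trip (\<phi> (w t)) (\<phi> (c t)) (vel c t))) 0"
    if kj: "k \<le> m" "j < d"
  proof -
    have "\<forall>\<^sub>F s in nhds 0. tri (w 0, c 0, c s) \<in> D" by (rule cin_D[OF cin_tri[OF curve_in_0[OF w] c]])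
    with R eventually_shift_curve[OF atl cc]
    have "\<forall>\<^sub>F s in nhds 0. jet_coords m M \<phi> (R s) (k * d + j) = (deriv ^^ k) (\<lambda>t. \<phi> (tri (w t, c t, c (s + t))) j) 0"
    proof eventually_elim
      case (elim s)
      then show ?case using jet_coords_at[OF atl curve_tri[OF cw cc elim(2)] chart _ kj] by simp
    qed
    then have "deriv (\<lambda>s. jet_coords m M \<phi> (R s) (k * d + j)) 0 =
        deriv (\<lambda>s. (deriv ^^ k) (\<lambda>t. \<phi> (tri (w t, c t, c (s + t))) j) 0) 0"
      by (rule deriv_cong_ev) simp
    then show ?thesis
      using co[OF order_refl jet_index(1)[OF kj]] dtri_tri_commute[OF w c wc kj(2), of k] by simp
  qed
qed

section \<open>The recursive solution\<close>

text \<open>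
  Given the coordinates \<open>u\<close> of the class of \<open>s \<mapsto> [t \<mapsto> w(s, t)]\<close>, \<open>sol m u\<close> is the sequence of derivatives at \<open>0\<close> of the
  solution \<open>c\<close> of \<open>c' = dtri(c, w(0, \<cdot>), \<partial>\<^sub>sw(0, \<cdot>))\<close>, \<open>c(0) = w(0, 0)\<close>.
\<close>

fun sol :: "nat \<Rightarrow> (nat \<Rightarrow> real) \<Rightarrow> nat \<Rightarrow> nat \<Rightarrow> real" where
  "sol m u 0 = take_coords d u"
| "sol m u (Suc k) = (\<lambda>j. if j < d then jet_comp d3 k (dtri j) (\<lambda>l. trip (if l \<le> k then sol m u l else (\<lambda>_. 0))
     (blk d u l) (blk d (drop_coords (Suc m * d) u) l)) else 0)"

lemma blk_esp: "blk d u k \<in> esp d"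
  by (simp add: blk_def esp_iff)

text \<open>Strong induction through \<open>C_infinity_on_jet_comp\<close>. The guard
  \<open>l \<le> k\<close> in \<open>sol\<close> secures termination and holds for all orders that
  \<open>jet_comp\<close> reads.\<close>

lemma C_infinity_on_sol:
  fixes m :: nat
  defines "V \<equiv> {u \<in> esp (Suc 1 * (Suc m * d)). take_coords d u \<in> \<phi> ` D}"
  shows "C_infinity_on (Suc 1 * (Suc m * d)) V (\<lambda>u. sol m u k j)"
proof (induction k arbitrary: j rule: less_induct)
  case (less k)
  have V: "eopen (Suc 1 * (Suc m * d)) V"
    unfolding V_def by (rule eopen_take[OF chart_eopen[OF atl chart]]) simp
  show ?case
  proof (cases k)
    case 0
    then show ?thesis by (simp add: C_infinity_on_take del: mult_Suc)
  next
    case (Suc k')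
    show ?thesis
    proof (cases "j < d")
      case True
      have "C_infinity_on (Suc 1 * (Suc m * d)) V (\<lambda>u. jet_comp d3 k' (dtri j) (\<lambda>l. trip (if l \<le> k' then sol m u l else (\<lambda>_. 0))
         (blk d u l) (blk d (drop_coords (Suc m * d) u) l)))"
      proof (rule C_infinity_on_jet_comp[OF V eopen_V3 C_infinity_on_dtri[OF True]])
        fix l i assume l: "l \<le> k'" and i: "i < d3"
        have blk: "C_infinity_on (Suc 1 * (Suc m * d)) V (\<lambda>u. blk d u l i)" for i by (rule C_infinity_on_blk)
        have drop: "C_infinity_on (Suc 1 * (Suc m * d)) V (\<lambda>u. blk d (drop_coords (Suc m * d) u) l i)" for i
          by (cases "i < d") (simp_all add: blk_def drop_coords_def del: mult_Suc)
        have "C_infinity_on (Suc 1 * (Suc m * d)) V (\<lambda>u. (if l \<le> k' then sol m u l else (\<lambda>_. 0)) i)" for i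
          using less.IH[of l i] l Suc by simp
        then show "C_infinity_on (Suc 1 * (Suc m * d)) V (\<lambda>u. trip (if l \<le> k' then sol m u l else (\<lambda>_. 0))
           (blk d u l) (blk d (drop_coords (Suc m * d) u) l) i)"
          by (intro C_infinity_on_trip[OF _ _ _ i] blk drop)
      next
        fix u assume "u \<in> V"
        then have "take_coords d u \<in> \<phi> ` D" by (simp add: V_def)
        then show "trip (if 0 \<le> k' then sol m u 0 else (\<lambda>_. 0)) (blk d u 0) (blk d (drop_coords (Suc m * d) u) 0) \<in> V3"
          by (simp only: blk_0 sol.simps(1) if_P le0) (intro trip_in_V3 take_esp)
      qed
      then show ?thesis using True by (simp add: Suc del: mult_Suc)
    qed (simp add: Suc del: mult_Suc)
  qed
qed

text \<open>\<open>u\<close> is the coordinate vector of the class to be factored; \<open>w\<close>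
  realizes its base part and \<open>v\<close> its fibre part, in place of a two-parameter
  map.\<close>

context
  fixes m :: nat and u :: "nat \<Rightarrow> real" and w c :: "real \<Rightarrow> 'a" and v :: "real \<Rightarrow> nat \<Rightarrow> real"
  assumes w: "cin w" and c: "cin c"
    and wu: "\<And>l i. l \<le> m \<Longrightarrow> i < d \<Longrightarrow> cderiv l \<phi> w i = u (l * d + i)"
    and v: "\<And>i. i < d \<Longrightarrow> sgerm (\<lambda>t. v t i)" "\<And>t. v t \<in> esp d"
    and vu: "\<And>l i. l \<le> m \<Longrightarrow> i < d \<Longrightarrow> (deriv ^^ l) (\<lambda>t. v t i) 0 = u (Suc m * d + (l * d + i))"
begin

lemma take_coords_eq: "take_coords d u = \<phi> (w 0)"
  by (rule esp_eqI[OF take_esp \<phi>_esp[OF curve_in_0[OF w]]]) (use wu[of 0] in \<open>simp add: take_coords_def\<close>)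

text \<open>By \<open>jet_comp\<close>, the derivative of order \<open>k\<close> of the right side
  involves \<open>c\<close> only up to order \<open>k\<close>. Inserting the prescribed data for
  \<open>w\<close> and \<open>v\<close> and the earlier values for \<open>c\<close> gives the
  recursion of \<open>sol\<close>.\<close>

lemma sol_step:
  assumes k: "k \<le> m" and prev: "\<And>l i. l \<le> k \<Longrightarrow> i < d \<Longrightarrow> cderiv l \<phi> c i = sol m u l i" and j: "j < d"
  shows "(deriv ^^ k) (\<lambda>t. dtri j (trip (\<phi> (c t)) (\<phi> (w t)) (v t))) 0 = sol m u (Suc k) j"
proof -
  have "\<forall>\<^sub>F t in nhds 0. trip (\<phi> (c t)) (\<phi> (w t)) (v t) \<in> V3"
    using cin_D[OF c] cin_D[OF w] by eventually_elim (intro trip_in_V3 imageI v(2))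
  moreover have "sgerm (\<lambda>t. trip (\<phi> (c t)) (\<phi> (w t)) (v t) i)" if "i < d3" for i
    by (rule sgerm_trip[OF _ _ v(1) that]) (use w c in \<open>auto simp: curve_in_def\<close>)
  ultimately have "(deriv ^^ k) (\<lambda>t. dtri j (trip (\<phi> (c t)) (\<phi> (w t)) (v t))) 0 =
      jet_comp d3 k (dtri j) (\<lambda>l i. (deriv ^^ l) (\<lambda>t. trip (\<phi> (c t)) (\<phi> (w t)) (v t) i) 0)"
    by (intro higher_deriv_compose[OF eopen_V3 C_infinity_on_dtri[OF j]])
  also have "\<dots> = jet_comp d3 k (dtri j) (\<lambda>l. trip (if l \<le> k then sol m u l else (\<lambda>_. 0))
      (blk d u l) (blk d (drop_coords (Suc m * d) u) l))"
  proof (rule jet_comp_cong)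
    have "\<phi> (c 0) = take_coords d u"
      by (rule esp_eqI[OF \<phi>_esp[OF curve_in_0[OF c]] take_esp]) (use prev[of 0] in simp)
    moreover have "v 0 = blk d (drop_coords (Suc m * d) u) 0"
      by (rule esp_eqI[OF v(2) blk_esp]) (use vu[of 0] in \<open>simp add: blk_def drop_coords_def add.commute\<close>)
    ultimately show "(\<lambda>i. (deriv ^^ 0) (\<lambda>t. trip (\<phi> (c t)) (\<phi> (w t)) (v t) i) 0) =
        trip (if 0 \<le> k then sol m u 0 else (\<lambda>_. 0)) (blk d u 0) (blk d (drop_coords (Suc m * d) u) 0)"
      by (simp add: blk_0 take_coords_eq del: mult_Suc)
    fix l i assume l: "l \<le> k" and i: "i < d3"
    then have "l \<le> m" using k by simp
    have "cderiv l \<phi> w j = blk d u l j" "(deriv ^^ l) (\<lambda>t. v t j) 0 = blk d (drop_coords (Suc m * d) u) l j" if "j < d" for j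
      using that wu[OF \<open>l \<le> m\<close> that] vu[OF \<open>l \<le> m\<close> that]
      by (simp_all add: blk_def drop_coords_def add.commute add.left_commute del: mult_Suc)
    moreover have "i < d + d \<Longrightarrow> i - d < d \<or> i < d" "i - (d + d) < d" using i by linarith+
    ultimately show "(deriv ^^ l) (\<lambda>t. trip (\<phi> (c t)) (\<phi> (w t)) (v t) i) 0 = trip (if l \<le> k then sol m u l else (\<lambda>_. 0))
        (blk d u l) (blk d (drop_coords (Suc m * d) u) l) i"
      unfolding higher_deriv_trip trip_apply using l prev[OF l, of i]
      by (cases "i < d"; cases "i < d + d") auto
  qed
  finally show ?thesis using j by simp
qed

text \<open>The equation at order \<open>k\<close> yields the derivative of \<open>c\<close> of
  order \<open>Suc k\<close>, which explains \<open>m\<close> on one side and \<open>Suc m\<close>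
  on the other. Order \<open>0\<close> on the right corresponds to equality of the base
  points.\<close>

lemma sol_iff:
  "(w 0 = c 0 \<and> (\<forall>k\<le>m. \<forall>j<d. (deriv ^^ k) (\<lambda>t. dtri j (trip (\<phi> (c t)) (\<phi> (w t)) (v t))) 0 = cderiv (Suc k) \<phi> c j)) \<longleftrightarrow>
    (\<forall>k\<le>Suc m. \<forall>j<d. cderiv k \<phi> c j = sol m u k j)"
proof
  assume l: "w 0 = c 0 \<and> (\<forall>k\<le>m. \<forall>j<d. (deriv ^^ k) (\<lambda>t. dtri j (trip (\<phi> (c t)) (\<phi> (w t)) (v t))) 0 = cderiv (Suc k) \<phi> c j)"
  have "cderiv k \<phi> c j = sol m u k j" if "k \<le> Suc m" "j < d" for k j
    using that
  proof (induction k arbitrary: j rule: less_induct)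
    case (less k)
    show ?case
    proof (cases k)
      case 0
      then show ?thesis using l by (simp add: take_coords_eq)
    next
      case (Suc k')
      have "(deriv ^^ k') (\<lambda>t. dtri j (trip (\<phi> (c t)) (\<phi> (w t)) (v t))) 0 = sol m u (Suc k') j"
        by (rule sol_step) (use less Suc in auto)
      then show ?thesis using l less.prems Suc by (auto simp del: sol.simps funpow.simps)
    qed
  qed
  then show "\<forall>k\<le>Suc m. \<forall>j<d. cderiv k \<phi> c j = sol m u k j" by blast
next
  assume r: "\<forall>k\<le>Suc m. \<forall>j<d. cderiv k \<phi> c j = sol m u k j"
  have "\<phi> (w 0) = \<phi> (c 0)"
    by (rule esp_eqI) (use r \<phi>_esp curve_in_0[OF w] curve_in_0[OF c] take_coords_eq in \<open>auto dest: spec[of _ "0::nat"]\<close>)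
  then have "w 0 = c 0" by (rule \<phi>_inj[OF curve_in_0[OF w] curve_in_0[OF c]])
  moreover have "(deriv ^^ k) (\<lambda>t. dtri j (trip (\<phi> (c t)) (\<phi> (w t)) (v t))) 0 = cderiv (Suc k) \<phi> c j" if "k \<le> m" "j < d" for k j
  proof -
    have "(deriv ^^ k) (\<lambda>t. dtri j (trip (\<phi> (c t)) (\<phi> (w t)) (v t))) 0 = sol m u (Suc k) j"
      by (rule sol_step) (use r that in auto)
    also have "\<dots> = cderiv (Suc k) \<phi> c j" using r that by (simp del: sol.simps funpow.simps)
    finally show ?thesis .
  qed
  ultimately show "w 0 = c 0 \<and> (\<forall>k\<le>m. \<forall>j<d. (deriv ^^ k) (\<lambda>t. dtri j (trip (\<phi> (c t)) (\<phi> (w t)) (v t))) 0 = cderiv (Suc k) \<phi> c j)"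
    by blast
qed

end

text \<open>The left side is the fibre condition as it arises from the product, the right side is
  solved for the velocity of \<open>c\<close>. Each direction is an instance of
  \<open>dtri_transfer\<close>, the second with \<open>w\<close> exchanged with \<open>c\<close> and
  \<open>vel c\<close> with \<open>v\<close>.\<close>

lemma dtri_vel_iff:
  assumes w: "cin w" and c: "cin c" and v: "\<And>i. i < d \<Longrightarrow> sgerm (\<lambda>t. v t i)" "\<And>t. v t \<in> esp d"
  shows "(\<forall>k\<le>m. \<forall>j<d. (deriv ^^ k) (\<lambda>t. dtri j (trip (\<phi> (w t)) (\<phi> (c t)) (vel c t))) 0 = (deriv ^^ k) (\<lambda>t. v t j) 0) \<longleftrightarrow>
    (\<forall>k\<le>m. \<forall>j<d. (deriv ^^ k) (\<lambda>t. dtri j (trip (\<phi> (c t)) (\<phi> (w t)) (v t))) 0 = cderiv (Suc k) \<phi> c j)"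
proof -
  have gw: "sgerm (\<lambda>t. \<phi> (w t) i)" and gc: "sgerm (\<lambda>t. \<phi> (c t) i)" if "i < d" for i
    using w c that by (auto simp: curve_in_def)
  have Dw: "\<forall>\<^sub>F t in nhds 0. \<phi> (w t) \<in> \<phi> ` D" using cin_D[OF w] by eventually_elim simp
  have Dc: "\<forall>\<^sub>F t in nhds 0. \<phi> (c t) \<in> \<phi> ` D" using cin_D[OF c] by eventually_elim simp
  have vel: "sgerm (\<lambda>t. vel c t i)" if "i < d" for i using sgerm_deriv[OF gc[OF that]] that by (simp add: vel_def)
  have vel_esp: "vel c t \<in> esp d" for t by (simp add: vel_def esp_iff)
  have hvel: "(deriv ^^ k) (\<lambda>t. vel c t j) 0 = cderiv (Suc k) \<phi> c j" if "j < d" for k j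
    unfolding higher_deriv_Suc using that by (simp add: vel_def)
  show ?thesis
    using dtri_transfer[OF gw Dw gc Dc vel vel_esp v, of m] dtri_transfer[OF gc Dc gw Dw v vel vel_esp, of m] hvel
    by (auto simp del: funpow.simps)
qed

text \<open>Base jets satisfy \<open>A [c] = [w]\<close> in \<open>tangent_group m G\<close>, which
  determines \<open>A\<close>; the base points agree because \<open>A\<close> lies over the
  identity.\<close>

lemma jet_product_factor:
  assumes A: "A \<in> jets_at m M \<one>\<^bsub>G\<^esub>" and c: "curve M c" and w: "curve M w"
    and eq: "jet_base (jet_product m G A (jet (Suc m) M c)) = jet m M w"
  shows "w 0 = c 0" "A = jet_mult m G (jet m M w) (jet m M (\<lambda>t. inv\<^bsub>G\<^esub> c t))"
proof -
  interpret T: group "tangent_group m G" by (rule group_tangent_group[OF lie])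
  have AC: "jet_mult m G A (jet m M c) = jet m M w" using eq unfolding jet_base_jet_product[OF lie A c] .
  have at: "jet m M c \<in> jets_at m M (c 0)" "jet m M w \<in> jets_at m M (w 0)" using c w by (auto simp: jets_at_def)
  have "c 0 \<in> carrier G" using curve_point[OF atl c] lie_group_points[OF lie] by simp
  then have "jet m M w \<in> jets_at m M (c 0)" using jets_at_mult[OF lie A at(1)] by (simp add: AC)
  then show "w 0 = c 0" using jets_at_unique[OF atl _ at(2)] by simp
  have car: "A \<in> carrier (tangent_group m G)" "jet m M c \<in> carrier (tangent_group m G)"
    using A jets_at_subset[of m G "\<one>\<^bsub>G\<^esub>"] c by auto
  have "A = A \<otimes>\<^bsub>tangent_group m G\<^esub> jet m M c \<otimes>\<^bsub>tangent_group m G\<^esub> inv\<^bsub>tangent_group m G\<^esub> jet m M c"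
    using T.m_assoc[OF car T.inv_closed[OF car(2)]] T.r_inv[OF car(2)] T.r_one[OF car(1)] by simp
  then show "A = jet_mult m G (jet m M w) (jet m M (\<lambda>t. inv\<^bsub>G\<^esub> c t))"
    unfolding inv_tangent_group[OF lie c] by (simp add: AC)
qed

section \<open>Factorizations characterized by coordinates\<close>

definition sol_coords :: "nat \<Rightarrow> (nat \<Rightarrow> real) \<Rightarrow> nat \<Rightarrow> real" where
  "sol_coords m u = (\<lambda>i. if i < Suc (Suc m) * d then sol m u (i div d) (i mod d) else 0)"

text \<open>Existence, uniqueness and smooth dependence of \<open>B\<close> all come from this
  equivalence, whose right side prescribes the coordinates of \<open>B\<close> as a fixed function
  of those of \<open>X\<close>. \<open>A\<close> is eliminated by \<open>jet_product_factor\<close>;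
  the remaining fibre condition passes through \<open>dtri_vel_iff\<close> and
  \<open>sol_iff\<close>.\<close>

lemma factor_iff:
  assumes X: "X \<in> dom1 m" and B: "B \<in> points (JM (Suc m))"
  shows "(\<exists>A\<in>jets_at m M \<one>\<^bsub>G\<^esub>. jet_product m G A B = X) \<longleftrightarrow>
    B \<in> jet_dom (Suc m) M D \<and> jet_coords (Suc m) M \<phi> B = sol_coords m (coords1 m X)"
proof -
  note J = smooth_atlas_jet[OF atl, of m]
  obtain c where cc: "curve M c" and Bc: "B = jet (Suc m) M c" using B by auto
  obtain R where R: "curve (JM m) R" "R 0 \<in> jet_dom m M D" "X = jet 1 (JM m) R" using X unfolding jet_dom_def by blast
  obtain w where cw: "curve M w" and w0: "w 0 \<in> D" and Rw: "R 0 = jet m M w" using R(2) unfolding jet_dom_def by blast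
  have base: "jet_base X = jet m M w" unfolding R(3) jet_base_jet[OF J R(1)] Rw ..
  have w: "cin w" by (rule curve_in_chart[OF atl cw chart w0])
  define u where "u = coords1 m X"
  have tk: "take_coords (Suc m * d) u = jet_coords m M \<phi> (R 0)"
    using take_jet_coords[OF J R(1) in_atlas_jet[OF chart] R(2), of 1] unfolding u_def R(3) jet_manifold_simps .
  have "u i = jet_coords m M \<phi> (jet m M w) i" if "i < Suc m * d" for i
    using fun_cong[OF tk, of i] that unfolding Rw take_coords_def by (simp only: if_True)
  then have wu: "cderiv l \<phi> w i = u (l * d + i)" if "l \<le> m" "i < d" for l i
    using jet_coords_at[OF atl cw chart w0 that] jet_index(1)[OF that] by simp
  \<comment> \<open>Any germ with these derivatives represents the fibre part of \<open>X\<close>;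
    the Taylor polynomial is one.\<close>
  define v where "v t = (\<lambda>i. if i < d then taylor m (\<lambda>l. u (Suc m * d + (l * d + i))) t else 0)" for t
  have v: "sgerm (\<lambda>t. v t i)" if "i < d" for i using that sgerm_taylor by (simp add: v_def del: mult_Suc)
  have v_esp: "v t \<in> esp d" for t by (simp add: v_def esp_iff)
  have vu: "(deriv ^^ l) (\<lambda>t. v t i) 0 = u (Suc m * d + (l * d + i))" if "l \<le> m" "i < d" for l i
    using that higher_deriv_taylor by (simp add: v_def del: mult_Suc)
  show ?thesis
  proof (cases "c 0 \<in> D")
    \<comment> \<open>Both sides fail here: a factorization would force \<open>c 0 = w 0\<close>,
      which lies in the chart.\<close>
    case False
    have "B \<notin> jet_dom (Suc m) M D"
    proof
      assume "B \<in> jet_dom (Suc m) M D"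
      then obtain c' where "curve M c'" "c' 0 \<in> D" "B = jet (Suc m) M c'" unfolding jet_dom_def by blast
      then show False using False jet_base_jet[OF atl cc, of "Suc m"] jet_base_jet[OF atl, of c' "Suc m"] Bc by simp
    qed
    moreover have "jet_product m G A B \<noteq> X" if A: "A \<in> jets_at m M \<one>\<^bsub>G\<^esub>" for A
    proof
      assume "jet_product m G A B = X"
      then have "w 0 = c 0" using jet_product_factor(1)[OF A cc cw] base Bc by simp
      then show False using False w0 by simp
    qed
    ultimately show ?thesis by blast
  next
    case True
    have c: "cin c" by (rule curve_in_chart[OF atl cc chart True])
    let ?A = "jet_mult m G (jet m M w) (jet m M (\<lambda>t. inv\<^bsub>G\<^esub> c t))"
    let ?P = "\<forall>k\<le>m. \<forall>j<d. (deriv ^^ k) (\<lambda>t. dtri j (trip (\<phi> (w t)) (\<phi> (c t)) (vel c t))) 0 = (deriv ^^ k) (\<lambda>t. v t j) 0"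
    have P: "jet_product m G ?A B = X \<longleftrightarrow> ?P" if wc: "w 0 = c 0"
    proof
      assume eq: "jet_product m G ?A B = X"
      show ?P
      proof (intro allI impI)
        fix k j assume kj: "k \<le> m" "j < d"
        show "(deriv ^^ k) (\<lambda>t. dtri j (trip (\<phi> (w t)) (\<phi> (c t)) (vel c t))) 0 = (deriv ^^ k) (\<lambda>t. v t j) 0"
          using jet_product_fibre_coords[OF w c wc kj] vu[OF kj] eq unfolding Bc u_def by simp
      qed
    next
      assume P: ?P
      have "coords1 m (jet_product m G ?A B) = coords1 m X"
      proof (rule esp_eqI)
        show "coords1 m (jet_product m G ?A B) \<in> esp (Suc 1 * (Suc m * d))" "coords1 m X \<in> esp (Suc 1 * (Suc m * d))"
          using jet_coords_esp[of 1 "JM m"] by simp_all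
        fix i assume i: "i < Suc 1 * (Suc m * d)"
        note i' = jet_index'[OF i]
        define r where "r = i mod (Suc m * d)"
        have r: "r < Suc m * d" using i'(2) by (simp only: r_def)
        note r' = jet_index'[OF r]
        \<comment> \<open>The quotient of \<open>i\<close> by \<open>Suc m * d\<close> is the order
          in \<open>s\<close>, which is \<open>0\<close> for the base part and \<open>1\<close> for
          the fibre part.\<close>
        consider "i = r" | "i = Suc m * d + r" using i' unfolding r_def by (cases "i div (Suc m * d)") auto
        then show "coords1 m (jet_product m G ?A B) i = coords1 m X i"
        proof cases
          case 1
          show ?thesis
            using jet_product_base_coords[OF w c wc r'(1,2)] wu[OF r'(1,2)] unfolding r'(3) Bc u_def 1 by simp
        next
          case 2
          show ?thesis
            using jet_product_fibre_coords[OF w c wc r'(1,2)] vu[OF r'(1,2)] P r'(1,2) unfolding r'(3) Bc u_def 2 by simp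
        qed
      qed
      then show "jet_product m G ?A B = X"
        using jet_coords_inj[OF J in_atlas_jet[OF chart], of 1] jet_product_dom[OF w c wc, of m] X Bc
        unfolding inj_on_def by blast
    qed
    have Aat: "?A \<in> jets_at m M \<one>\<^bsub>G\<^esub>" if "w 0 = c 0"
    proof -
      have "c 0 \<in> carrier G" using True D_carrier by simp
      moreover have "?A \<in> jets_at m M (w 0 \<otimes>\<^bsub>G\<^esub> inv\<^bsub>G\<^esub> c 0)"
        by (rule jets_at_mult[OF lie]) (use cw curve_inv[OF lie cc] in \<open>auto simp: jets_at_def\<close>)
      ultimately show ?thesis using that by simp
    qed
    have "(\<exists>A\<in>jets_at m M \<one>\<^bsub>G\<^esub>. jet_product m G A B = X) \<longleftrightarrow> w 0 = c 0 \<and> ?P"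
    proof
      assume "\<exists>A\<in>jets_at m M \<one>\<^bsub>G\<^esub>. jet_product m G A B = X"
      then obtain A where A: "A \<in> jets_at m M \<one>\<^bsub>G\<^esub>" "jet_product m G A B = X" by blast
      have "jet_base (jet_product m G A (jet (Suc m) M c)) = jet m M w" using A(2) base Bc by simp
      note f = jet_product_factor[OF A(1) cc cw this]
      show "w 0 = c 0 \<and> ?P" using f(1) P[OF f(1)] A(2) f(2) by blast
    next
      assume "w 0 = c 0 \<and> ?P"
      then show "\<exists>A\<in>jets_at m M \<one>\<^bsub>G\<^esub>. jet_product m G A B = X" using P Aat by blast
    qed
    also have "?P \<longleftrightarrow> (\<forall>k\<le>m. \<forall>j<d. (deriv ^^ k) (\<lambda>t. dtri j (trip (\<phi> (c t)) (\<phi> (w t)) (v t))) 0 = cderiv (Suc k) \<phi> c j)"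
      by (rule dtri_vel_iff[OF w c v v_esp])
    also have "(w 0 = c 0 \<and> \<dots>) \<longleftrightarrow> (\<forall>k\<le>Suc m. \<forall>j<d. cderiv k \<phi> c j = sol m u k j)"
      by (rule sol_iff[OF w c wu v v_esp vu])
    also have "\<dots> \<longleftrightarrow> jet_coords (Suc m) M \<phi> B = sol_coords m u"
    proof
      assume l: "\<forall>k\<le>Suc m. \<forall>j<d. cderiv k \<phi> c j = sol m u k j"
      show "jet_coords (Suc m) M \<phi> B = sol_coords m u"
        unfolding Bc jet_coords_jet[OF atl cc chart True] sol_coords_def
        by (rule ext) (use l jet_index'(1,2) in \<open>simp del: mult_Suc sol.simps funpow.simps\<close>)
    next
      assume r: "jet_coords (Suc m) M \<phi> B = sol_coords m u"
      show "\<forall>k\<le>Suc m. \<forall>j<d. cderiv k \<phi> c j = sol m u k j"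
      proof (intro allI impI)
        fix k j assume kj: "k \<le> Suc m" "j < d"
        have "cderiv k \<phi> c j = sol_coords m u (k * d + j)"
          using jet_coords_at[OF atl cc chart True kj] r Bc by simp
        then show "cderiv k \<phi> c j = sol m u k j" using jet_index[OF kj] by (simp add: sol_coords_def del: mult_Suc sol.simps funpow.simps)
      qed
    qed
    finally show ?thesis using jet_in_dom[OF cc True, of "Suc m"] Bc unfolding u_def by simp
  qed
qed

text \<open>The block of order \<open>0\<close> is taken over from \<open>X\<close>, so the vector
  lies in the image of the jet chart and belongs to an actual jet. This is the existence half of the
  factorization.\<close>

lemma sol_coords_in:
  assumes X: "X \<in> dom1 m"
  shows "\<exists>B\<in>jet_dom (Suc m) M D. jet_coords (Suc m) M \<phi> B = sol_coords m (coords1 m X)"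
    and "take_coords d (coords1 m X) \<in> \<phi> ` D"
proof -
  note J = smooth_atlas_jet[OF atl, of m]
  obtain R where R: "curve (JM m) R" "R 0 \<in> jet_dom m M D" "X = jet 1 (JM m) R" using X unfolding jet_dom_def by blast
  have "take_coords (Suc m * d) (coords1 m X) = jet_coords m M \<phi> (R 0)"
    using take_jet_coords[OF J R(1) in_atlas_jet[OF chart] R(2), of 1] unfolding R(3) jet_manifold_simps .
  moreover have "take_coords d (take_coords (Suc m * d) z) = take_coords d z" for z
    by (auto simp: take_coords_def)
  moreover have "take_coords d (jet_coords m M \<phi> (R 0)) \<in> \<phi> ` D"
    using R(2) jet_coords_image[OF atl chart, of m] by blast
  ultimately show t: "take_coords d (coords1 m X) \<in> \<phi> ` D" by metis
  have "take_coords d (sol_coords m (coords1 m X)) = take_coords d (coords1 m X)"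
    by (auto simp: take_coords_def sol_coords_def)
  then have "sol_coords m (coords1 m X) \<in> {u \<in> esp (Suc (Suc m) * d). take_coords d u \<in> \<phi> ` D}"
    using t by (simp add: esp_iff sol_coords_def)
  then have "sol_coords m (coords1 m X) \<in> jet_coords (Suc m) M \<phi> ` jet_dom (Suc m) M D"
    by (simp only: jet_coords_image[OF atl chart])
  then show "\<exists>B\<in>jet_dom (Suc m) M D. jet_coords (Suc m) M \<phi> B = sol_coords m (coords1 m X)"
    by (metis imageE)
qed

end

section \<open>The second factor as a globally defined smooth map\<close>

definition jet_factor :: "nat \<Rightarrow> 'a lie \<Rightarrow> (real \<Rightarrow> (real \<Rightarrow> 'a) set) set \<Rightarrow> (real \<Rightarrow> 'a) set" where
  "jet_factor m G X = (THE B. B \<in> points (jet_manifold (Suc m) (mfd G)) \<and>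
     (\<exists>A\<in>jets_at m (mfd G) \<one>\<^bsub>G\<^esub>. jet_product m G A B = X))"

lemma jet_dom_points: "jet_dom n M D \<subseteq> points (jet_manifold n M)"
  by (auto simp: jet_dom_def)

lemma (in group_chart) jet_factor_ex1:
  assumes X: "X \<in> dom1 m"
  shows "\<exists>!B. B \<in> points (JM (Suc m)) \<and> (\<exists>A\<in>jets_at m M \<one>\<^bsub>G\<^esub>. jet_product m G A B = X)"
proof -
  obtain B where B: "B \<in> jet_dom (Suc m) M D" "jet_coords (Suc m) M \<phi> B = sol_coords m (coords1 m X)"
    using sol_coords_in(1)[OF X] by blast
  show ?thesis
  proof (rule ex1I[of _ B])
    have Bp: "B \<in> points (JM (Suc m))" using B(1) jet_dom_points by blast
    then show "B \<in> points (JM (Suc m)) \<and> (\<exists>A\<in>jets_at m M \<one>\<^bsub>G\<^esub>. jet_product m G A B = X)"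
      using factor_iff[OF X Bp] B by blast
    fix C assume C: "C \<in> points (JM (Suc m)) \<and> (\<exists>A\<in>jets_at m M \<one>\<^bsub>G\<^esub>. jet_product m G A C = X)"
    then have "C \<in> jet_dom (Suc m) M D" "jet_coords (Suc m) M \<phi> C = sol_coords m (coords1 m X)"
      using factor_iff[OF X, of C] by blast+
    then show "C = B" using jet_coords_inj[OF atl chart, of "Suc m"] B unfolding inj_on_def by simp
  qed
qed

lemma (in group_chart) smooth_rep_jet_factor:
  "smooth_rep (Suc 1 * (Suc m * d)) (dom1 m) (coords1 m) (Suc (Suc m) * d) (jet_dom (Suc m) M D) (jet_coords (Suc m) M \<phi>)
    (jet_factor m G) X" if "X \<in> dom1 m"
proof (rule smooth_repI[where U = "{u \<in> esp (Suc 1 * (Suc m * d)). take_coords d u \<in> \<phi> ` D}" and g = "sol_coords m"])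
  show "eopen (Suc 1 * (Suc m * d)) {u \<in> esp (Suc 1 * (Suc m * d)). take_coords d u \<in> \<phi> ` D}"
    by (rule eopen_take[OF chart_eopen[OF atl chart]]) simp
  show "coords1 m X \<in> {u \<in> esp (Suc 1 * (Suc m * d)). take_coords d u \<in> \<phi> ` D}"
    using sol_coords_in(2)[OF that] jet_coords_esp[of 1 "JM m"] by simp
  fix Y assume Y: "Y \<in> dom1 m"
  have f: "jet_factor m G Y \<in> points (JM (Suc m))" "\<exists>A\<in>jets_at m M \<one>\<^bsub>G\<^esub>. jet_product m G A (jet_factor m G Y) = Y"
    using theI'[OF jet_factor_ex1[OF Y]] unfolding jet_factor_def by blast+
  then have f': "jet_factor m G Y \<in> jet_dom (Suc m) M D" "jet_coords (Suc m) M \<phi> (jet_factor m G Y) = sol_coords m (coords1 m Y)"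
    using factor_iff[OF Y f(1)] by blast+
  then show "jet_factor m G Y \<in> jet_dom (Suc m) M D"
    "jet_coords (Suc m) M \<phi> (jet_factor m G Y) i = sol_coords m (coords1 m Y) i" for i by simp_all
  show "jet_coords (Suc m) M \<phi> (jet_factor m G Y) \<in> esp (Suc (Suc m) * d)" by (rule jet_coords_esp)
next
  fix i assume "i < Suc (Suc m) * d"
  then show "C_infinity_on (Suc 1 * (Suc m * d)) {u \<in> esp (Suc 1 * (Suc m * d)). take_coords d u \<in> \<phi> ` D} (\<lambda>u. sol_coords m u i)"
    using C_infinity_on_sol[of m "i div d" "i mod d"] by (simp add: sol_coords_def del: mult_Suc)
qed

lemma group_chart_exists:
  assumes G: "lie_group G" and X: "X \<in> points (jet_manifold 1 (jet_manifold m (mfd G)))"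
  obtains D \<phi> where "group_chart G D \<phi>" "X \<in> jet_dom 1 (jet_manifold m (mfd G)) (jet_dom m (mfd G) D)"
proof -
  note M = lie_group_atlas[OF G]
  note J = smooth_atlas_jet[OF M, of m]
  obtain R where R: "curve (jet_manifold m (mfd G)) R" "X = jet 1 (jet_manifold m (mfd G)) R" using X by auto
  obtain C \<theta> where C: "(C, \<theta>) \<in> atlas (jet_manifold m (mfd G))" "R 0 \<in> C" using chart_exists[OF J curve_point[OF J R(1)]] .
  then obtain D \<phi> where D: "(D, \<phi>) \<in> atlas (mfd G)" "C = jet_dom m (mfd G) D" unfolding atlas_jet_manifold by blast
  show ?thesis
  proof
    show "group_chart G D \<phi>" using G D by (simp add: group_chart_def)
    show "X \<in> jet_dom 1 (jet_manifold m (mfd G)) (jet_dom m (mfd G) D)"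
      unfolding R(2) using jet_in_dom[OF R(1)] C D by simp
  qed
qed

lemma jet_factor_ex1:
  assumes G: "lie_group G" and X: "X \<in> points (jet_manifold 1 (jet_manifold m (mfd G)))"
  shows "\<exists>!B. B \<in> points (jet_manifold (Suc m) (mfd G)) \<and> (\<exists>A\<in>jets_at m (mfd G) \<one>\<^bsub>G\<^esub>. jet_product m G A B = X)"
  using group_chart_exists[OF G X] group_chart.jet_factor_ex1 by metis

lemma smooth_map_jet_factor:
  assumes G: "lie_group G"
  shows "smooth_map (jet_manifold 1 (jet_manifold m (mfd G))) (jet_manifold (Suc m) (mfd G)) (jet_factor m G)"
proof (rule smooth_mapI)
  note M = lie_group_atlas[OF G]
  show "smooth_atlas (jet_manifold 1 (jet_manifold m (mfd G)))" "smooth_atlas (jet_manifold (Suc m) (mfd G))"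
    by (intro smooth_atlas_jet M)+
  fix X assume "X \<in> points (jet_manifold 1 (jet_manifold m (mfd G)))"
  then obtain D \<phi> where gc: "group_chart G D \<phi>" and X: "X \<in> jet_dom 1 (jet_manifold m (mfd G)) (jet_dom m (mfd G) D)"
    using group_chart_exists[OF G] by blast
  note D = group_chart.chart[OF gc]
  show "\<exists>C \<theta> E \<psi>. (C, \<theta>) \<in> atlas (jet_manifold 1 (jet_manifold m (mfd G))) \<and> (E, \<psi>) \<in> atlas (jet_manifold (Suc m) (mfd G)) \<and> X \<in> C \<and>
      smooth_rep (mdim (jet_manifold 1 (jet_manifold m (mfd G)))) C \<theta> (mdim (jet_manifold (Suc m) (mfd G))) E \<psi> (jet_factor m G) X"
    using in_atlas_jet[OF in_atlas_jet[OF D]] in_atlas_jet[OF D, of "Suc m"] X group_chart.smooth_rep_jet_factor[OF gc X]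
    unfolding jet_manifold_simps by blast
qed

theorem proposition5p4:
  fixes G :: "'a lie" and n :: nat
  assumes "lie_group G" and "n \<ge> 1"
  shows "\<exists>lact ract \<Phi>.
    mutual_actions (tangent_group_at_one (n - 1) G) (tangent_group n G) lact ract \<and>
    lie_group_iso
      (double_cross_product (tangent_group_at_one (n - 1) G) (tangent_group n G) lact ract)
      (tangent_group 1 (tangent_group (n - 1) G))
      \<Phi> \<and>
    (\<forall>A\<in>carrier (tangent_group_at_one (n - 1) G).
       \<Phi> (A, \<one>\<^bsub>tangent_group n G\<^esub>) = zero_section (n - 1) G A) \<and>
    (\<forall>B\<in>carrier (tangent_group n G).
       \<Phi> (\<one>\<^bsub>tangent_group_at_one (n - 1) G\<^esub>, B) = prolongation n G B)"
proof -
  note G = assms(1)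
  obtain m where n: "n = Suc m" using assms(2) by (cases n) auto
  note M = lie_group_atlas[OF G]
  note J = smooth_atlas_jet[OF M, of m]
  note T = lie_group_tangent_group[OF G, of m]
  let ?K = "tangent_group_at_one m G" and ?H = "tangent_group (Suc m) G" and ?L = "tangent_group 1 (tangent_group m G)"
  note K = lie_group_at_one[OF G, of m] and H = lie_group_tangent_group[OF G, of "Suc m"] and L = lie_group_tangent_group[OF T, of 1]
  interpret T: group "tangent_group m G" by (rule lie_group_group[OF T])
  interpret L: group ?L by (rule lie_group_group[OF L])
  let ?i = "zero_section m G" and ?p = "prolongation (Suc m) G"
  let ?b = "jet_factor m G"
  \<comment> \<open>If \<open>X\<close> is the product belonging to \<open>(A, B)\<close>, its base
    jet is \<open>A\<close> times the truncation of \<open>B\<close>; dividing by that truncation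
    recovers \<open>A\<close>.\<close>
  let ?a = "\<lambda>X. jet_base X \<otimes>\<^bsub>tangent_group m G\<^esub> inv\<^bsub>tangent_group m G\<^esub> (jet_trunc m (mfd G) (?b X))"
  have carL: "carrier ?L = points (jet_manifold 1 (jet_manifold m (mfd G)))" by simp
  have prod: "?i A \<otimes>\<^bsub>?L\<^esub> ?p B = jet_product m G A B" for A B by (simp add: jet_product_def)
  have p_in: "jet_product m G A B \<in> carrier ?L" if "A \<in> carrier ?K" "B \<in> carrier ?H" for A B
    unfolding prod[symmetric]
    by (rule L.m_closed[OF hom_in_carrier[OF zero_section_hom[OF G] that(1)] hom_in_carrier[OF prolongation_hom[OF G] that(2)]])
  have b: "?b (jet_product m G A B) = B" if A: "A \<in> carrier ?K" and B: "B \<in> carrier ?H" for A B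
    unfolding jet_factor_def
    by (rule the1_equality[OF jet_factor_ex1[OF G]]) (use p_in[OF A B] A B in auto)
  have a: "?a (jet_product m G A B) = A" if A: "A \<in> carrier ?K" and B: "B \<in> carrier ?H" for A B
  proof -
    obtain c where c: "curve (mfd G) c" "B = jet (Suc m) (mfd G) c" using B by auto
    have A': "A \<in> jets_at m (mfd G) \<one>\<^bsub>G\<^esub>" "A \<in> carrier (tangent_group m G)"
      using A jets_at_subset[of m G "\<one>\<^bsub>G\<^esub>"] by auto
    have C: "jet m (mfd G) c \<in> carrier (tangent_group m G)" using c(1) by auto
    have "jet_base (jet_product m G A B) = A \<otimes>\<^bsub>tangent_group m G\<^esub> jet m (mfd G) c"
      unfolding c(2) jet_base_jet_product[OF G A'(1) c(1)] by simp
    moreover have "jet_trunc m (mfd G) (?b (jet_product m G A B)) = jet m (mfd G) c"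
      unfolding b[OF A B] unfolding c(2) by (rule jet_trunc_jet[OF M c(1)]) simp
    ultimately show ?thesis
      using T.m_assoc[OF A'(2) C T.inv_closed[OF C]] T.r_inv[OF C] T.r_one[OF A'(2)] by (simp only:)
  qed
  have ex: "\<exists>A\<in>carrier ?K. \<exists>B\<in>carrier ?H. jet_product m G A B = X" if "X \<in> carrier ?L" for X
    using ex1_implies_ex[OF jet_factor_ex1[OF G, of X m]] that by auto
  have sb: "smooth_map (mfd ?L) (mfd ?H) ?b" using smooth_map_jet_factor[OF G] by simp
  have "smooth_map (mfd ?L) (mfd (tangent_group m G)) ?a"
  proof (intro smooth_map_mult[OF T lie_group_atlas[OF L]] smooth_map_inv[OF T lie_group_atlas[OF L]])
    show "smooth_map (mfd ?L) (mfd (tangent_group m G)) jet_base" using smooth_map_jet_base[OF J, of 1] by simp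
    have "smooth_map (mfd ?H) (mfd (tangent_group m G)) (jet_trunc m (mfd G))" using smooth_map_jet_trunc[OF M, of m "Suc m"] by simp
    from smooth_map_compose[OF lie_group_atlas[OF L] lie_group_atlas[OF H] lie_group_atlas[OF T] sb this]
    show "smooth_map (mfd ?L) (mfd (tangent_group m G)) (\<lambda>X. jet_trunc m (mfd G) (?b X))" .
  qed
  then have "smooth_map (mfd ?L) (jet_manifold m (mfd G)) ?a" by (simp only: tangent_group_simps(4))
  \<comment> \<open>Smoothness was obtained with values in \<open>tangent_group m G\<close>. That
    the values lie over the identity follows from the existence of a factorization, and the codomain
    may then be restricted.\<close>
  then have sa: "smooth_map (mfd ?L) (mfd ?K) ?a"
  proof (rule smooth_map_into_at_one[OF G lie_group_atlas[OF L]])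
    fix X assume "X \<in> points (mfd ?L)"
    then have "X \<in> carrier ?L" by (simp only: lie_group_points[OF L])
    then obtain A B where AB: "A \<in> carrier ?K" "B \<in> carrier ?H" "jet_product m G A B = X" using ex by blast
    from a[OF AB(1,2)] AB(1) show "?a X \<in> jets_at m (mfd G) \<one>\<^bsub>G\<^esub>"
      by (simp only: AB(3) tangent_group_at_one_simps(1))
  qed
  have fac: "?i (?a X) \<otimes>\<^bsub>?L\<^esub> ?p (?b X) = X" if X: "X \<in> carrier ?L" for X
  proof -
    obtain A B where AB: "A \<in> carrier ?K" "B \<in> carrier ?H" "jet_product m G A B = X" using ex[OF X] by blast
    from a[OF AB(1,2)] b[OF AB(1,2)] AB(3) show ?thesis by (simp only: AB(3) prod)
  qed
  have si: "smooth_map (mfd ?K) (mfd ?L) ?i" using smooth_map_zero_section[OF G] by simp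
  have sp: "smooth_map (mfd ?H) (mfd ?L) ?p" using smooth_map_prolongation[OF M] by simp
  have a_eq: "?a (?i A \<otimes>\<^bsub>?L\<^esub> ?p B) = A" if "A \<in> carrier ?K" "B \<in> carrier ?H" for A B
    unfolding prod by (rule a[OF that])
  have b_eq: "?b (?i A \<otimes>\<^bsub>?L\<^esub> ?p B) = B" if "A \<in> carrier ?K" "B \<in> carrier ?H" for A B
    unfolding prod by (rule b[OF that])
  note dcp = double_cross_product_factorization[where i = ?i and p = ?p and a = ?a and b = ?b,
      OF L K H zero_section_hom[OF G] si prolongation_hom[OF G] sp sa sb fac a_eq b_eq]
  let ?lact = "\<lambda>h k. ?a (?p h \<otimes>\<^bsub>?L\<^esub> ?i k)" and ?ract = "\<lambda>h k. ?b (?p h \<otimes>\<^bsub>?L\<^esub> ?i k)"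
  let ?\<Phi> = "\<lambda>(k, h). ?i k \<otimes>\<^bsub>?L\<^esub> ?p h"
  have 1: "mutual_actions ?K ?H ?lact ?ract" by (rule dcp(1))
  have 2: "lie_group_iso (double_cross_product ?K ?H ?lact ?ract) ?L ?\<Phi>" by (rule dcp(2))
  have 3: "?\<Phi> (A, \<one>\<^bsub>?H\<^esub>) = ?i A" if "A \<in> carrier ?K" for A
    unfolding prod.case hom_one[OF prolongation_hom[OF G] lie_group_group[OF H] lie_group_group[OF L]]
    by (rule L.r_one[OF hom_in_carrier[OF zero_section_hom[OF G] that]])
  have 4: "?\<Phi> (\<one>\<^bsub>?K\<^esub>, B) = ?p B" if "B \<in> carrier ?H" for B
    unfolding prod.case hom_one[OF zero_section_hom[OF G] lie_group_group[OF K] lie_group_group[OF L]]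
    by (rule L.l_one[OF hom_in_carrier[OF prolongation_hom[OF G] that]])
  show ?thesis unfolding n diff_Suc_1 using 1 2 3 4 by blast
qed

end
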